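(* Let $M$ be a compact orientable manifold with a chosen oriented atlas, let $\lambda_0,\delta\in\mathbb R$, put $\mu_0=\lambda_0+\delta$, and let $\Delta\colon \mathcal F_{\lambda_0}(M)\to\mathcal F_{\mu_0}(M)$ be an arbitrary second order linear differential operator of weight $\delta$. Suppose $\lambda_0\neq 0$, $\mu_0\neq 1$ and $\lambda_0+\mu_0\neq 1$. Then there exists a unique normalized self-adjoint pencil $\{\Delta_\lambda\}_{\lambda\in\mathbb R}$ of second order operators of weight $\delta$, i.e. a unique pencil of the form $$\Delta_\lambda=\frac{|D(x)|^\delta}{2}\Bigl(S^{ab}\partial_a\partial_b+\partial_bS^{ba}\,\partial_a+(2\lambda+\delta-1)\gamma^a\partial_a+\lambda\,\partial_a\gamma^a+\lambda(\lambda+\delta-1)\theta\Bigr),$$ that passes through $\Delta$, i.e. such that $\Delta_\lambda|_{\lambda=\lambda_0}=\Delta$. Moreover, if in local coordinates $\Delta=|D(x)|^\delta\bigl(A^{ab}\partial_a\partial_b+A^a\partial_a+A\bigr)$ with $A^{ab}=A^{ba}$, then the relations $$\tfrac12S^{ab}=A^{ab},\qquad \tfrac12\bigl((2\lambda_0+\delta-1)\gamma^a+\partial_bS^{ba}\bigr)=A^a,\qquad \tfrac12\bigl(\lambda_0\,\partial_a\gamma^a+\lambda_0(\lambda_0+\delta-1)\theta\bigr)=A$$ uniquely define the principal symbol $S^{ab}$, the upper connection $\gamma^a$ and the Brans–Dicke function $\theta$, which determine the pencil $\Delta_\lambda$.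
   Context: A density of weight $\lambda\in\mathbb R$ on $M$ is an object $\mathbf s=s(x)|D(x)|^\lambda$ whose coefficient is multiplied by the $\lambda$th power of the Jacobian: $s(x)|D(x)|^\lambda=s(x(x'))\left|\det\frac{\partial x}{\partial x'}\right|^\lambda|D(x')|^\lambda$, where $|D(x)|$ is the coordinate volume element. $\mathcal F_\lambda(M)$ is the space of smooth densities of weight $\lambda$. An operator has weight $\delta$ if it maps densities of weight $\lambda$ to densities of weight $\lambda+\delta$. Local operators written as $|D(x)|^\delta(\dots)$ act on the coefficient $s(x)$ and produce the coefficient of $|D(x)|^{\lambda+\delta}$. Derivatives such as $\partial_bS^{ba}$ and $\partial_a\gamma^a$ are functions (divergences of the coefficients), and repeated indices are summed. There is a canonical pairing $\langle s_1|D(x)|^{\lambda_1},s_2|D(x)|^{\lambda_2}\rangle=\int_Ms_1s_2|D(x)|$ if $\lambda_1+\lambda_2=1$, and $0$ otherwise. The adjoint of an operator $\mathcal F_\lambda\to\mathcal F_{\lambda+\delta}$ is an operator $\mathcal F_{1-\lambda-\delta}\to\mathcal F_{1-\lambda}$. A pencil of operators $\Delta_\lambda\colon\mathcal F_\lambda\to\mathcal F_{\lambda+\delta}$, $\lambda\in\mathbb R$, of second order is a family of the form $\Delta_\lambda=L|_{\mathcal F_\lambda}$, where $L$ is a differential operator of order $\le 2$ and weight $\delta$ on the algebra of densities, i.e. locally $L=t^\delta\bigl(P^{ab}\partial_a\partial_b+\hat\lambda Q^a\partial_a+\hat\lambda^2 C+D^a\partial_a+\hat\lambda E+G\bigr)$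 with coefficients depending on $x$, where $t=|D(x)|$ and $\hat\lambda$ acts on $\mathcal F_\lambda$ as multiplication by $\lambda$. The pencil is self-adjoint if $(\Delta_\lambda)^+=\Delta_{1-\lambda-\delta}$ for all $\lambda$, and normalized if $\Delta_0(1)=0$. The coefficients of a pencil of the displayed form transform, under a change of coordinates $x'=x'(x)$ with $J=\det(\partial x'/\partial x)>0$, as follows: $S^{a'b'}=J^{-\delta}\frac{\partial x^{a'}}{\partial x^a}\frac{\partial x^{b'}}{\partial x^b}S^{ab}$ (symmetric tensor density of weight $\delta$, called the principal symbol); $\gamma^{a'}=J^{-\delta}\frac{\partial x^{a'}}{\partial x^a}(\gamma^a+S^{ab}\partial_b\log J)$ (upper connection of weight $\delta$); $\theta'=J^{-\delta}(\theta+2\gamma^a\partial_a\log J+\partial_a\log J\,S^{ab}\partial_b\log J)$ (Brans–Dicke function). *)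

theory Defs
  imports "HOL-Analysis.Analysis"
begin

text \<open>Meaningful for open \<open>U\<close> only: the derivatives at the points of \<open>U\<close> are unrestricted.\<close>

fun times_differentiable_on ::
  "nat \<Rightarrow> ('a::real_normed_vector \<Rightarrow> 'b::real_normed_vector) \<Rightarrow> 'a set \<Rightarrow> bool" where
  "times_differentiable_on 0 f U \<longleftrightarrow> continuous_on U f"
| "times_differentiable_on (Suc k) f U \<longleftrightarrow>
     (\<forall>x\<in>U. f differentiable (at x)) \<and>
     (\<forall>v. times_differentiable_on k (\<lambda>x. frechet_derivative f (at x) v) U)"

definition smooth_on ::
  "('a::real_normed_vector \<Rightarrow> 'b::real_normed_vector) \<Rightarrow> 'a set \<Rightarrow> bool" where
  "smooth_on f U \<longleftrightarrow> (\<forall>k. times_differentiable_on k f U)"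

definition pd :: "'n::finite \<Rightarrow> (real ^ 'n \<Rightarrow> real) \<Rightarrow> real ^ 'n \<Rightarrow> real" where
  "pd a f x = frechet_derivative f (at x) (axis a 1)"

definition divergence :: "(real ^ 'n::finite \<Rightarrow> real ^ 'n) \<Rightarrow> real ^ 'n \<Rightarrow> real" where
  "divergence V x = (\<Sum>a\<in>UNIV. pd a (\<lambda>y. V y $ a) x)"

text \<open>The vector field with components \<open>\<partial>\<^sub>b S\<^sup>b\<^sup>a\<close>.\<close>
definition tensor_divergence ::
  "(real ^ 'n::finite \<Rightarrow> real ^ 'n ^ 'n) \<Rightarrow> real ^ 'n \<Rightarrow> real ^ 'n" where
  "tensor_divergence S x = (\<chi> a. \<Sum>b\<in>UNIV. pd b (\<lambda>y. S y $ b $ a) x)"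

text \<open>A chart is a pair of its domain and its coordinate map; the values of the map outside the
  domain are irrelevant.\<close>

type_synonym ('m, 'n) chart = "'m set \<times> ('m \<Rightarrow> real ^ 'n)"

definition coord_range :: "('m, 'n::finite) chart \<Rightarrow> (real ^ 'n) set" where
  "coord_range c = snd c ` fst c"

definition is_chart :: "'m topology \<Rightarrow> ('m, 'n::finite) chart \<Rightarrow> bool" where
  "is_chart X c \<longleftrightarrow> openin X (fst c) \<and> open (coord_range c) \<and>
     homeomorphic_map (subtopology X (fst c)) (top_of_set (coord_range c)) (snd c)"

text \<open>If \<open>c\<close> has coordinates \<open>x\<close> and \<open>c'\<close> has coordinates \<open>x'\<close>, then \<open>transition c c'\<close> is the
  map \<open>x \<mapsto> x'(x)\<close>, defined on \<open>overlap c c'\<close>.\<close>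

definition overlap :: "('m, 'n::finite) chart \<Rightarrow> ('m, 'n) chart \<Rightarrow> (real ^ 'n) set" where
  "overlap c c' = snd c ` (fst c \<inter> fst c')"

definition transition ::
  "('m, 'n::finite) chart \<Rightarrow> ('m, 'n) chart \<Rightarrow> real ^ 'n \<Rightarrow> real ^ 'n" where
  "transition c c' = snd c' \<circ> inv_into (fst c) (snd c)"

definition jac :: "('m, 'n::finite) chart \<Rightarrow> ('m, 'n) chart \<Rightarrow> real ^ 'n \<Rightarrow> real ^ 'n ^ 'n" where
  "jac c c' x = jacobian (transition c c') (at x)"

definition oriented_atlas :: "'m topology \<Rightarrow> ('m, 'n::finite) chart set \<Rightarrow> bool" where
  "oriented_atlas X A \<longleftrightarrow>
     (\<forall>c\<in>A. is_chart X c) \<and> (\<Union>c\<in>A. fst c) = topspace X \<and>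
     (\<forall>c\<in>A. \<forall>c'\<in>A. smooth_on (transition c c') (overlap c c') \<and>
        (\<forall>x\<in>overlap c c'. 0 < det (jac c c' x)))"

text \<open>Second countability is not listed: it follows from compactness.\<close>

definition compact_oriented_manifold :: "'m topology \<Rightarrow> ('m, 'n::finite) chart set \<Rightarrow> bool" where
  "compact_oriented_manifold X A \<longleftrightarrow>
     compact_space X \<and> Hausdorff_space X \<and> oriented_atlas X A"

text \<open>A density \<open>s(x) |D(x)|\<^sup>w\<close> is given by its coefficient \<open>s c\<close> in each chart \<open>c\<close> of the atlas.
  To have one function per density, coefficients are set to \<open>0\<close> where they are meaningless.\<close>

type_synonym ('m, 'n) density = "('m, 'n) chart \<Rightarrow> real ^ 'n \<Rightarrow> real"

definition densities :: "('m, 'n::finite) chart set \<Rightarrow> real \<Rightarrow> ('m, 'n) density set" where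
  "densities A w = {s.
     (\<forall>c x. c \<notin> A \<or> x \<notin> coord_range c \<longrightarrow> s c x = 0) \<and>
     (\<forall>c\<in>A. smooth_on (s c) (coord_range c)) \<and>
     (\<forall>c\<in>A. \<forall>c'\<in>A. \<forall>x'\<in>overlap c' c.
        s c' x' = s c (transition c' c x') * \<bar>det (jac c' c x')\<bar> powr w)}"

definition unit_density :: "('m, 'n::finite) chart set \<Rightarrow> ('m, 'n) density" where
  "unit_density A = (\<lambda>c x. if c \<in> A \<and> x \<in> coord_range c then 1 else 0)"

text \<open>Integral over the manifold of a density of weight 1: choose finitely many charts that cover
  the manifold, cut it into the Borel pieces \<open>U\<^sub>i - (\<Union>j<i. U\<^sub>j)\<close>, and integrate over each piece in
  its own coordinates. On a compact manifold a finite cover exists, the integrals converge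
  absolutely, and by the change of variables formula the value does not depend on the choice.\<close>

definition finite_cover :: "('m, 'n::finite) chart set \<Rightarrow> ('m, 'n) chart list" where
  "finite_cover A = (SOME cs. set cs \<subseteq> A \<and> (\<Union>c\<in>set cs. fst c) = (\<Union>c\<in>A. fst c))"

definition density_integral :: "('m, 'n::finite) chart set \<Rightarrow> ('m, 'n) density \<Rightarrow> real" where
  "density_integral A s = (let cs = finite_cover A in
     \<Sum>i<length cs. integral (snd (cs ! i) ` (fst (cs ! i) - (\<Union>j<i. fst (cs ! j)))) (s (cs ! i)))"

definition pairing ::
  "('m, 'n::finite) chart set \<Rightarrow> real \<Rightarrow> ('m, 'n) density \<Rightarrow> real \<Rightarrow> ('m, 'n) density \<Rightarrow> real" where
  "pairing A w1 s1 w2 s2 =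
     (if w1 + w2 = 1 then density_integral A (\<lambda>c x. s1 c x * s2 c x) else 0)"

text \<open>Operators between spaces of densities are extensional functions, so that equality of
  functions is equality of operators.\<close>

type_synonym ('m, 'n) operator = "('m, 'n) density \<Rightarrow> ('m, 'n) density"

definition operators ::
  "('m, 'n::finite) chart set \<Rightarrow> real \<Rightarrow> real \<Rightarrow> ('m, 'n) operator set" where
  "operators A \<delta> w = densities A w \<rightarrow>\<^sub>E densities A (w + \<delta>)"

text \<open>\<open>T'\<close> is the adjoint of \<open>T\<close>, an operator of weight \<open>\<delta>\<close> on densities of weight \<open>w\<close>.\<close>
definition is_adjoint ::
  "('m, 'n::finite) chart set \<Rightarrow> real \<Rightarrow> real \<Rightarrow> ('m, 'n) operator \<Rightarrow> ('m, 'n) operator \<Rightarrow> bool" where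
  "is_adjoint A \<delta> w T T' \<longleftrightarrow>
     T' \<in> operators A \<delta> (1 - w - \<delta>) \<and>
     (\<forall>s1\<in>densities A w. \<forall>s2\<in>densities A (1 - w - \<delta>).
        pairing A (w + \<delta>) (T s1) (1 - w - \<delta>) s2 = pairing A w s1 (1 - w) (T' s2))"

definition op2 ::
  "(real ^ 'n::finite \<Rightarrow> real ^ 'n ^ 'n) \<Rightarrow> (real ^ 'n \<Rightarrow> real ^ 'n) \<Rightarrow> (real ^ 'n \<Rightarrow> real) \<Rightarrow>
    (real ^ 'n \<Rightarrow> real) \<Rightarrow> real ^ 'n \<Rightarrow> real" where
  "op2 P V W f x =
     (\<Sum>a\<in>UNIV. \<Sum>b\<in>UNIV. P x $ a $ b * pd a (pd b f) x) + (\<Sum>a\<in>UNIV. V x $ a * pd a f x) + W x * f x"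

definition local_form ::
  "('m, 'n::finite) chart set \<Rightarrow> real \<Rightarrow> ('m, 'n) operator \<Rightarrow> ('m, 'n) chart \<Rightarrow>
    (real ^ 'n \<Rightarrow> real ^ 'n ^ 'n) \<Rightarrow> (real ^ 'n \<Rightarrow> real ^ 'n) \<Rightarrow> (real ^ 'n \<Rightarrow> real) \<Rightarrow> bool" where
  "local_form A w T c P V W \<longleftrightarrow>
     smooth_on P (coord_range c) \<and> smooth_on V (coord_range c) \<and> smooth_on W (coord_range c) \<and>
     (\<forall>s\<in>densities A w. \<forall>x\<in>coord_range c. T s c x = op2 P V W (s c) x)"

definition second_order_operator ::
  "('m, 'n::finite) chart set \<Rightarrow> real \<Rightarrow> real \<Rightarrow> ('m, 'n) operator \<Rightarrow> bool" where
  "second_order_operator A \<delta> w T \<longleftrightarrow>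
     T \<in> operators A \<delta> w \<and> (\<forall>c\<in>A. \<exists>P V W. local_form A w T c P V W)"

text \<open>An operator of weight \<open>\<delta>\<close> on the algebra of densities (the direct sum over all weights) is
  the family of its restrictions \<open>D w\<close> to the densities of weight \<open>w\<close>. For a differential operator
  of order at most 2 on the algebra, the coefficients are those of
  \<open>P\<^sup>a\<^sup>b \<partial>\<^sub>a \<partial>\<^sub>b + w Q\<^sup>a \<partial>\<^sub>a + w\<^sup>2 C + V\<^sup>a \<partial>\<^sub>a + w E + G\<close>, and they do not depend on \<open>w\<close>.\<close>

definition second_order_pencil ::
  "('m, 'n::finite) chart set \<Rightarrow> real \<Rightarrow> (real \<Rightarrow> ('m, 'n) operator) \<Rightarrow> bool" where
  "second_order_pencil A \<delta> D \<longleftrightarrow>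
     (\<forall>w. D w \<in> operators A \<delta> w) \<and>
     (\<forall>c\<in>A. \<exists>P Q C V E G.
        smooth_on P (coord_range c) \<and> smooth_on Q (coord_range c) \<and> smooth_on C (coord_range c) \<and>
        smooth_on V (coord_range c) \<and> smooth_on E (coord_range c) \<and> smooth_on G (coord_range c) \<and>
        (\<forall>w. \<forall>s\<in>densities A w. \<forall>x\<in>coord_range c.
           D w s c x =
             op2 P (\<lambda>y. w *\<^sub>R Q y + V y) (\<lambda>y. w\<^sup>2 * C y + w * E y + G y) (s c) x))"

definition self_adjoint_pencil ::
  "('m, 'n::finite) chart set \<Rightarrow> real \<Rightarrow> (real \<Rightarrow> ('m, 'n) operator) \<Rightarrow> bool" where
  "self_adjoint_pencil A \<delta> D \<longleftrightarrow> (\<forall>w. is_adjoint A \<delta> w (D w) (D (1 - w - \<delta>)))"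

definition normalized_pencil ::
  "('m, 'n::finite) chart set \<Rightarrow> (real \<Rightarrow> ('m, 'n) operator) \<Rightarrow> bool" where
  "normalized_pencil A D \<longleftrightarrow> D 0 (unit_density A) = (\<lambda>c x. 0)"

definition normalized_self_adjoint_pencil ::
  "('m, 'n::finite) chart set \<Rightarrow> real \<Rightarrow> (real \<Rightarrow> ('m, 'n) operator) \<Rightarrow> bool" where
  "normalized_self_adjoint_pencil A \<delta> D \<longleftrightarrow>
     second_order_pencil A \<delta> D \<and> self_adjoint_pencil A \<delta> D \<and> normalized_pencil A D"

text \<open>Geometric objects are given, like densities, by their components in each chart.\<close>

type_synonym ('m, 'n) tensor_field = "('m, 'n) chart \<Rightarrow> real ^ 'n \<Rightarrow> real ^ 'n ^ 'n"
type_synonym ('m, 'n) vector_field = "('m, 'n) chart \<Rightarrow> real ^ 'n \<Rightarrow> real ^ 'n"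
type_synonym ('m, 'n) scalar_field = "('m, 'n) chart \<Rightarrow> real ^ 'n \<Rightarrow> real"

definition canonical_pencil ::
  "('m, 'n::finite) chart set \<Rightarrow> real \<Rightarrow>
    ('m, 'n) tensor_field \<Rightarrow> ('m, 'n) vector_field \<Rightarrow> ('m, 'n) scalar_field \<Rightarrow>
    (real \<Rightarrow> ('m, 'n) operator) \<Rightarrow> bool" where
  "canonical_pencil A \<delta> S \<gamma> \<theta> D \<longleftrightarrow>
     (\<forall>w. D w \<in> operators A \<delta> w) \<and>
     (\<forall>c\<in>A. smooth_on (S c) (coord_range c) \<and> smooth_on (\<gamma> c) (coord_range c) \<and>
        smooth_on (\<theta> c) (coord_range c) \<and>
        (\<forall>x\<in>coord_range c. \<forall>a b. S c x $ a $ b = S c x $ b $ a) \<and>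
        (\<forall>w. \<forall>s\<in>densities A w. \<forall>x\<in>coord_range c.
           D w s c x = 1 / 2 *
             ((\<Sum>a\<in>UNIV. \<Sum>b\<in>UNIV. S c x $ a $ b * pd a (pd b (s c)) x)
              + (\<Sum>a\<in>UNIV. tensor_divergence (S c) x $ a * pd a (s c) x)
              + (2 * w + \<delta> - 1) * (\<Sum>a\<in>UNIV. \<gamma> c x $ a * pd a (s c) x)
              + w * divergence (\<gamma> c) x * s c x
              + w * (w + \<delta> - 1) * \<theta> c x * s c x)))"

text \<open>Transformation laws from \<open>c\<close> (coordinates \<open>x\<close>) to \<open>c'\<close> (coordinates \<open>x'\<close>);
  \<open>jac c c' x $ p $ a\<close> is \<open>\<partial>x'\<^sup>p / \<partial>x\<^sup>a\<close> and \<open>log_jac c c'\<close> is \<open>log J\<close>.\<close>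

definition log_jac :: "('m, 'n::finite) chart \<Rightarrow> ('m, 'n) chart \<Rightarrow> real ^ 'n \<Rightarrow> real" where
  "log_jac c c' x = ln (det (jac c c' x))"

definition principal_symbol ::
  "('m, 'n::finite) chart set \<Rightarrow> real \<Rightarrow> ('m, 'n) tensor_field \<Rightarrow> bool" where
  "principal_symbol A \<delta> S \<longleftrightarrow>
     (\<forall>c\<in>A. smooth_on (S c) (coord_range c) \<and>
        (\<forall>x\<in>coord_range c. \<forall>a b. S c x $ a $ b = S c x $ b $ a)) \<and>
     (\<forall>c\<in>A. \<forall>c'\<in>A. \<forall>x\<in>overlap c c'. \<forall>p q.
        S c' (transition c c' x) $ p $ q =
          det (jac c c' x) powr (- \<delta>) *
          (\<Sum>a\<in>UNIV. \<Sum>b\<in>UNIV. jac c c' x $ p $ a * jac c c' x $ q $ b * S c x $ a $ b))"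

definition upper_connection ::
  "('m, 'n::finite) chart set \<Rightarrow> real \<Rightarrow> ('m, 'n) tensor_field \<Rightarrow> ('m, 'n) vector_field \<Rightarrow> bool" where
  "upper_connection A \<delta> S \<gamma> \<longleftrightarrow>
     (\<forall>c\<in>A. smooth_on (\<gamma> c) (coord_range c)) \<and>
     (\<forall>c\<in>A. \<forall>c'\<in>A. \<forall>x\<in>overlap c c'. \<forall>p.
        \<gamma> c' (transition c c' x) $ p =
          det (jac c c' x) powr (- \<delta>) *
          (\<Sum>a\<in>UNIV. jac c c' x $ p $ a *
             (\<gamma> c x $ a + (\<Sum>b\<in>UNIV. S c x $ a $ b * pd b (log_jac c c') x))))"

definition brans_dicke_function ::
  "('m, 'n::finite) chart set \<Rightarrow> real \<Rightarrow> ('m, 'n) tensor_field \<Rightarrow> ('m, 'n) vector_field \<Rightarrow>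
    ('m, 'n) scalar_field \<Rightarrow> bool" where
  "brans_dicke_function A \<delta> S \<gamma> \<theta> \<longleftrightarrow>
     (\<forall>c\<in>A. smooth_on (\<theta> c) (coord_range c)) \<and>
     (\<forall>c\<in>A. \<forall>c'\<in>A. \<forall>x\<in>overlap c c'.
        \<theta> c' (transition c c' x) =
          det (jac c c' x) powr (- \<delta>) *
          (\<theta> c x + 2 * (\<Sum>a\<in>UNIV. \<gamma> c x $ a * pd a (log_jac c c') x)
           + (\<Sum>a\<in>UNIV. \<Sum>b\<in>UNIV.
                pd a (log_jac c c') x * S c x $ a $ b * pd b (log_jac c c') x)))"

definition coefficient_relations ::
  "('m, 'n::finite) chart set \<Rightarrow> real \<Rightarrow> real \<Rightarrow>
    ('m, 'n) tensor_field \<Rightarrow> ('m, 'n) vector_field \<Rightarrow> ('m, 'n) scalar_field \<Rightarrow>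
    ('m, 'n) tensor_field \<Rightarrow> ('m, 'n) vector_field \<Rightarrow> ('m, 'n) scalar_field \<Rightarrow> bool" where
  "coefficient_relations A \<delta> w A2 A1 A0 S \<gamma> \<theta> \<longleftrightarrow>
     (\<forall>c\<in>A. \<forall>x\<in>coord_range c.
        (\<forall>a b. 1 / 2 * S c x $ a $ b = A2 c x $ a $ b) \<and>
        (\<forall>a. 1 / 2 * ((2 * w + \<delta> - 1) * \<gamma> c x $ a + tensor_divergence (S c) x $ a) = A1 c x $ a) \<and>
        1 / 2 * (w * divergence (\<gamma> c) x + w * (w + \<delta> - 1) * \<theta> c x) = A0 c x)"

end

theory Submission
  imports Defs
begin

text \<open>In a chart, integration by parts sends the operator with coefficients
  \<open>P\<^sup>a\<^sup>b\<close>, \<open>V\<^sup>a\<close>, \<open>W\<close> to the one with coefficients \<open>P\<close>, \<open>2 div P - V\<close>, \<open>div div P - div V + W\<close>. Comparing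
  coefficients (test densities with arbitrary 2-jets exist in every chart), self-adjointness together
  with \<open>\<Delta>\<^sub>0 1 = 0\<close> forces the canonical form; conversely the canonical form is formally self-adjoint, and
  since every density is a finite sum of densities supported in single charts, this gives global
  self-adjointness. For the given weight the relations between \<open>(S, \<gamma>, \<theta>)\<close> and the coefficients of \<open>\<Delta>\<close>
  are solvable, with denominators \<open>2 w\<^sub>0 + \<delta> - 1\<close> and \<open>w\<^sub>0 (w\<^sub>0 + \<delta> - 1)\<close>. The coefficients of weight
  \<open>w\<close> fail to transform like those of an operator on densities by \<open>2 w + \<delta> - 1\<close> times the defect in
  the law of \<open>\<gamma>\<close> and \<open>w (w + \<delta> - 1)\<close> times the defect in the law of \<open>\<theta>\<close>; hence invariance at the single
  weight \<open>w\<^sub>0\<close> gives the transformation laws, and these give invariance at every weight.\<close>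

subsection \<open>Smooth functions\<close>

text \<open>The integral is a sum over an arbitrarily chosen cover, cut along chart domains. It is
  evaluated only for densities supported in one chart, where weight 1 absorbs the Jacobian and the
  pieces reassemble to an ordinary integral; beyond that, additivity is enough. Compactness makes
  the decompositions finite, and Hausdorffness lets a density be extended by zero out of a chart.
  The relations are triangular: \<open>S\<close> is read off, \<open>\<gamma>\<close> then needs the
  divergence of \<open>S\<close>, and \<open>\<theta>\<close> the divergence of
  \<open>\<gamma>\<close>; the transformation laws are derived in the same order. The divisors
  vanish exactly in the excluded cases: \<open>2 w\<^sub>0 + \<delta> - 1\<close> at the self-dual
  weight, where \<open>\<gamma>\<close> drops out of the first-order coefficient, and
  \<open>w\<^sub>0 (w\<^sub>0 + \<delta> - 1)\<close> at weight 0 and its dual weight, where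
  \<open>\<theta>\<close> drops out. The duality \<open>w \<mapsto> 1 - w - \<delta>\<close>
  reverses the sign of the first divisor and fixes the second, which is what makes the canonical
  form self-adjoint.\<close>

lemma times_differentiable_on_SucD:
  "times_differentiable_on (Suc k) f U \<Longrightarrow> times_differentiable_on k f U"
proof (induction k arbitrary: f)
  case 0
  then show ?case
    by (auto intro!: continuous_at_imp_continuous_on differentiable_imp_continuous_within)
next
  case (Suc k)
  then show ?case by (metis times_differentiable_on.simps(2))
qed

text \<open>A derivative at a point of \<open>U\<close> depends on values nearby, so openness is
  what lets agreement on \<open>U\<close> pass to derivatives. This makes the values of coefficients
  outside coordinate ranges harmless.\<close>

lemma times_differentiable_on_cong:
  assumes "open U" and "\<And>x. x \<in> U \<Longrightarrow> f x = g x" and "times_differentiable_on k f U"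
  shows "times_differentiable_on k g U"
  using assms(2,3)
proof (induction k arbitrary: f g)
  case 0
  then show ?case by (auto cong: continuous_on_cong)
next
  case (Suc k)
  have 1: "g differentiable (at x)" if "x \<in> U" for x
  proof -
    have "(f has_derivative frechet_derivative f (at x)) (at x)"
      using Suc.prems(2) that by (simp add: frechet_derivative_works)
    then have "(g has_derivative frechet_derivative f (at x)) (at x)"
      by (rule has_derivative_transform_within_open[OF _ assms(1) that]) (simp add: Suc.prems(1))
    then show ?thesis by (rule differentiableI)
  qed
  have 2: "frechet_derivative f (at x) = frechet_derivative g (at x)" if "x \<in> U" for x
    using Suc.prems that assms(1) by (intro frechet_derivative_transform_within_open) auto
  have "times_differentiable_on k (\<lambda>x. frechet_derivative g (at x) v) U" for v
    by (rule Suc.IH[of "\<lambda>x. frechet_derivative f (at x) v"]) (use 2 Suc.prems in auto)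
  then show ?case using 1 by simp
qed

text \<open>With this rule the closure properties below can exhibit the derivative given by the
  usual differentiation rules instead of handling \<open>frechet_derivative\<close> of a composite
  expression.\<close>

lemma times_differentiable_on_SucI:
  assumes "open U" "\<And>x. x \<in> U \<Longrightarrow> (f has_derivative D x) (at x)"
    "\<And>v. times_differentiable_on k (\<lambda>x. D x v) U"
  shows "times_differentiable_on (Suc k) f U"
proof -
  have "times_differentiable_on k (\<lambda>x. frechet_derivative f (at x) v) U" for v
    by (rule times_differentiable_on_cong[OF assms(1) _ assms(3)[of v]])
      (use frechet_derivative_at[OF assms(2)] in simp)
  then show ?thesis using differentiableI[OF assms(2)] by simp
qed

lemma times_differentiable_on_Un:
  assumes "open U" "open V" "times_differentiable_on k f U" "times_differentiable_on k f V"
  shows "times_differentiable_on k f (U \<union> V)"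
  using assms(3,4) by (induction k arbitrary: f) (auto intro: continuous_on_open_Un assms)

lemma times_differentiable_on_subset:
  assumes "times_differentiable_on k f U" "V \<subseteq> U"
  shows "times_differentiable_on k f V"
  using assms(1)
proof (induction k arbitrary: f)
  case 0
  then show ?case using assms(2) by (auto intro: continuous_on_subset)
qed (use assms(2) in auto)

lemma times_differentiable_on_const: "times_differentiable_on k (\<lambda>x. c) U"
  by (induction k arbitrary: c) auto

lemma times_differentiable_on_bounded_linear:
  assumes "bounded_linear L" "open U" "times_differentiable_on k f U"
  shows "times_differentiable_on k (\<lambda>x. L (f x)) U"
  using assms(3)
proof (induction k arbitrary: f)
  case 0
  then show ?case using bounded_linear.continuous_on[OF assms(1)] by auto
next
  case (Suc k)
  have *: "((\<lambda>x. L (f x)) has_derivative (\<lambda>v. L (frechet_derivative f (at x) v))) (at x)"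
    if "x \<in> U" for x
    using Suc.prems that
    by (intro bounded_linear.has_derivative[OF assms(1)]) (auto simp: frechet_derivative_works)
  show ?case
    by (rule times_differentiable_on_SucI[OF assms(2) *]) (use Suc in auto)
qed

lemma times_differentiable_on_add:
  assumes "open U" "times_differentiable_on k f U" "times_differentiable_on k g U"
  shows "times_differentiable_on k (\<lambda>x. f x + g x) U"
  using assms(2,3)
proof (induction k arbitrary: f g)
  case 0
  then show ?case by (auto intro: continuous_intros)
next
  case (Suc k)
  have *: "((\<lambda>x. f x + g x) has_derivative
      (\<lambda>v. frechet_derivative f (at x) v + frechet_derivative g (at x) v)) (at x)" if "x \<in> U" for x
    using Suc.prems that
    by (intro has_derivative_add) (auto simp: frechet_derivative_works)
  show ?case
    by (rule times_differentiable_on_SucI[OF assms(1) *]) (use Suc in auto)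
qed

lemma times_differentiable_on_sum:
  assumes "open U" "\<And>i. i \<in> I \<Longrightarrow> times_differentiable_on k (f i) U"
  shows "times_differentiable_on k (\<lambda>x. \<Sum>i\<in>I. f i x) U"
  using assms(2)
  by (induction I rule: infinite_finite_induct)
    (auto intro: times_differentiable_on_add times_differentiable_on_const assms(1))

lemma times_differentiable_on_scaleR:
  assumes "open U" "times_differentiable_on k f U" "times_differentiable_on k g U"
  shows "times_differentiable_on k (\<lambda>x. f x *\<^sub>R g x) U"
  using assms(2,3)
proof (induction k arbitrary: f g)
  case 0
  then show ?case by (auto intro: continuous_intros)
next
  case (Suc k)
  let ?D = "\<lambda>x v. f x *\<^sub>R frechet_derivative g (at x) v + frechet_derivative f (at x) v *\<^sub>R g x"
  have *: "((\<lambda>x. f x *\<^sub>R g x) has_derivative ?D x) (at x)" if "x \<in> U" for x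
    using Suc.prems that
    by (intro has_derivative_scaleR) (auto simp: frechet_derivative_works)
  \<comment> \<open>The Leibniz derivative contains \<open>f\<close> and \<open>g\<close>
    undifferentiated, so they are needed at level \<open>k\<close> too.\<close>
  have "times_differentiable_on k f U" "times_differentiable_on k g U"
    using Suc.prems by (blast dest: times_differentiable_on_SucD)+
  then have "times_differentiable_on k (\<lambda>x. ?D x v) U" for v
    by (intro times_differentiable_on_add assms(1) Suc.IH) (use Suc.prems in auto)
  then show ?case
    by (intro times_differentiable_on_SucI[OF assms(1) *])
qed

lemma times_differentiable_on_compose:
  fixes g :: "'a::real_normed_vector \<Rightarrow> 'b::euclidean_space"
  assumes "open U" "times_differentiable_on k f V" "times_differentiable_on k g U" "g ` U \<subseteq> V"
  shows "times_differentiable_on k (\<lambda>x. f (g x)) U"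
  using assms(2,3)
proof (induction k arbitrary: f)
  case 0
  then show ?case using continuous_on_compose2 assms(4) by auto
next
  case (Suc k)
  let ?D = "\<lambda>x v. frechet_derivative f (at (g x)) (frechet_derivative g (at x) v)"
  have *: "((\<lambda>x. f (g x)) has_derivative ?D x) (at x)" if "x \<in> U" for x
    using Suc.prems that assms(4)
    by (intro has_derivative_compose[of g _ x UNIV f]) (auto simp: frechet_derivative_works[symmetric])
  \<comment> \<open>The inner derivative is a direction that moves with \<open>x\<close>, whereas
    \<open>times_differentiable_on\<close> differentiates along fixed directions. Expansion in
    \<open>Basis\<close> leaves fixed directions with variable scalar factors, to which the
    induction hypothesis applies.\<close>
  have 1: "?D x v = (\<Sum>b\<in>Basis. (frechet_derivative g (at x) v \<bullet> b) *\<^sub>R frechet_derivative f (at (g x)) b)"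
    if "x \<in> U" for x v
  proof -
    have "linear (frechet_derivative f (at (g x)))"
      using Suc.prems that assms(4) by (auto intro!: linear_frechet_derivative)
    then show ?thesis
      by (subst euclidean_representation[of "frechet_derivative g (at x) v", symmetric])
        (simp add: linear_sum linear_scale del: euclidean_representation)
  qed
  have 2: "times_differentiable_on k g U"
    using Suc.prems by (blast dest: times_differentiable_on_SucD)
  have "times_differentiable_on k (\<lambda>x. \<Sum>b\<in>Basis. (frechet_derivative g (at x) v \<bullet> b) *\<^sub>R frechet_derivative f (at (g x)) b) U" for v
    by (intro times_differentiable_on_sum times_differentiable_on_scaleR assms(1)
      times_differentiable_on_bounded_linear[OF bounded_linear_inner_left] Suc.IH 2)
      (use Suc.prems in auto)
  then have "times_differentiable_on k (\<lambda>x. ?D x v) U" for v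
    by (rule times_differentiable_on_cong[OF assms(1), rotated]) (simp add: 1)
  then show ?case
    by (intro times_differentiable_on_SucI[OF assms(1) *])
qed

lemma times_differentiable_on_ident: "times_differentiable_on k (\<lambda>x. x) U"
proof (cases k)
  case (Suc n)
  then show ?thesis by (auto intro: times_differentiable_on_const)
qed simp

lemma smooth_on_cong:
  "open U \<Longrightarrow> (\<And>x. x \<in> U \<Longrightarrow> f x = g x) \<Longrightarrow> smooth_on f U \<Longrightarrow> smooth_on g U"
  unfolding smooth_on_def using times_differentiable_on_cong by blast

lemma smooth_on_subset: "smooth_on f U \<Longrightarrow> V \<subseteq> U \<Longrightarrow> smooth_on f V"
  unfolding smooth_on_def using times_differentiable_on_subset by blast

lemma smooth_on_Un: "open U \<Longrightarrow> open V \<Longrightarrow> smooth_on f U \<Longrightarrow> smooth_on f V \<Longrightarrow> smooth_on f (U \<union> V)"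
  unfolding smooth_on_def using times_differentiable_on_Un by blast

lemma smooth_on_const: "smooth_on (\<lambda>x. c) U"
  by (simp add: smooth_on_def times_differentiable_on_const)

lemma smooth_on_ident: "smooth_on (\<lambda>x. x) U"
  by (simp add: smooth_on_def times_differentiable_on_ident)

lemma smooth_on_bounded_linear:
  "bounded_linear L \<Longrightarrow> open U \<Longrightarrow> smooth_on f U \<Longrightarrow> smooth_on (\<lambda>x. L (f x)) U"
  by (simp add: smooth_on_def times_differentiable_on_bounded_linear)

lemma smooth_on_add:
  "open U \<Longrightarrow> smooth_on f U \<Longrightarrow> smooth_on g U \<Longrightarrow> smooth_on (\<lambda>x. f x + g x) U"
  by (simp add: smooth_on_def times_differentiable_on_add)

lemma smooth_on_sum:
  "open U \<Longrightarrow> (\<And>i. i \<in> I \<Longrightarrow> smooth_on (f i) U) \<Longrightarrow> smooth_on (\<lambda>x. \<Sum>i\<in>I. f i x) U"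
  by (simp add: smooth_on_def times_differentiable_on_sum)

lemma smooth_on_scaleR:
  "open U \<Longrightarrow> smooth_on f U \<Longrightarrow> smooth_on g U \<Longrightarrow> smooth_on (\<lambda>x. f x *\<^sub>R g x) U"
  by (simp add: smooth_on_def times_differentiable_on_scaleR)

lemma smooth_on_mult:
  fixes f g :: "'a::real_normed_vector \<Rightarrow> real"
  shows "open U \<Longrightarrow> smooth_on f U \<Longrightarrow> smooth_on g U \<Longrightarrow> smooth_on (\<lambda>x. f x * g x) U"
  using smooth_on_scaleR[of U f g] by simp

lemma smooth_on_minus: "open U \<Longrightarrow> smooth_on f U \<Longrightarrow> smooth_on (\<lambda>x. - f x) U"
  by (rule smooth_on_bounded_linear[OF bounded_linear_minus[OF bounded_linear_ident]])

lemma smooth_on_diff: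
  "open U \<Longrightarrow> smooth_on f U \<Longrightarrow> smooth_on g U \<Longrightarrow> smooth_on (\<lambda>x. f x - g x) U"
  using smooth_on_add[of U f "\<lambda>x. - g x"] smooth_on_minus[of U g] by simp

lemma smooth_on_prod:
  fixes f :: "'i \<Rightarrow> 'a::real_normed_vector \<Rightarrow> real"
  shows "open U \<Longrightarrow> (\<And>i. i \<in> I \<Longrightarrow> smooth_on (f i) U) \<Longrightarrow> smooth_on (\<lambda>x. \<Prod>i\<in>I. f i x) U"
  by (induction I rule: infinite_finite_induct) (auto intro: smooth_on_const smooth_on_mult)

lemma smooth_on_compose:
  fixes g :: "'a::real_normed_vector \<Rightarrow> 'b::euclidean_space"
  shows "open U \<Longrightarrow> smooth_on f V \<Longrightarrow> smooth_on g U \<Longrightarrow> g ` U \<subseteq> V \<Longrightarrow> smooth_on (\<lambda>x. f (g x)) U"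
  unfolding smooth_on_def using times_differentiable_on_compose by blast

lemma smooth_on_frechet:
  "smooth_on f U \<Longrightarrow> smooth_on (\<lambda>x. frechet_derivative f (at x) v) U"
  unfolding smooth_on_def using times_differentiable_on.simps(2) by blast

lemma smooth_on_pd: "smooth_on f U \<Longrightarrow> smooth_on (pd a f) U"
  unfolding pd_def by (rule smooth_on_frechet)

lemma smooth_on_differentiable: "smooth_on f U \<Longrightarrow> x \<in> U \<Longrightarrow> f differentiable (at x)"
  unfolding smooth_on_def using times_differentiable_on.simps(2) by blast

lemma smooth_on_continuous: "smooth_on f U \<Longrightarrow> continuous_on U f"
  unfolding smooth_on_def by (metis times_differentiable_on.simps(1))

lemma smooth_on_nth:
  fixes f :: "'a::real_normed_vector \<Rightarrow> 'b::euclidean_space ^ 'n"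
  shows "open U \<Longrightarrow> smooth_on f U \<Longrightarrow> smooth_on (\<lambda>x. f x $ i) U"
  by (rule smooth_on_bounded_linear[OF bounded_linear_vec_nth])

lemma smooth_on_vec:
  fixes f :: "'a::real_normed_vector \<Rightarrow> 'b::euclidean_space ^ 'n"
  assumes "open U" "\<And>i. smooth_on (\<lambda>x. f x $ i) U"
  shows "smooth_on f U"
proof -
  have bl: "bounded_linear (axis i :: 'b \<Rightarrow> 'b ^ 'n)" for i
    by (rule linear_conv_bounded_linear[THEN iffD1], rule linearI)
      (auto simp: axis_def vec_eq_iff)
  have "smooth_on (\<lambda>x. \<Sum>i\<in>UNIV. axis i (f x $ i)) U"
    by (intro smooth_on_sum smooth_on_bounded_linear[OF bl] assms)
  moreover have "(\<Sum>i\<in>UNIV. axis i (v $ i)) = v" for v :: "'b ^ 'n"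
    by (simp add: vec_eq_iff axis_def if_distrib cong: if_cong)
  ultimately show ?thesis by simp
qed

section \<open>Real powers and the logarithm\<close>

lemma times_differentiable_on_real_Suc:
  fixes f :: "real \<Rightarrow> real"
  assumes "open U" "\<And>x. x \<in> U \<Longrightarrow> (f has_field_derivative f' x) (at x)"
    and "times_differentiable_on k f' U"
  shows "times_differentiable_on (Suc k) f U"
proof -
  show ?thesis
  proof (rule times_differentiable_on_SucI[OF assms(1)])
    show "(f has_derivative (\<lambda>v. f' x * v)) (at x)" if "x \<in> U" for x
      using assms(2)[OF that] by (simp add: has_field_derivative_def)
    show "times_differentiable_on k (\<lambda>x. f' x * v) U" for v
      using times_differentiable_on_scaleR[OF assms(1,3) times_differentiable_on_const[of _ v]] by simp
  qed
qed

lemma smooth_on_powr_real: "smooth_on (\<lambda>x::real. x powr w) {0<..}"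
proof -
  \<comment> \<open>The family \<open>c * x powr w\<close> is closed under differentiation, so the
    induction has to run over all \<open>c\<close> and \<open>w\<close>.\<close>
  have "times_differentiable_on k (\<lambda>x. c * x powr w) {0<..}" for k and c w :: real
  proof (induction k arbitrary: c w)
    case 0
    then show ?case by (auto intro!: continuous_intros)
  next
    case (Suc k)
    show ?case
      by (rule times_differentiable_on_real_Suc[OF _ _ Suc[of "c * w" "w - 1"]])
        (auto intro!: derivative_eq_intros)
  qed
  from this[of _ 1] show ?thesis by (simp add: smooth_on_def)
qed

lemma smooth_on_ln_real: "smooth_on (ln :: real \<Rightarrow> real) {0<..}"
proof -
  have "times_differentiable_on (Suc k) (ln :: real \<Rightarrow> real) {0<..}" for k
  proof (rule times_differentiable_on_real_Suc)
    show "(ln has_field_derivative x powr (-1)) (at x)" if "x \<in> {0<..}" for x :: real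
      using DERIV_ln[of x] that by (simp add: powr_minus)
  qed (use smooth_on_powr_real[of "-1", unfolded smooth_on_def] in auto)
  then show ?thesis
    by (metis smooth_on_def times_differentiable_on_SucD)
qed

lemma smooth_on_powr:
  fixes f :: "'a::real_normed_vector \<Rightarrow> real"
  assumes "open U" "smooth_on f U" "\<And>x. x \<in> U \<Longrightarrow> f x > 0"
  shows "smooth_on (\<lambda>x. f x powr w) U"
  using smooth_on_compose[OF assms(1) smooth_on_powr_real assms(2)] assms(3) by auto

lemma smooth_on_ln:
  fixes f :: "'a::real_normed_vector \<Rightarrow> real"
  assumes "open U" "smooth_on f U" "\<And>x. x \<in> U \<Longrightarrow> f x > 0"
  shows "smooth_on (\<lambda>x. ln (f x)) U"
  using smooth_on_compose[OF assms(1) smooth_on_ln_real assms(2)] assms(3) by auto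

text \<open>For \<open>n = 0\<close> this is the standard smooth function that is flat at 0. The
  powers \<open>t ^ n\<close> in the denominator are carried along because the derivative of a
  member of the family is a linear combination of members.\<close>

definition flat :: "nat \<Rightarrow> real \<Rightarrow> real" where
  "flat n t = (if t > 0 then exp (- (1 / t)) / t ^ n else 0)"

text \<open>On the right, \<open>u = 1/t\<close> turns the claim into the decay of
  \<open>u ^ n / exp u\<close> at infinity; on the left the function is identically 0.\<close>

lemma flat_tendsto: "(flat n \<longlongrightarrow> 0) (at 0)"
proof -
  have "((\<lambda>t::real. exp (- (1 / t)) / t ^ n) \<longlongrightarrow> 0) (at_right 0)"
  proof -
    have "((\<lambda>u::real. u ^ n / exp u) \<longlongrightarrow> 0) at_top"
      by (rule tendsto_power_div_exp_0)
    then have "((\<lambda>t::real. (inverse t) ^ n / exp (inverse t)) \<longlongrightarrow> 0) (at_right 0)"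
      by (rule filterlim_compose[OF _ filterlim_inverse_at_top_right])
    then show ?thesis
      by (rule Lim_transform_eventually)
        (auto simp: eventually_at_right_less divide_inverse exp_minus power_inverse mult.commute)
  qed
  then have "(flat n \<longlongrightarrow> 0) (at_right 0)"
    by (rule Lim_transform_eventually)
      (auto simp: flat_def intro: eventually_at_right_less[THEN eventually_mono])
  moreover have "(flat n \<longlongrightarrow> 0) (at_left 0)"
    by (rule tendsto_eventually)
      (auto simp: flat_def eventually_at_filter)
  ultimately show ?thesis
    by (simp add: filterlim_split_at)
qed

lemma flat_deriv: "(flat n has_field_derivative flat (n + 2) x - real n * flat (n + 1) x) (at x)"
proof -
  consider "x > 0" | "x < 0" | "x = 0" by linarith
  then show ?thesis
  proof cases
    case 1
    have "((\<lambda>t. exp (- (1 / t)) / t ^ n) has_field_derivative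
        flat (n + 2) x - real n * flat (n + 1) x) (at x)"
      using 1 by (auto intro!: derivative_eq_intros simp: flat_def field_simps power2_eq_square)
        (cases n; simp add: field_simps)
    then show ?thesis
      using 1 by (elim has_field_derivative_transform_within_open[of _ _ _ "{0<..}"])
        (auto simp: flat_def)
  next
    case 2
    have "((\<lambda>t. 0) has_field_derivative 0) (at x)" by simp
    then have "(flat n has_field_derivative 0) (at x)"
      using 2 by (elim has_field_derivative_transform_within_open[of _ _ _ "{..<0}"])
        (auto simp: flat_def)
    then show ?thesis using 2 by (simp add: flat_def)
  next
    case 3
    \<comment> \<open>At 0 the difference quotient is again a member of the family, so its limit is
      already known.\<close>
    have "(\<lambda>h. (flat n (0 + h) - flat n 0) / h) = flat (Suc n)"
      by (auto simp: flat_def fun_eq_iff)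
    then have "(flat n has_field_derivative 0) (at 0)"
      using flat_tendsto[of "Suc n"] by (simp add: DERIV_def)
    then show ?thesis using 3 by (simp add: flat_def)
  qed
qed

lemma smooth_on_flat: "smooth_on (flat n) UNIV"
proof -
  have "times_differentiable_on k (flat n) UNIV" for k
  proof (induction k arbitrary: n)
    case 0
    show ?case using flat_deriv
      by (auto intro!: continuous_at_imp_continuous_on DERIV_isCont)
  next
    case (Suc k)
    have "times_differentiable_on k (\<lambda>x. flat (n + 2) x + (- real n) *\<^sub>R flat (n + 1) x) UNIV"
      by (intro times_differentiable_on_add times_differentiable_on_scaleR
        times_differentiable_on_const Suc) auto
    then have *: "times_differentiable_on k (\<lambda>x. flat (n + 2) x - real n * flat (n + 1) x) UNIV"
      by simp
    show ?case by (rule times_differentiable_on_real_Suc[OF _ flat_deriv *]) auto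
  qed
  then show ?thesis by (simp add: smooth_on_def)
qed

text \<open>The function is \<open>a / (a + b)\<close>, where \<open>a\<close> is positive exactly
  on the ball of radius \<open>r\<close> and \<open>b\<close> exactly off the closed ball of radius
  \<open>r/2\<close>; these two regions cover the space, so the denominator never vanishes. Squared
  distances keep everything smooth at the centre, and writing the quotient with
  \<open>powr (-1)\<close> reuses the smoothness of powers.\<close>

lemma plateau_exists:
  fixes x0 :: "'a::euclidean_space"
  assumes "r > 0"
  obtains \<phi> :: "'a \<Rightarrow> real" where "smooth_on \<phi> UNIV" "\<And>x. 0 \<le> \<phi> x"
    "\<And>x. x \<in> ball x0 (r/2) \<Longrightarrow> \<phi> x = 1" "\<And>x. x \<notin> ball x0 r \<Longrightarrow> \<phi> x = 0"
proof -
  define q where "q x = (x - x0) \<bullet> (x - x0)" for x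
  define a where "a x = flat 0 (r\<^sup>2 - q x)" for x
  define b where "b x = flat 0 (q x - (r/2)\<^sup>2)" for x
  have q: "q x = (dist x0 x)\<^sup>2" for x
    by (simp add: q_def dist_norm norm_minus_commute dot_square_norm)
  have "smooth_on (\<lambda>x. (x - x0) \<bullet> i) UNIV" for i
    by (intro smooth_on_bounded_linear[OF bounded_linear_inner_left] smooth_on_diff
        smooth_on_ident smooth_on_const) auto
  then have "smooth_on (\<lambda>x. \<Sum>i\<in>Basis. ((x - x0) \<bullet> i) * ((x - x0) \<bullet> i)) UNIV"
    by (intro smooth_on_sum smooth_on_mult) auto
  then have smq: "smooth_on q UNIV"
    unfolding q_def by (subst euclidean_inner)
  have sa: "smooth_on a UNIV" "smooth_on b UNIV"
    unfolding a_def b_def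
    by (intro smooth_on_compose[OF _ smooth_on_flat] smooth_on_diff smooth_on_const smq; simp)+
  have nn: "a x \<ge> 0" "b x \<ge> 0" for x by (auto simp: a_def b_def flat_def)
  have sq: "u\<^sup>2 < v\<^sup>2 \<longleftrightarrow> u < v" if "0 \<le> u" "0 \<le> v" for u v :: real
    using that power2_less_imp_less[of u v] power_strict_mono[of u v 2] by auto
  have a0: "a x > 0 \<longleftrightarrow> x \<in> ball x0 r" for x
    using sq[of "dist x0 x" r] \<open>r > 0\<close> by (simp add: a_def flat_def q)
  have b0: "b x > 0 \<longleftrightarrow> x \<notin> cball x0 (r/2)" for x
    using sq[of "r/2" "dist x0 x"] \<open>r > 0\<close> by (simp add: b_def flat_def q not_le)
  have pos: "a x + b x > 0" for x
  proof -
    have "x \<in> ball x0 r \<or> x \<notin> cball x0 (r/2)" using \<open>r > 0\<close> by auto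
    then show ?thesis using a0[of x] b0[of x] nn[of x] by linarith
  qed
  define \<phi> where "\<phi> x = a x * (a x + b x) powr (-1)" for x
  show thesis
  proof
    show "smooth_on \<phi> UNIV"
      unfolding \<phi>_def using pos sa by (intro smooth_on_mult smooth_on_powr smooth_on_add) auto
    show "0 \<le> \<phi> x" for x using nn by (simp add: \<phi>_def)
    show "\<phi> x = 1" if "x \<in> ball x0 (r/2)" for x
    proof -
      have "b x = 0" using that b0[of x] nn[of x] by auto
      then show ?thesis using pos[of x] by (simp add: \<phi>_def powr_minus)
    qed
    show "\<phi> x = 0" if "x \<notin> ball x0 r" for x
      using that a0[of x] nn[of x] by (auto simp: \<phi>_def)
  qed
qed

subsection \<open>Partial derivatives\<close>

text \<open>Both functions have the same set of derivatives at \<open>x\<close>, so the choice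
  inside \<open>frechet_derivative\<close> agrees even where no derivative exists. Hence
  \<open>pd_cong\<close> rewrites under \<open>pd\<close> without differentiability side
  conditions.\<close>

lemma frechet_derivative_cong:
  assumes "open U" "x \<in> U" "\<And>y. y \<in> U \<Longrightarrow> f y = g y"
  shows "frechet_derivative f (at x) = frechet_derivative g (at x)"
proof -
  have "(f has_derivative D) (at x) \<longleftrightarrow> (g has_derivative D) (at x)" for D
    by (rule iffI; erule has_derivative_transform_within_open[OF _ assms(1,2)]) (simp_all add: assms(3))
  then show ?thesis by (simp add: frechet_derivative_def)
qed

lemma pd_cong:
  "open U \<Longrightarrow> x \<in> U \<Longrightarrow> (\<And>y. y \<in> U \<Longrightarrow> f y = g y) \<Longrightarrow> pd a f x = pd a g x"
  using frechet_derivative_cong[of U x f g] by (simp add: pd_def)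

lemma pd_eqI: "(f has_derivative D) (at x) \<Longrightarrow> pd a f x = D (axis a 1)"
  using frechet_derivative_at[of f D x] by (simp add: pd_def)

lemma pd_const [simp]: "pd a (\<lambda>x. c) x = 0"
  by (simp add: pd_def)

lemma pd_add:
  "f differentiable (at x) \<Longrightarrow> g differentiable (at x) \<Longrightarrow> pd a (\<lambda>x. f x + g x) x = pd a f x + pd a g x"
  unfolding frechet_derivative_works
  by (drule (1) has_derivative_add, drule pd_eqI) (simp add: pd_def)

lemma pd_diff:
  "f differentiable (at x) \<Longrightarrow> g differentiable (at x) \<Longrightarrow> pd a (\<lambda>x. f x - g x) x = pd a f x - pd a g x"
  unfolding frechet_derivative_works
  by (drule (1) has_derivative_diff, drule pd_eqI) (simp add: pd_def)

lemma pd_mult: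
  "f differentiable (at x) \<Longrightarrow> g differentiable (at x) \<Longrightarrow>
    pd a (\<lambda>x. f x * g x) x = f x * pd a g x + pd a f x * g x"
  unfolding frechet_derivative_works
  by (drule (1) has_derivative_mult, drule pd_eqI) (simp add: pd_def)

lemma pd_cmult:
  "f differentiable (at x) \<Longrightarrow> pd a (\<lambda>x. c * f x) x = c * pd a f x"
  by (simp add: pd_mult[of "\<lambda>x. c"])

lemma differentiable_sum_fun:
  "(\<And>i. i \<in> I \<Longrightarrow> f i differentiable (at x)) \<Longrightarrow> (\<lambda>x. \<Sum>i\<in>I. f i x) differentiable (at x)"
  by (induction I rule: infinite_finite_induct) (auto intro: differentiable_add)

lemma pd_sum:
  "(\<And>i. i \<in> I \<Longrightarrow> f i differentiable (at x)) \<Longrightarrow>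
    pd a (\<lambda>x. \<Sum>i\<in>I. f i x) x = (\<Sum>i\<in>I. pd a (f i) x)"
proof (induction I rule: infinite_finite_induct)
  case (insert i I)
  then show ?case by (simp add: pd_add differentiable_sum_fun)
qed auto

lemma pd_prod:
  assumes "\<And>i. i \<in> I \<Longrightarrow> f i differentiable (at x)"
  shows "pd a (\<lambda>x. \<Prod>i\<in>I. f i x) x = (\<Sum>i\<in>I. pd a (f i) x * (\<Prod>j\<in>I - {i}. f j x))"
proof -
  have "((\<lambda>x. \<Prod>i\<in>I. f i x) has_derivative
      (\<lambda>y. \<Sum>i\<in>I. frechet_derivative (f i) (at x) y * (\<Prod>j\<in>I - {i}. f j x))) (at x)"
    by (intro has_derivative_prod) (use assms in \<open>simp add: frechet_derivative_works\<close>)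
  from pd_eqI[OF this] show ?thesis by (simp add: pd_def)
qed

lemma pd_real_compose:
  assumes "(h has_field_derivative h') (at (g x))" "g differentiable (at x)"
  shows "pd a (\<lambda>x. h (g x)) x = h' * pd a g x"
proof -
  have "((\<lambda>x. h (g x)) has_derivative (\<lambda>v. h' * frechet_derivative g (at x) v)) (at x)"
    using assms by (intro has_derivative_compose[of g _ x UNIV h])
      (auto simp: frechet_derivative_works[symmetric] has_field_derivative_def)
  from pd_eqI[OF this] show ?thesis by (simp add: pd_def)
qed

lemma frechet_derivative_pd:
  fixes f :: "real ^ 'n \<Rightarrow> real"
  assumes "f differentiable (at x)"
  shows "frechet_derivative f (at x) v = (\<Sum>a\<in>UNIV. pd a f x * v $ a)"
proof -
  have l: "linear (frechet_derivative f (at x))" by (rule linear_frechet_derivative[OF assms])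
  have "v = (\<Sum>a\<in>UNIV. v $ a *\<^sub>R axis a 1)"
    by (simp add: vec_eq_iff axis_def if_distrib cong: if_cong)
  then have "frechet_derivative f (at x) v = frechet_derivative f (at x) (\<Sum>a\<in>UNIV. v $ a *\<^sub>R axis a 1)"
    by simp
  then show ?thesis by (simp add: linear_sum[OF l] linear_scale[OF l] pd_def mult.commute)
qed

lemma differentiable_vec_nth:
  "f differentiable (at x) \<Longrightarrow> (\<lambda>y. f y $ i) differentiable (at x)"
  unfolding differentiable_def using bounded_linear.has_derivative[OF bounded_linear_vec_nth] by blast

lemma frechet_derivative_vec_nth:
  assumes "f differentiable (at x)"
  shows "frechet_derivative f (at x) v $ i = frechet_derivative (\<lambda>y. f y $ i) (at x) v"
proof -
  have "((\<lambda>y. f y $ i) has_derivative (\<lambda>v. frechet_derivative f (at x) v $ i)) (at x)"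
    using assms by (intro bounded_linear.has_derivative[OF bounded_linear_vec_nth])
      (simp add: frechet_derivative_works)
  from fun_cong[OF frechet_derivative_at[OF this]] show ?thesis .
qed

lemma jacobian_nth:
  assumes "f differentiable (at x)"
  shows "jacobian f (at x) $ p $ a = pd a (\<lambda>y. f y $ p) x"
  using frechet_derivative_vec_nth[OF assms] by (simp add: jacobian_def matrix_def pd_def)

lemma differentiable_compose_at:
  "f differentiable (at (g x)) \<Longrightarrow> g differentiable (at x) \<Longrightarrow> (\<lambda>x. f (g x)) differentiable (at x)"
  using differentiable_chain_at[of g x f] by (simp add: o_def)

lemma pd_compose:
  fixes f :: "real ^ 'm \<Rightarrow> real" and g :: "real ^ 'n \<Rightarrow> real ^ 'm"
  assumes "f differentiable (at (g x))" "g differentiable (at x)"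
  shows "pd a (\<lambda>y. f (g y)) x = (\<Sum>p\<in>UNIV. pd p f (g x) * pd a (\<lambda>y. g y $ p) x)"
proof -
  have "pd a (\<lambda>y. f (g y)) x = frechet_derivative f (at (g x)) (frechet_derivative g (at x) (axis a 1))"
    using frechet_derivative_compose[of g x f, OF assms(2,1)] by (simp add: pd_def o_def)
  also have "\<dots> = (\<Sum>p\<in>UNIV. pd p f (g x) * frechet_derivative g (at x) (axis a 1) $ p)"
    by (rule frechet_derivative_pd[OF assms(1)])
  finally show ?thesis
    unfolding frechet_derivative_vec_nth[OF assms(2)] by (simp only: pd_def[symmetric])
qed

section \<open>Restriction to lines and the symmetry of mixed partial derivatives\<close>

lemma line_derivative:
  fixes f :: "real ^ 'n \<Rightarrow> real"
  assumes "f differentiable (at (p + s *\<^sub>R axis a 1))"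
  shows "((\<lambda>s. f (p + s *\<^sub>R axis a 1)) has_field_derivative pd a f (p + s *\<^sub>R axis a 1)) (at s)"
proof -
  have 1: "((\<lambda>s. p + s *\<^sub>R axis a 1) has_derivative (\<lambda>t. t *\<^sub>R axis a 1)) (at s)"
    by (auto intro!: derivative_eq_intros)
  have "((\<lambda>s. f (p + s *\<^sub>R axis a 1)) has_derivative
      (\<lambda>t. frechet_derivative f (at (p + s *\<^sub>R axis a 1)) (t *\<^sub>R axis a 1))) (at s)"
    by (rule has_derivative_compose[OF 1]) (use assms in \<open>simp add: frechet_derivative_works\<close>)
  then show ?thesis
    using linear_scale[OF linear_frechet_derivative[OF assms]]
    by (simp add: has_field_derivative_def pd_def mult_commute_abs)
qed

text \<open>The mean value theorem is applied twice: to the increment of \<open>f\<close> in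
  direction \<open>b\<close>, viewed as a function along direction \<open>a\<close>, and then to
  \<open>pd a f\<close> along direction \<open>b\<close>.\<close>

lemma second_difference:
  fixes f :: "real ^ 'n \<Rightarrow> real"
  assumes "smooth_on f U" "h > 0"
    and U: "\<And>s t. 0 \<le> s \<Longrightarrow> s \<le> h \<Longrightarrow> 0 \<le> t \<Longrightarrow> t \<le> h \<Longrightarrow> x + s *\<^sub>R axis a 1 + t *\<^sub>R axis b 1 \<in> U"
  obtains s t where "0 \<le> s" "s \<le> h" "0 \<le> t" "t \<le> h"
    "f (x + h *\<^sub>R axis a 1 + h *\<^sub>R axis b 1) - f (x + h *\<^sub>R axis a 1) - f (x + h *\<^sub>R axis b 1) + f x
      = h * h * pd b (pd a f) (x + s *\<^sub>R axis a 1 + t *\<^sub>R axis b 1)"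
proof -
  define g where "g s = f (x + h *\<^sub>R axis b 1 + s *\<^sub>R axis a 1) - f (x + s *\<^sub>R axis a 1)" for s
  define g' where "g' s = pd a f (x + h *\<^sub>R axis b 1 + s *\<^sub>R axis a 1) - pd a f (x + s *\<^sub>R axis a 1)" for s
  have g: "(g has_field_derivative g' s) (at s)" if "0 \<le> s" "s \<le> h" for s
    unfolding g_def g'_def
    using that U[of s h] U[of s 0] \<open>h > 0\<close>
    by (intro DERIV_diff line_derivative smooth_on_differentiable[OF assms(1)])
      (auto simp: algebra_simps)
  obtain s where s: "0 < s" "s < h" "g h - g 0 = (h - 0) * g' s"
    using MVT2[OF \<open>h > 0\<close> g] by blast
  have k: "((\<lambda>t. pd a f (x + s *\<^sub>R axis a 1 + t *\<^sub>R axis b 1)) has_field_derivative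
      pd b (pd a f) (x + s *\<^sub>R axis a 1 + t *\<^sub>R axis b 1)) (at t)" if "0 \<le> t" "t \<le> h" for t
    using that U[of s t] s
    by (intro line_derivative smooth_on_differentiable[OF smooth_on_pd[OF assms(1)]]) auto
  obtain t where t: "0 < t" "t < h" "pd a f (x + s *\<^sub>R axis a 1 + h *\<^sub>R axis b 1) -
      pd a f (x + s *\<^sub>R axis a 1 + 0 *\<^sub>R axis b 1) = (h - 0) * pd b (pd a f) (x + s *\<^sub>R axis a 1 + t *\<^sub>R axis b 1)"
    using MVT2[OF \<open>h > 0\<close> k] by blast
  show thesis
    by (rule that[of s t]) (use s t in \<open>auto simp: g_def g'_def algebra_simps\<close>)
qed

text \<open>The second difference does not depend on the order of the two directions, so for every
  small \<open>h\<close> both mixed derivatives take a common value at points near \<open>x\<close>.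
  If they differed at \<open>x\<close>, continuity would keep them apart nearby.\<close>

lemma pd_commute:
  fixes f :: "real ^ 'n \<Rightarrow> real"
  assumes "open U" "smooth_on f U" "x \<in> U"
  shows "pd a (pd b f) x = pd b (pd a f) x"
proof (rule ccontr)
  define A where "A = pd a (pd b f)"
  define B where "B = pd b (pd a f)"
  assume "pd a (pd b f) x \<noteq> pd b (pd a f) x"
  then have e: "dist (A x) (B x) / 2 > 0" by (simp add: A_def B_def)
  have "continuous (at x) A" "continuous (at x) B"
    unfolding A_def B_def
    using smooth_on_continuous[OF smooth_on_pd[OF smooth_on_pd[OF assms(2)]]] assms
    by (auto simp: continuous_on_eq_continuous_at)
  then obtain d1 d2 where d: "d1 > 0" "d2 > 0"
    "\<And>y. dist y x < d1 \<Longrightarrow> dist (A y) (A x) < dist (A x) (B x) / 2"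
    "\<And>y. dist y x < d2 \<Longrightarrow> dist (B y) (B x) < dist (A x) (B x) / 2"
    using e unfolding continuous_at_eps_delta by metis
  obtain r where r: "r > 0" "ball x r \<subseteq> U" using assms openE by blast
  \<comment> \<open>The sampled points lie within \<open>2 h\<close> of \<open>x\<close>, hence
    strictly inside all three radii.\<close>
  define h where "h = min r (min d1 d2) / 3"
  have h: "h > 0" using d r by (simp add: h_def)
  have near: "dist (x + s *\<^sub>R axis i 1 + t *\<^sub>R axis j 1) x < min r (min d1 d2)"
    if "0 \<le> s" "s \<le> h" "0 \<le> t" "t \<le> h" for s t i j
  proof -
    have "dist (x + s *\<^sub>R axis i 1 + t *\<^sub>R axis j 1) x = norm (s *\<^sub>R axis i 1 + t *\<^sub>R axis j 1 :: real ^ 'n)"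
      by (simp add: dist_norm algebra_simps)
    also have "\<dots> \<le> norm (s *\<^sub>R axis i 1 :: real ^ 'n) + norm (t *\<^sub>R axis j 1 :: real ^ 'n)"
      by (rule norm_triangle_ineq)
    also have "\<dots> \<le> h + h" using that by (simp add: norm_axis_1)
    also have "\<dots> < min r (min d1 d2)" using h unfolding h_def by linarith
    finally show ?thesis .
  qed
  have inU: "x + s *\<^sub>R axis i 1 + t *\<^sub>R axis j 1 \<in> U"
    if "0 \<le> s" "s \<le> h" "0 \<le> t" "t \<le> h" for s t i j
    using near[OF that] r(2) by (auto simp: subset_iff dist_commute)
  obtain s t where st: "0 \<le> s" "s \<le> h" "0 \<le> t" "t \<le> h"
    "f (x + h *\<^sub>R axis a 1 + h *\<^sub>R axis b 1) - f (x + h *\<^sub>R axis a 1) - f (x + h *\<^sub>R axis b 1) + f x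
      = h * h * B (x + s *\<^sub>R axis a 1 + t *\<^sub>R axis b 1)"
    by (rule second_difference[OF assms(2) h inU, of a b]) (auto simp: B_def)
  obtain s' t' where st': "0 \<le> s'" "s' \<le> h" "0 \<le> t'" "t' \<le> h"
    "f (x + h *\<^sub>R axis b 1 + h *\<^sub>R axis a 1) - f (x + h *\<^sub>R axis b 1) - f (x + h *\<^sub>R axis a 1) + f x
      = h * h * A (x + s' *\<^sub>R axis b 1 + t' *\<^sub>R axis a 1)"
    by (rule second_difference[OF assms(2) h inU, of b a]) (auto simp: A_def)
  have swap: "x + h *\<^sub>R axis b 1 + h *\<^sub>R axis a 1 = x + h *\<^sub>R axis a 1 + h *\<^sub>R axis b 1" by simp
  have "h * h * A (x + s' *\<^sub>R axis b 1 + t' *\<^sub>R axis a 1) = h * h * B (x + s *\<^sub>R axis a 1 + t *\<^sub>R axis b 1)"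
    using st(5) st'(5)[unfolded swap] by linarith
  then have eq: "A (x + s' *\<^sub>R axis b 1 + t' *\<^sub>R axis a 1) = B (x + s *\<^sub>R axis a 1 + t *\<^sub>R axis b 1)"
    using h by simp
  have "dist (A (x + s' *\<^sub>R axis b 1 + t' *\<^sub>R axis a 1)) (A x) < dist (A x) (B x) / 2"
    using near[OF st'(1-4)] by (intro d(3)) (metis min_less_iff_conj)
  moreover have "dist (B (x + s *\<^sub>R axis a 1 + t *\<^sub>R axis b 1)) (B x) < dist (A x) (B x) / 2"
    using near[OF st(1-4)] by (intro d(4)) (metis min_less_iff_conj)
  ultimately show False
    unfolding eq by (auto simp: dist_real_def abs_if split: if_splits)
qed

section \<open>The derivative of a determinant\<close>

lemma det_replace_row:
  fixes M :: "'a::comm_ring_1 ^ 'n ^ 'n"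
  shows "det (\<chi> k. if k = i then (\<Sum>l\<in>UNIV. c l *s M $ l) else M $ k) = c i * det M"
proof -
  have "det (\<chi> k. if k = i then (\<Sum>l\<in>UNIV. c l *s M $ l) else M $ k) =
      (\<Sum>l\<in>UNIV. det (\<chi> k. if k = i then c l *s M $ l else M $ k))"
    using det_linear_row_sum[of UNIV i "\<lambda>i l. c l *s M $ l" "\<lambda>k. M $ k"] by simp
  also have "\<dots> = (\<Sum>l\<in>UNIV. c l * det (\<chi> k. if k = i then M $ l else M $ k))"
    using det_row_mul[of i "c _" "\<lambda>_. M $ _" "\<lambda>k. M $ k"] by simp
  also have "\<dots> = (\<Sum>l\<in>UNIV. if l = i then c i * det M else 0)"
  proof (rule sum.cong[OF refl])
    fix l
    have "det (\<chi> k. if k = i then M $ l else M $ k) = 0" if "l \<noteq> i"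
      by (rule det_identical_rows[OF that]) (use that in \<open>simp add: row_def vec_eq_iff\<close>)
    moreover have "(\<chi> k. if k = i then M $ i else M $ k) = M"
      by (simp add: vec_eq_iff)
    ultimately show "c l * det (\<chi> k. if k = i then M $ l else M $ k) = (if l = i then c i * det M else 0)"
      by auto
  qed
  finally show ?thesis by simp
qed

text \<open>This is Jacobi's formula. Differentiating the product in each permutation term replaces
  one row of \<open>M x\<close> by its derivative; expanded in the rows of \<open>M x\<close>, only
  the multiple of the replaced row itself contributes to the determinant.\<close>

lemma pd_det:
  fixes M :: "real ^ 'n \<Rightarrow> real ^ 'n ^ 'n"
  assumes diff: "\<And>i j. (\<lambda>y. M y $ i $ j) differentiable (at x)"
    and K: "K ** M x = mat 1"
  shows "pd a (\<lambda>y. det (M y)) x = det (M x) * (\<Sum>i\<in>UNIV. \<Sum>l\<in>UNIV. K $ l $ i * pd a (\<lambda>y. M y $ i $ l) x)"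
proof -
  let ?P = "{p. p permutes (UNIV :: 'n set)}"
  define D where "D i = (\<chi> l. pd a (\<lambda>y. M y $ i $ l) x)" for i
  \<comment> \<open>These are the coordinates of the differentiated row \<open>D i\<close> in the
    basis formed by the rows of \<open>M x\<close>, obtained with the inverse matrix
    \<open>K\<close>.\<close>
  define c where "c i l = (\<Sum>m\<in>UNIV. D i $ m * K $ m $ l)" for i l
  have Di: "D i = (\<Sum>l\<in>UNIV. c i l *s M x $ l)" for i
  proof -
    have "(\<Sum>l\<in>UNIV. c i l * M x $ l $ k) = D i $ k" for k
    proof -
      have "(\<Sum>l\<in>UNIV. c i l * M x $ l $ k) = (\<Sum>m\<in>UNIV. D i $ m * (\<Sum>l\<in>UNIV. K $ m $ l * M x $ l $ k))"
        unfolding c_def sum_distrib_left sum_distrib_right by (subst sum.swap) (simp add: mult.assoc)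
      also have "\<dots> = (\<Sum>m\<in>UNIV. D i $ m * (if m = k then 1 else 0))"
        using K by (simp add: vec_eq_iff matrix_matrix_mult_def mat_def)
      finally show ?thesis by (simp add: if_distrib cong: if_cong)
    qed
    then show ?thesis by (simp add: vec_eq_iff)
  qed
  have dp: "(\<lambda>y. \<Prod>i\<in>UNIV. M y $ i $ p i) differentiable (at x)" for p
    unfolding differentiable_def
    by (rule exI, rule has_derivative_prod) (use diff in \<open>simp add: frechet_derivative_works\<close>)
  have "pd a (\<lambda>y. det (M y)) x = (\<Sum>p\<in>?P. pd a (\<lambda>y. of_int (sign p) * (\<Prod>i\<in>UNIV. M y $ i $ p i)) x)"
    unfolding det_def by (intro pd_sum differentiable_mult dp) auto
  also have "\<dots> = (\<Sum>p\<in>?P. of_int (sign p) * (\<Sum>i\<in>UNIV. D i $ p i * (\<Prod>j\<in>UNIV - {i}. M x $ j $ p j)))"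
    by (intro sum.cong refl) (simp add: pd_cmult[OF dp] pd_prod[OF diff] D_def)
  also have "\<dots> = (\<Sum>i\<in>UNIV. \<Sum>p\<in>?P. of_int (sign p) * (\<Prod>j\<in>UNIV. (if j = i then D i else M x $ j) $ p j))"
  proof -
    have "(\<Prod>j\<in>UNIV. (if j = i then D i else M x $ j) $ p j) = D i $ p i * (\<Prod>j\<in>UNIV - {i}. M x $ j $ p j)" for i p
      by (subst prod.remove[of _ i]) auto
    then show ?thesis by (subst sum.swap) (simp add: sum_distrib_left)
  qed
  also have "\<dots> = (\<Sum>i\<in>UNIV. det (\<chi> j. if j = i then D i else M x $ j))"
    by (simp add: det_def)
  also have "\<dots> = (\<Sum>i\<in>UNIV. c i i * det (M x))"
  proof (rule sum.cong[OF refl])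
    fix i
    show "det (\<chi> j. if j = i then D i else M x $ j) = c i i * det (M x)"
      unfolding Di[of i] by (rule det_replace_row)
  qed
  also have "\<dots> = det (M x) * (\<Sum>i\<in>UNIV. \<Sum>l\<in>UNIV. K $ l $ i * D i $ l)"
    by (simp add: c_def sum_distrib_left mult_ac)
  finally show ?thesis by (simp add: D_def)
qed

lemma smooth_on_det:
  assumes "open U" "smooth_on M U"
  shows "smooth_on (\<lambda>y. det (M y :: real ^ 'n ^ 'n)) U"
  unfolding det_def
  by (intro smooth_on_sum smooth_on_mult smooth_on_prod smooth_on_const smooth_on_nth assms)

lemma smooth_on_jacobian:
  fixes g :: "real ^ 'n \<Rightarrow> real ^ 'm"
  assumes "open U" "smooth_on g U"
  shows "smooth_on (\<lambda>y. jacobian g (at y)) U"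
proof (intro smooth_on_vec assms(1))
  fix p a
  show "smooth_on (\<lambda>y. jacobian g (at y) $ p $ a) U"
    by (rule smooth_on_cong[OF assms(1), of "pd a (\<lambda>y. g y $ p)"])
      (use jacobian_nth[OF smooth_on_differentiable[OF assms(2)]] assms in
        \<open>auto intro: smooth_on_pd smooth_on_nth\<close>)
qed

text \<open>The correction term is the derivative of the logarithm of the Jacobian determinant because
  \<open>\<partial>\<^sub>a \<partial>\<^sub>b \<phi>\<^sup>p\<close> is symmetric in \<open>a\<close> and \<open>b\<close>.\<close>

lemma divergence_pushforward:
  fixes \<phi> :: "real ^ 'n \<Rightarrow> real ^ 'n"
  assumes U: "open U" "x \<in> U" and \<phi>: "smooth_on \<phi> U"
    and det: "\<And>y. y \<in> U \<Longrightarrow> det (jacobian \<phi> (at y)) > 0"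
    and V: "\<And>b. (\<lambda>y. V y $ b) differentiable (at x)"
    and V': "\<And>p. (\<lambda>z. V' z $ p) differentiable (at (\<phi> x))"
    and eq: "\<And>y p. y \<in> U \<Longrightarrow> V' (\<phi> y) $ p = (\<Sum>b\<in>UNIV. jacobian \<phi> (at y) $ p $ b * V y $ b)"
  shows "divergence V' (\<phi> x) =
    divergence V x + (\<Sum>b\<in>UNIV. V x $ b * pd b (\<lambda>y. ln (det (jacobian \<phi> (at y)))) x)"
proof -
  define j where "j p b = pd b (\<lambda>y. \<phi> y $ p)" for p b
  define M where "M y = jacobian \<phi> (at y)" for y
  have M: "M y $ p $ b = j p b y" if "y \<in> U" for y p b
    unfolding M_def j_def by (rule jacobian_nth) (rule smooth_on_differentiable[OF \<phi> that])
  have sj: "smooth_on (j p b) U" for p b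
    unfolding j_def using U \<phi> by (intro smooth_on_pd smooth_on_nth)
  have dj: "j p b differentiable (at x)" for p b
    using smooth_on_differentiable[OF sj U(2)] .
  have sM: "smooth_on M U" unfolding M_def using U \<phi> by (intro smooth_on_jacobian)
  have dM: "M differentiable (at x)" using smooth_on_differentiable[OF sM U(2)] .
  have dphi: "\<phi> differentiable (at x)" using smooth_on_differentiable[OF \<phi> U(2)] .
  have sym: "pd a (j p b) x = pd b (j p a) x" for a b p
    unfolding j_def using U \<phi> by (intro pd_commute[OF U(1)] smooth_on_nth)
  have "invertible (M x)" using det[OF U(2)] by (simp add: invertible_det_nz M_def)
  then obtain K where K: "M x ** K = mat 1" "K ** M x = mat 1" by (auto simp: invertible_def)
  have K1: "(\<Sum>l\<in>UNIV. j p l x * K $ l $ q) = (if p = q then 1 else 0)" for p q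
    using K(1) M[OF U(2)] by (simp add: vec_eq_iff matrix_matrix_mult_def mat_def)
  have K2: "(\<Sum>l\<in>UNIV. K $ p $ l * j l q x) = (if p = q then 1 else 0)" for p q
    using K(2) M[OF U(2)] by (simp add: vec_eq_iff matrix_matrix_mult_def mat_def)
  have chain: "(\<Sum>q\<in>UNIV. pd q (\<lambda>z. V' z $ p) (\<phi> x) * j q a x) =
      (\<Sum>b\<in>UNIV. pd a (j p b) x * V x $ b + j p b x * pd a (\<lambda>y. V y $ b) x)" for p a
  proof -
    have "(\<Sum>q\<in>UNIV. pd q (\<lambda>z. V' z $ p) (\<phi> x) * j q a x) = pd a (\<lambda>y. V' (\<phi> y) $ p) x"
      using pd_compose[OF V' dphi] by (simp add: j_def)
    also have "\<dots> = pd a (\<lambda>y. \<Sum>b\<in>UNIV. j p b y * V y $ b) x"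
      by (rule pd_cong[OF U]) (simp add: eq M[unfolded M_def])
    also have "\<dots> = (\<Sum>b\<in>UNIV. pd a (\<lambda>y. j p b y * V y $ b) x)"
      by (rule pd_sum) (intro differentiable_mult dj V)
    finally show ?thesis by (simp add: pd_mult[OF dj V] add.commute)
  qed
  have ln: "pd b (\<lambda>y. ln (det (M y))) x = (\<Sum>p\<in>UNIV. \<Sum>l\<in>UNIV. K $ l $ p * pd b (j p l) x)" for b
  proof -
    have "pd b (\<lambda>y. ln (det (M y))) x = inverse (det (M x)) * pd b (\<lambda>y. det (M y)) x"
      using smooth_on_differentiable[OF smooth_on_det[OF U(1) sM] U(2)] det[OF U(2)]
      by (intro pd_real_compose DERIV_ln) (auto simp: M_def)
    also have "pd b (\<lambda>y. det (M y)) x = det (M x) * (\<Sum>p\<in>UNIV. \<Sum>l\<in>UNIV. K $ l $ p * pd b (\<lambda>y. M y $ p $ l) x)"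
      by (rule pd_det[where M = M and K = K and x = x, OF _ K(2)]) (intro differentiable_vec_nth dM)
    finally show ?thesis
      using det[OF U(2)] pd_cong[OF U M] by (simp add: M_def)
  qed
  have "divergence V' (\<phi> x) = (\<Sum>p\<in>UNIV. \<Sum>q\<in>UNIV. pd q (\<lambda>z. V' z $ p) (\<phi> x) * (if q = p then 1 else 0))"
    by (simp add: divergence_def if_distrib cong: if_cong)
  \<comment> \<open>The Kronecker symbol is replaced by the Jacobian times its inverse, which turns
    derivatives along target coordinates into derivatives along source coordinates, where
    \<open>chain\<close> applies.\<close>
  also have "\<dots> = (\<Sum>p\<in>UNIV. \<Sum>q\<in>UNIV. pd q (\<lambda>z. V' z $ p) (\<phi> x) * (\<Sum>a\<in>UNIV. j q a x * K $ a $ p))"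
    by (simp only: K1)
  also have "\<dots> = (\<Sum>p\<in>UNIV. \<Sum>a\<in>UNIV. K $ a $ p * (\<Sum>q\<in>UNIV. pd q (\<lambda>z. V' z $ p) (\<phi> x) * j q a x))"
    unfolding sum_distrib_left by (rule sum.cong[OF refl], subst sum.swap) (simp add: mult_ac)
  also have "\<dots> = (\<Sum>p\<in>UNIV. \<Sum>a\<in>UNIV. \<Sum>b\<in>UNIV. V x $ b * (K $ a $ p * pd b (j p a) x))
      + (\<Sum>p\<in>UNIV. \<Sum>a\<in>UNIV. \<Sum>b\<in>UNIV. pd a (\<lambda>y. V y $ b) x * (K $ a $ p * j p b x))"
    unfolding chain sum_distrib_left
    by (simp add: sum.distrib[symmetric] sym algebra_simps)
  also have "(\<Sum>p\<in>UNIV. \<Sum>a\<in>UNIV. \<Sum>b\<in>UNIV. V x $ b * (K $ a $ p * pd b (j p a) x))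
      = (\<Sum>p\<in>UNIV. \<Sum>b\<in>UNIV. \<Sum>a\<in>UNIV. V x $ b * (K $ a $ p * pd b (j p a) x))"
    by (rule sum.cong[OF refl], rule sum.swap)
  also have "\<dots> = (\<Sum>b\<in>UNIV. V x $ b * pd b (\<lambda>y. ln (det (M y))) x)"
    unfolding ln sum_distrib_left by (rule sum.swap)
  also have "(\<Sum>p\<in>UNIV. \<Sum>a\<in>UNIV. \<Sum>b\<in>UNIV. pd a (\<lambda>y. V y $ b) x * (K $ a $ p * j p b x))
      = (\<Sum>a\<in>UNIV. \<Sum>b\<in>UNIV. pd a (\<lambda>y. V y $ b) x * (\<Sum>p\<in>UNIV. K $ a $ p * j p b x))"
    unfolding sum_distrib_left
    by (subst sum.swap, rule sum.cong[OF refl], rule sum.swap)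
  also have "\<dots> = divergence V x"
    unfolding K2 by (simp add: divergence_def if_distrib cong: if_cong)
  finally show ?thesis by (simp add: M_def)
qed

subsection \<open>Change of variables over an unordered index type\<close>

text \<open>The change of variables theorem of the library needs a well-ordered index type; this copy of
  a finite type has one.\<close>

datatype 'a ordered = Ordered (unOrdered: 'a)

instance ordered :: (finite) finite
proof
  have "x \<in> range Ordered" for x :: "'a ordered"
    by (cases x) auto
  then have "(UNIV :: 'a ordered set) = range Ordered"
    by auto
  then show "finite (UNIV :: 'a ordered set)"
    using finite_imageI[OF finite, of Ordered] by metis
qed

instantiation ordered :: (finite) wellorder
begin

text \<open>The order is pulled back along an injection into the natural numbers, from which it
  inherits well-foundedness. Only its existence matters, since determinants and integrals are
  insensitive to it.\<close>

definition less_eq_ordered :: "'a ordered \<Rightarrow> 'a ordered \<Rightarrow> bool" where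
  "x \<le> y \<longleftrightarrow> to_nat (unOrdered x) \<le> to_nat (unOrdered y)"

definition less_ordered :: "'a ordered \<Rightarrow> 'a ordered \<Rightarrow> bool" where
  "x < y \<longleftrightarrow> to_nat (unOrdered x) < to_nat (unOrdered y)"

instance
proof
  fix x y z :: "'a ordered" and P :: "'a ordered \<Rightarrow> bool"
  show "x < y \<longleftrightarrow> x \<le> y \<and> \<not> y \<le> x" "x \<le> x" "x \<le> y \<Longrightarrow> y \<le> z \<Longrightarrow> x \<le> z" "x \<le> y \<or> y \<le> x"
    by (auto simp: less_eq_ordered_def less_ordered_def)
  show "x = y" if "x \<le> y" "y \<le> x"
  proof -
    have "to_nat (unOrdered x) = to_nat (unOrdered y)"
      using that by (simp add: less_eq_ordered_def)
    then show ?thesis by (cases x; cases y) simp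
  qed
  assume P: "\<And>x. (\<And>y. y < x \<Longrightarrow> P y) \<Longrightarrow> P x"
  show "P x"
  proof (induction x rule: measure_induct_rule[where f = "\<lambda>x. to_nat (unOrdered x)"])
    case (less x)
    show ?case by (rule P, rule less) (simp add: less_ordered_def)
  qed
qed

end

section \<open>Relabelling the coordinates of a Euclidean space\<close>

definition reindex :: "('a \<Rightarrow> 'b) \<Rightarrow> real ^ 'b \<Rightarrow> real ^ 'a" where
  "reindex \<sigma> y = (\<chi> i. y $ \<sigma> i)"

lemma reindex_inverse:
  assumes "\<And>i. \<tau> (\<sigma> i) = i" shows "reindex \<sigma> (reindex \<tau> x) = x"
  using assms by (simp add: reindex_def vec_eq_iff)

lemma linear_reindex: "linear (reindex \<sigma>)"
  by (rule linearI) (auto simp: reindex_def vec_eq_iff)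

lemma norm_reindex:
  fixes \<sigma> :: "'a::finite \<Rightarrow> 'b::finite"
  assumes "bij \<sigma>" shows "norm (reindex \<sigma> y) = norm y"
  unfolding norm_vec_def L2_set_def reindex_def
  using sum.reindex_bij_betw[OF assms, of "\<lambda>j. (norm (y $ j))\<^sup>2"] by simp

lemma reindex_cbox:
  fixes \<sigma> :: "'a::finite \<Rightarrow> 'b::finite"
  assumes \<tau>: "\<And>i. \<tau> (\<sigma> i) = i" and \<sigma>: "\<And>j. \<sigma> (\<tau> j) = j"
  shows "reindex \<sigma> ` cbox u v = cbox (reindex \<sigma> u) (reindex \<sigma> v)"
proof
  show "reindex \<sigma> ` cbox u v \<subseteq> cbox (reindex \<sigma> u) (reindex \<sigma> v)"
    by (auto simp: mem_box_cart reindex_def)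
  show "cbox (reindex \<sigma> u) (reindex \<sigma> v) \<subseteq> reindex \<sigma> ` cbox u v"
  proof
    fix x assume x: "x \<in> cbox (reindex \<sigma> u) (reindex \<sigma> v)"
    have "u $ j \<le> x $ \<tau> j \<and> x $ \<tau> j \<le> v $ j" for j
      using x[unfolded mem_box_cart, rule_format, of "\<tau> j"] \<sigma>[of j] by (simp add: reindex_def)
    then have "reindex \<tau> x \<in> cbox u v" by (simp add: mem_box_cart reindex_def)
    then show "x \<in> reindex \<sigma> ` cbox u v"
      using reindex_inverse[of \<tau> \<sigma> x, OF \<tau>] by (metis image_eqI)
  qed
qed

text \<open>Relabelling maps boxes to boxes of the same content, which settles integrals over boxes.
  The integral over the whole space is a limit over boxes containing large balls, and relabelling
  preserves norms.\<close>

lemma has_integral_reindex: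
  fixes f :: "real ^ 'a::finite \<Rightarrow> real" and \<sigma> :: "'a \<Rightarrow> 'b::finite"
  assumes \<tau>: "\<And>i. \<tau> (\<sigma> i) = i" and \<sigma>: "\<And>j. \<sigma> (\<tau> j) = j"
    and f: "(f has_integral I) UNIV"
  shows "((\<lambda>y. f (reindex \<sigma> y)) has_integral I) UNIV"
proof -
  have bij: "bij \<sigma>" using \<tau> \<sigma> by (metis bijI')
  have inv: "reindex \<sigma> (reindex \<tau> x) = x" "reindex \<tau> (reindex \<sigma> y) = y" for x y
    using \<tau> \<sigma> by (auto intro: reindex_inverse)
  \<comment> \<open>The whole space is not a box, so \<open>has_integral_alt\<close> unfolds to its
    limit clause.\<close>
  have U: "\<not> (\<exists>a b. (UNIV :: (real ^ 'c::finite) set) = cbox a b)"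
    by (metis bounded_cbox not_bounded_UNIV)
  have content: "measure lborel (reindex \<sigma> ` cbox u v) = 1 * measure lborel (cbox u v)" for u v
  proof -
    have "cbox (reindex \<sigma> u) (reindex \<sigma> v) = {} \<longleftrightarrow> cbox u v = {}"
      using reindex_cbox[OF \<tau> \<sigma>, of u v] by (metis image_is_empty)
    moreover have "(\<Prod>i\<in>UNIV. v $ \<sigma> i - u $ \<sigma> i) = (\<Prod>j\<in>UNIV. v $ j - u $ j)"
      by (rule prod.reindex_bij_betw[OF bij])
    ultimately show ?thesis
      by (simp add: reindex_cbox[OF \<tau> \<sigma>] content_cbox_if_cart) (simp add: reindex_def)
  qed
  have twiddle: "((\<lambda>y. f (reindex \<sigma> y)) has_integral z) (cbox a b)"
    if "(f has_integral z) (cbox (reindex \<sigma> a) (reindex \<sigma> b))" for a b z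
  proof -
    have "((\<lambda>y. f (reindex \<sigma> y)) has_integral (1 / 1) *\<^sub>R z)
        (reindex \<tau> ` cbox (reindex \<sigma> a) (reindex \<sigma> b))"
    proof (rule has_integral_twiddle[OF _ _ _ _ _ _ _ that])
      show "continuous (at x) (reindex \<sigma>)" for x
        by (rule linear_continuous_at[OF linear_conv_bounded_linear[THEN iffD1, OF linear_reindex]])
      show "\<exists>w z. reindex \<sigma> ` cbox u v = cbox w z" "\<exists>w z. reindex \<tau> ` cbox u' v' = cbox w z" for u v u' v'
        using reindex_cbox[OF \<tau> \<sigma>] reindex_cbox[OF \<sigma> \<tau>] by blast+
    qed (simp_all add: inv content)
    then show ?thesis by (simp add: reindex_cbox[OF \<sigma> \<tau>] inv)
  qed
  show ?thesis
  proof (subst has_integral_alt, simp add: U, intro allI impI)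
    fix e :: real assume "e > 0"
    obtain B where B: "B > 0" "\<And>a b. ball 0 B \<subseteq> cbox a b \<Longrightarrow>
        \<exists>z. (f has_integral z) (cbox a b) \<and> norm (z - I) < e"
      using has_integral_altD[OF f U \<open>e > 0\<close>] by auto
    have "\<exists>z. ((\<lambda>y. f (reindex \<sigma> y)) has_integral z) (cbox a b) \<and> \<bar>z - I\<bar> < e"
      if ab: "ball 0 B \<subseteq> cbox a b" for a b
    proof -
      \<comment> \<open>The same radius \<open>B\<close> serves on both sides because relabelling is
        a norm-preserving bijection.\<close>
      have "ball 0 B \<subseteq> cbox (reindex \<sigma> a) (reindex \<sigma> b)"
      proof
        fix x :: "real ^ 'a" assume "x \<in> ball 0 B"
        have "bij \<tau>" using \<tau> \<sigma> by (metis bijI')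
        then have "reindex \<tau> x \<in> cbox a b"
          using \<open>x \<in> ball 0 B\<close> ab by (auto simp: subset_iff norm_reindex)
        then show "x \<in> cbox (reindex \<sigma> a) (reindex \<sigma> b)"
          using inv(1) reindex_cbox[OF \<tau> \<sigma>] by (metis image_eqI)
      qed
      then obtain z where "(f has_integral z) (cbox (reindex \<sigma> a) (reindex \<sigma> b))" "norm (z - I) < e"
        using B(2) by meson
      then show ?thesis using twiddle[of z a b] by auto
    qed
    then show "\<exists>B>0. \<forall>a b. ball 0 B \<subseteq> cbox a b \<longrightarrow>
        (\<exists>z. ((\<lambda>y. f (reindex \<sigma> y)) has_integral z) (cbox a b) \<and> \<bar>z - I\<bar> < e)"
      using B(1) by blast
  qed
qed

lemma absolutely_integrable_reindex:
  fixes f :: "real ^ 'a::finite \<Rightarrow> real" and \<sigma> :: "'a \<Rightarrow> 'b::finite"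
  assumes \<tau>: "\<And>i. \<tau> (\<sigma> i) = i" and \<sigma>: "\<And>j. \<sigma> (\<tau> j) = j"
    and f: "f absolutely_integrable_on S"
  shows "(\<lambda>y. f (reindex \<sigma> y)) absolutely_integrable_on (reindex \<tau> ` S)"
    and "integral (reindex \<tau> ` S) (\<lambda>y. f (reindex \<sigma> y)) = integral S f"
proof -
  have im: "y \<in> reindex \<tau> ` S \<longleftrightarrow> reindex \<sigma> y \<in> S" for y
    using reindex_inverse[of \<tau> \<sigma>, OF \<tau>] reindex_inverse[of \<sigma> \<tau>, OF \<sigma>] by (metis image_iff)
  have *: "((\<lambda>y. g (reindex \<sigma> y)) has_integral I) (reindex \<tau> ` S)"
    if "(g has_integral I) S" for g :: "real ^ 'a::finite \<Rightarrow> real" and I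
    using has_integral_reindex[OF \<tau> \<sigma>, of "\<lambda>x. if x \<in> S then g x else 0" I] that
    by (simp add: im[symmetric] has_integral_restrict_UNIV)
  show "(\<lambda>y. f (reindex \<sigma> y)) absolutely_integrable_on (reindex \<tau> ` S)"
    using f *[of f] *[of "\<lambda>x. norm (f x)"] by (auto simp: absolutely_integrable_on_def integrable_on_def)
  show "integral (reindex \<tau> ` S) (\<lambda>y. f (reindex \<sigma> y)) = integral S f"
    using *[of f "integral S f"] f by (metis absolutely_integrable_on_def integrable_integral integral_unique)
qed

text \<open>Conjugation sends transpositions to transpositions, so it preserves the length of a
  product of them and hence parity.\<close>

lemma evenperm_conj:
  assumes \<tau>: "\<And>i. \<tau> (\<sigma> i) = i" and \<sigma>: "\<And>j. \<sigma> (\<tau> j) = j" and "permutation p"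
  shows "evenperm (\<lambda>j. \<sigma> (p (\<tau> j))) = evenperm p"
proof -
  have "swapidseq n p \<Longrightarrow> swapidseq n (\<lambda>j. \<sigma> (p (\<tau> j)))" for n p
  proof (induction rule: swapidseq.induct)
    case id
    have "(\<lambda>j. \<sigma> (id (\<tau> j))) = id" by (simp add: \<sigma> fun_eq_iff)
    then show ?case by (metis swapidseq.id)
  next
    case (comp_Suc n p a b)
    have "(\<lambda>j. \<sigma> ((Transposition.transpose a b \<circ> p) (\<tau> j))) = Transposition.transpose (\<sigma> a) (\<sigma> b) \<circ> (\<lambda>j. \<sigma> (p (\<tau> j)))"
      using \<tau> by (auto simp: fun_eq_iff Transposition.transpose_def) metis+
    moreover have "\<sigma> a \<noteq> \<sigma> b" using comp_Suc \<tau> by metis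
    ultimately show ?case using swapidseq.comp_Suc[OF comp_Suc.IH] by simp
  qed
  then show ?thesis
    using \<open>permutation p\<close> evenperm_unique by (metis permutation_def)
qed

text \<open>Conjugation by the relabelling is a sign-preserving bijection between the permutations
  of the two index types, under which the Leibniz expansions agree term by term.\<close>

lemma det_reindex:
  fixes M :: "real ^ 'b::finite ^ 'b" and \<sigma> :: "'a::finite \<Rightarrow> 'b"
  assumes \<tau>: "\<And>i. \<tau> (\<sigma> i) = i" and \<sigma>: "\<And>j. \<sigma> (\<tau> j) = j"
  shows "det (\<chi> i j. M $ \<sigma> i $ \<sigma> j) = det M"
proof -
  have bij: "bij \<sigma>" using \<tau> \<sigma> by (metis bijI')
  have perm: "(\<lambda>i. g (p (h i))) permutes UNIV"
    if "p permutes UNIV" "\<And>i. g (h i) = i" "\<And>i. h (g i) = i"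
    for p :: "'c \<Rightarrow> 'c" and g :: "'c \<Rightarrow> 'd" and h
  proof -
    have "bij g" "bij h" using that(2,3) by (metis bijI')+
    then have "bij (g \<circ> p \<circ> h)" using permutes_bij[OF that(1)] by (intro bij_comp)
    then show ?thesis by (intro bij_imp_permutes) (simp_all add: o_def)
  qed
  have bb: "bij_betw (\<lambda>p i. \<tau> (p (\<sigma> i))) {p. p permutes (UNIV :: 'b set)} {p. p permutes (UNIV :: 'a set)}"
    by (rule bij_betwI[where g = "\<lambda>p j. \<sigma> (p (\<tau> j))"])
      (use perm[of _ \<tau> \<sigma>, OF _ \<tau> \<sigma>] perm[of _ \<sigma> \<tau>, OF _ \<sigma> \<tau>] in \<open>auto simp: \<tau> \<sigma>\<close>)
  have "det M = (\<Sum>p | p permutes (UNIV :: 'b set). of_int (sign p) * (\<Prod>j\<in>UNIV. M $ j $ p j))"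
    by (simp add: det_def)
  also have "\<dots> = (\<Sum>p | p permutes (UNIV :: 'b set). of_int (sign (\<lambda>i. \<tau> (p (\<sigma> i)))) *
      (\<Prod>i\<in>UNIV. M $ \<sigma> i $ \<sigma> (\<tau> (p (\<sigma> i)))))"
  proof (rule sum.cong[OF refl])
    fix p assume p: "p \<in> {p. p permutes (UNIV :: 'b set)}"
    then have "permutation p" using permutes_imp_permutation[of UNIV p] by auto
    then have "sign (\<lambda>i. \<tau> (p (\<sigma> i))) = sign p"
      using evenperm_conj[OF \<sigma> \<tau>, of p] by (simp add: sign_def)
    moreover have "(\<Prod>i\<in>UNIV. M $ \<sigma> i $ p (\<sigma> i)) = (\<Prod>j\<in>UNIV. M $ j $ p j)"
      by (rule prod.reindex_bij_betw[OF bij])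
    ultimately show "of_int (sign p) * (\<Prod>j\<in>UNIV. M $ j $ p j) = of_int (sign (\<lambda>i. \<tau> (p (\<sigma> i)))) *
      (\<Prod>i\<in>UNIV. M $ \<sigma> i $ \<sigma> (\<tau> (p (\<sigma> i))))" by (simp add: \<sigma>)
  qed
  also have "\<dots> = (\<Sum>q | q permutes (UNIV :: 'a set). of_int (sign q) * (\<Prod>i\<in>UNIV. M $ \<sigma> i $ \<sigma> (q i)))"
    using sum.reindex_bij_betw[OF bb, of "\<lambda>q. of_int (sign q) * (\<Prod>i\<in>UNIV. M $ \<sigma> i $ \<sigma> (q i))"] by simp
  finally show ?thesis by (simp add: det_def)
qed

text \<open>The change of variables theorem invoked here speaks of vector-valued integrands, so
  \<open>f\<close> is viewed as a map into \<open>real ^ 1\<close> and its single component is taken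
  at the end.\<close>

lemma change_of_variables_ordered:
  fixes f :: "real ^ 'm::{finite,wellorder} \<Rightarrow> real" and g :: "real ^ 'm::_ \<Rightarrow> real ^ 'm::_"
  assumes "S \<in> sets lebesgue" "\<And>x. x \<in> S \<Longrightarrow> (g has_derivative g' x) (at x within S)" "inj_on g S"
    and f: "f absolutely_integrable_on g ` S"
  shows "(\<lambda>x. \<bar>det (matrix (g' x))\<bar> * f (g x)) absolutely_integrable_on S"
    and "integral S (\<lambda>x. \<bar>det (matrix (g' x))\<bar> * f (g x)) = integral (g ` S) f"
proof -
  define F where "F y = (vec (f y) :: real ^ 1)" for y
  have b: "b \<in> (Basis :: (real ^ 1) set) \<Longrightarrow> vec c \<bullet> b = c" for b c
    by (auto simp: Basis_vec_def inner_axis)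
  have "F absolutely_integrable_on g ` S"
    using f by (subst absolutely_integrable_componentwise_iff) (simp add: F_def b)
  then have *: "(\<lambda>x. \<bar>det (matrix (g' x))\<bar> *\<^sub>R F (g x)) absolutely_integrable_on S \<and>
      integral S (\<lambda>x. \<bar>det (matrix (g' x))\<bar> *\<^sub>R F (g x)) = integral (g ` S) F"
    using has_absolute_integral_change_of_variables[OF assms(1-3), of F "integral (g ` S) F"] by simp
  have comp: "(\<lambda>x. h x $ (1::1)) absolutely_integrable_on T \<and> integral T (\<lambda>x. h x $ 1) = integral T h $ 1"
    if "h absolutely_integrable_on T" for h :: "real ^ 'm::_ \<Rightarrow> real ^ 1" and T
    using that absolutely_integrable_component[OF that, of "axis 1 1"]
    by (auto simp: absolutely_integrable_on_def inner_axis integral_component_eq_cart)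
  show "(\<lambda>x. \<bar>det (matrix (g' x))\<bar> * f (g x)) absolutely_integrable_on S"
    using comp[OF conjunct1[OF *]] by (simp add: F_def)
  show "integral S (\<lambda>x. \<bar>det (matrix (g' x))\<bar> * f (g x)) = integral (g ` S) f"
    using comp[OF conjunct1[OF *]] comp[OF \<open>F absolutely_integrable_on g ` S\<close>] * by (simp add: F_def)
qed

text \<open>The map is conjugated by the relabelling \<open>R\<close>. This changes neither the
  Jacobian determinant nor any integral, so the statement for the ordered copy of the index type can
  be read back.\<close>

lemma change_of_variables:
  fixes f :: "real ^ 'n \<Rightarrow> real" and g :: "real ^ 'n \<Rightarrow> real ^ 'n"
  assumes S: "S \<in> sets borel" and g': "\<And>x. x \<in> S \<Longrightarrow> (g has_derivative g' x) (at x within S)"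
    and inj: "inj_on g S" and f: "f absolutely_integrable_on g ` S"
  shows "(\<lambda>x. \<bar>det (matrix (g' x))\<bar> * f (g x)) absolutely_integrable_on S"
    and "integral S (\<lambda>x. \<bar>det (matrix (g' x))\<bar> * f (g x)) = integral (g ` S) f"
proof -
  define R where "R = (reindex unOrdered :: real ^ 'n \<Rightarrow> real ^ 'n ordered)"
  define R' where "R' = (reindex Ordered :: real ^ 'n ordered \<Rightarrow> real ^ 'n)"
  define G where "G = R \<circ> g \<circ> R'"
  define G' where "G' y = R \<circ> g' (R' y) \<circ> R'" for y
  have RR [simp]: "R (R' y) = y" "R' (R x) = x" for x y
    unfolding R_def R'_def by (auto intro!: reindex_inverse)
  have lin: "linear R" "linear R'" by (simp_all add: R_def R'_def linear_reindex)
  have bl: "bounded_linear R" "bounded_linear R'"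
    using lin linear_conv_bounded_linear by blast+
  have img: "G ` R ` S = R ` g ` S" by (simp add: G_def image_image)
  \<comment> \<open>The image is the preimage of \<open>S\<close> under the continuous inverse of
    \<open>R\<close>, and preimages of Borel sets under continuous maps are Borel.\<close>
  have meas: "R ` S \<in> sets lebesgue"
  proof -
    have "R ` S = R' -` S \<inter> space borel" using RR by (auto intro: image_eqI[where x = "R' _"])
    also have "\<dots> \<in> sets borel"
      using linear_continuous_on[OF bl(2)] S
      by (intro measurable_sets[of R' borel borel] borel_measurable_continuous_onI)
    finally show ?thesis by simp
  qed
  have der: "(G has_derivative G' y) (at y within R ` S)" if y: "y \<in> R ` S" for y
  proof -
    have "R' ` R ` S = S" by (simp add: image_image)
    then have "(g has_derivative g' (R' y)) (at (R' y) within R' ` R ` S)"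
      using y g' by auto
    then have "((\<lambda>y. R (g (R' y))) has_derivative (\<lambda>v. R (g' (R' y) (R' v)))) (at y within R ` S)"
      by (intro bounded_linear.has_derivative[OF bl(1)]
        has_derivative_in_compose[OF bounded_linear_imp_has_derivative[OF bl(2)]])
    then show ?thesis by (simp add: G_def G'_def o_def)
  qed
  have detG: "det (matrix (G' y)) = det (matrix (g' (R' y)))" if "y \<in> R ` S" for y
  proof -
    have "R' (axis j 1) = axis (unOrdered j) 1" for j
      by (auto simp: R'_def reindex_def axis_def vec_eq_iff)
    then have "matrix (G' y) = (\<chi> i j. matrix (g' (R' y)) $ unOrdered i $ unOrdered j)"
      by (simp add: matrix_def G'_def R_def reindex_def[of unOrdered])
    then show ?thesis
      using det_reindex[of Ordered unOrdered "matrix (g' (R' y))"] by simp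
  qed
  have injG: "inj_on G (R ` S)"
    using inj by (auto simp: inj_on_def G_def) (metis RR(2))
  have fR: "(\<lambda>y. f (R' y)) absolutely_integrable_on G ` R ` S"
      "integral (G ` R ` S) (\<lambda>y. f (R' y)) = integral (g ` S) f"
    using absolutely_integrable_reindex[OF _ _ f, of unOrdered Ordered]
    by (simp_all add: img R_def[symmetric] R'_def[symmetric])
  note cov = change_of_variables_ordered[OF meas der injG fR(1)]
  let ?H = "\<lambda>y. \<bar>det (matrix (G' y))\<bar> * f (R' (G y))"
  have undo: "R' ` R ` S = S" "reindex Ordered = R'" "reindex unOrdered = R"
    by (simp add: image_image) (simp_all only: R'_def R_def)
  have H: "?H (R x) = \<bar>det (matrix (g' x))\<bar> * f (g x)" if "x \<in> S" for x
    using that detG[of "R x"] by (simp add: G_def)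
  have "(\<lambda>x. ?H (R x)) absolutely_integrable_on S" "integral S (\<lambda>x. ?H (R x)) = integral (R ` S) ?H"
    using absolutely_integrable_reindex[OF _ _ cov(1), of Ordered unOrdered] by (simp_all add: undo)
  then show "(\<lambda>x. \<bar>det (matrix (g' x))\<bar> * f (g x)) absolutely_integrable_on S"
    and "integral S (\<lambda>x. \<bar>det (matrix (g' x))\<bar> * f (g x)) = integral (g ` S) f"
    using H cov(2) fR(2)
    by (auto simp: set_integrable_cong[OF refl refl H] intro: integral_cong cong: integral_cong)
qed

subsection \<open>Integration by parts\<close>

lemma absolutely_integrable_compact_support:
  fixes f :: "'a::euclidean_space \<Rightarrow> real"
  assumes "compact K" "K \<subseteq> U" "continuous_on U f" "\<And>x. x \<in> U - K \<Longrightarrow> f x = 0"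
  shows "f absolutely_integrable_on U"
proof -
  have *: "integrable lborel (\<lambda>x. indicator K x *\<^sub>R f x)"
    using assms(1) continuous_on_subset[OF assms(3,2)] by (rule borel_integrable_compact)
  then have "integrable lebesgue (\<lambda>x. indicator K x *\<^sub>R f x)"
    using integrable_completion[OF borel_measurable_integrable[OF *]] by simp
  moreover have "(\<lambda>x. indicator K x *\<^sub>R f x) = (\<lambda>x. indicator U x *\<^sub>R f x)"
    using assms(2,4) by (auto simp: indicator_def fun_eq_iff)
  ultimately show ?thesis by (simp add: set_integrable_def)
qed

lemma pd_const_fun [simp]: "pd a (\<lambda>_. c) = (\<lambda>_. 0)"
  by (rule ext) simp

lemma pd_eq_zero_outside:
  assumes "open U" "closed K" "\<And>x. x \<in> U - K \<Longrightarrow> f x = 0" "x \<in> U - K"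
  shows "pd a f x = 0"
proof -
  have "pd a f x = pd a (\<lambda>_. 0) x"
    by (rule pd_cong[of "U - K"]) (use assms in auto)
  then show ?thesis by simp
qed

text \<open>The open sets \<open>U\<close> and \<open>- K\<close> cover the space. The extension is
  \<open>f\<close> on the first and 0 on the second, and smoothness is local.\<close>

lemma smooth_on_extend_zero:
  assumes "open U" "closed K" "smooth_on f U" "\<And>x. x \<in> U - K \<Longrightarrow> f x = 0" "K \<subseteq> U"
  shows "smooth_on (\<lambda>x. if x \<in> U then f x else 0) UNIV"
proof -
  let ?F = "\<lambda>x. if x \<in> U then f x else 0"
  have "smooth_on ?F U"
    by (rule smooth_on_cong[OF assms(1) _ assms(3)]) auto
  moreover have "smooth_on ?F (- K)"
    by (rule smooth_on_cong[of _ "\<lambda>_. 0"]) (use assms in \<open>auto intro: smooth_on_const\<close>)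
  ultimately have "smooth_on ?F (U \<union> - K)"
    using assms by (intro smooth_on_Un) auto
  moreover have "U \<union> - K = UNIV" using assms(5) by auto
  ultimately show ?thesis by simp
qed

text \<open>By translation invariance every difference quotient of the zero extension
  \<open>F\<close> has integral 0. Dominated convergence carries this over to the derivative, with
  no iterated integration.\<close>

lemma integral_pd_zero:
  fixes f :: "real ^ 'n \<Rightarrow> real"
  assumes U: "open U" and K: "compact K" "K \<subseteq> U" and f: "smooth_on f U"
    and supp: "\<And>x. x \<in> U - K \<Longrightarrow> f x = 0"
  shows "integral U (pd a f) = 0"
proof -
  define F where "F x = (if x \<in> U then f x else 0)" for x
  have cK: "closed K" using K(1) by (rule compact_imp_closed)
  have sF: "smooth_on F UNIV"
    unfolding F_def using U cK f supp K(2) by (intro smooth_on_extend_zero)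
  have F0: "F x = 0" if "x \<notin> K" for x using supp that by (auto simp: F_def)
  have contF: "continuous_on UNIV F" "continuous_on UNIV (pd a F)"
    using smooth_on_continuous sF smooth_on_pd by blast+
  have pF0: "pd a F x = 0" if "x \<notin> K" for x
    using F0 that cK by (intro pd_eq_zero_outside[of UNIV K]) auto
  have intF: "integrable lborel F"
  proof -
    have "(\<lambda>x. indicator K x *\<^sub>R F x) = F" using F0 by (auto simp: indicator_def fun_eq_iff)
    then show ?thesis
      using borel_integrable_compact[OF K(1) continuous_on_subset[OF contF(1)]] by simp
  qed
  have mF: "F \<in> borel_measurable borel"
    using contF(1) by (intro borel_measurable_continuous_onI)
  define e where "e = (axis a 1 :: real ^ 'n)"
  have shift: "integrable lborel (\<lambda>x. F (c + x))" "integral\<^sup>L lborel (\<lambda>x. F (c + x)) = integral\<^sup>L lborel F" for c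
  proof -
    have d: "lborel = distr lborel borel ((+) c)" by (rule lborel_distr_plus[symmetric])
    show "integrable lborel (\<lambda>x. F (c + x))"
      using intF by (subst (asm) d) (simp add: integrable_distr_eq mF)
    show "integral\<^sup>L lborel (\<lambda>x. F (c + x)) = integral\<^sup>L lborel F"
      by (subst (2) d) (simp add: integral_distr mF)
  qed
  \<comment> \<open>Steps of length at most 1 keep the supports of all difference quotients in one
    ball, of radius \<open>R + 1\<close> below, which provides an integrable bound.\<close>
  define h where "h n = inverse (real (Suc n))" for n
  have h: "0 < h n" "h n \<le> 1" for n by (auto simp: h_def inverse_le_1_iff)
  define q where "q n x = (F (h n *\<^sub>R e + x) - F x) / h n" for n x
  obtain C where C: "\<And>x. \<bar>pd a F x\<bar> \<le> C"
  proof -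
    have "bounded (pd a F ` K)"
      using compact_continuous_image[OF continuous_on_subset[OF contF(2)] K(1)] compact_imp_bounded by blast
    then obtain B where B: "\<And>x. x \<in> K \<Longrightarrow> \<bar>pd a F x\<bar> \<le> B" by (auto simp: bounded_iff)
    have "\<bar>pd a F x\<bar> \<le> max B 0" for x using B[of x] pF0[of x] by (cases "x \<in> K") auto
    then show ?thesis by (rule that)
  qed
  have line: "((\<lambda>s. F (x + s *\<^sub>R e)) has_field_derivative pd a F (x + s *\<^sub>R e)) (at s)" for x s
    unfolding e_def by (rule line_derivative) (rule smooth_on_differentiable[OF sF], simp)
  have qC: "\<bar>q n x\<bar> \<le> C" for n x
  proof -
    obtain z where "F (x + h n *\<^sub>R e) - F (x + 0 *\<^sub>R e) = (h n - 0) * pd a F (x + z *\<^sub>R e)"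
      using MVT2[OF h(1)[of n], of "\<lambda>s. F (x + s *\<^sub>R e)" "\<lambda>s. pd a F (x + s *\<^sub>R e)"] line by blast
    then have "q n x = pd a F (x + z *\<^sub>R e)"
      using h(1)[of n] by (simp add: q_def add.commute)
    then show ?thesis using C by simp
  qed
  obtain R where R: "\<And>x. x \<in> K \<Longrightarrow> norm x \<le> R"
    using compact_imp_bounded[OF K(1)] by (auto simp: bounded_iff)
  have q0: "q n x = 0" if "x \<notin> cball 0 (R + 1)" for n x
  proof -
    have "norm x \<le> norm (h n *\<^sub>R e + x) + norm (h n *\<^sub>R e)"
      using norm_triangle_ineq4[of "h n *\<^sub>R e + x" "h n *\<^sub>R e"] by simp
    also have "norm (h n *\<^sub>R e) \<le> 1" using h[of n] by (simp add: e_def norm_axis_1)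
    finally have "norm (h n *\<^sub>R e + x) > R" "norm x > R" using that by auto
    then have "h n *\<^sub>R e + x \<notin> K" "x \<notin> K" using R by fastforce+
    then show ?thesis by (simp add: q_def F0)
  qed
  have "(\<lambda>n. integral\<^sup>L lborel (q n)) \<longlonglongrightarrow> integral\<^sup>L lborel (pd a F)"
  proof (rule integral_dominated_convergence[where w = "\<lambda>x. indicator (cball 0 (R + 1)) x *\<^sub>R C"])
    show "pd a F \<in> borel_measurable lborel"
      using contF(2) by (simp add: borel_measurable_continuous_onI)
    show "q n \<in> borel_measurable lborel" for n
      unfolding q_def using contF(1) h(1)[of n]
      by (auto intro!: borel_measurable_continuous_onI continuous_intros
        continuous_on_compose2[OF contF(1)])
    show "integrable lborel (\<lambda>x. indicator (cball 0 (R + 1)) x *\<^sub>R C :: real)"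
      by (rule borel_integrable_compact) auto
    show "AE x in lborel. (\<lambda>n. q n x) \<longlonglongrightarrow> pd a F x"
    proof (rule AE_I2)
      fix x
      have "((\<lambda>t. (F (x + t *\<^sub>R e) - F x) / t) \<longlongrightarrow> pd a F x) (at 0)"
        using line[of x 0] by (simp add: DERIV_def)
      moreover have "filterlim h (at 0) sequentially"
        unfolding filterlim_at using LIMSEQ_inverse_real_of_nat
        by (auto simp: h_def[abs_def])
      ultimately have "(\<lambda>n. (F (x + h n *\<^sub>R e) - F x) / h n) \<longlonglongrightarrow> pd a F x"
        by (rule filterlim_compose)
      then show "(\<lambda>n. q n x) \<longlonglongrightarrow> pd a F x" by (simp add: q_def add.commute)
    qed
    show "AE x in lborel. norm (q n x) \<le> indicator (cball 0 (R + 1)) x *\<^sub>R C" for n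
      using qC q0 by (auto simp: indicator_def)
  qed
  moreover have "integral\<^sup>L lborel (q n) = 0" for n
    unfolding q_def using shift intF by simp
  ultimately have "integral\<^sup>L lborel (pd a F) = 0"
    by (simp add: LIMSEQ_const_iff)
  moreover have "integrable lborel (pd a F)"
  proof -
    have "(\<lambda>x. indicator K x *\<^sub>R pd a F x) = pd a F" using pF0 by (auto simp: indicator_def fun_eq_iff)
    then show ?thesis
      using borel_integrable_compact[OF K(1) continuous_on_subset[OF contF(2)]] by simp
  qed
  ultimately have "integral UNIV (pd a F) = 0"
    using integral_lborel by metis
  moreover have "integral U (pd a f) = integral UNIV (pd a F)"
  proof -
    have "(if x \<in> U then pd a f x else 0) = pd a F x" for x
    proof (cases "x \<in> U")
      case True
      then have "pd a f x = pd a F x" by (intro pd_cong[OF U]) (auto simp: F_def)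
      then show ?thesis using True by simp
    qed (use pF0 K(2) in auto)
    then show ?thesis using integral_restrict_UNIV[of U "pd a f"] by simp
  qed
  ultimately show ?thesis by simp
qed

text \<open>If \<open>h x\<close> were nonzero, \<open>h\<close> would keep its sign near
  \<open>x\<close>. Testing with a bump function concentrated there gives a continuous integrand of
  constant sign with integral 0, which must vanish on a box around \<open>x\<close>, although at
  \<open>x\<close> it does not.\<close>

lemma fundamental_lemma:
  fixes h :: "real ^ 'n \<Rightarrow> real"
  assumes U: "open U" and h: "continuous_on U h"
    and int: "\<And>f K. smooth_on f UNIV \<Longrightarrow> compact K \<Longrightarrow> K \<subseteq> U \<Longrightarrow> (\<And>x. x \<notin> K \<Longrightarrow> f x = 0) \<Longrightarrow>
      integral U (\<lambda>x. f x * h x) = 0"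
    and x: "x \<in> U"
  shows "h x = 0"
proof (rule ccontr)
  assume hx: "h x \<noteq> 0"
  \<comment> \<open>The sign factor reduces both cases to a function that is positive at
    \<open>x\<close>.\<close>
  define g where "g y = h y * sgn (h x)" for y
  have "continuous_on U g" unfolding g_def using h by (intro continuous_intros)
  then have gc: "continuous (at x) g" using U x by (simp add: continuous_on_eq_continuous_at)
  have gx: "g x > 0" using hx by (simp add: g_def sgn_if)
  obtain d where d: "d > 0" "\<And>y. dist y x < d \<Longrightarrow> dist (g y) (g x) < g x"
    using gc gx unfolding continuous_at_eps_delta by metis
  have gpos: "g y > 0" if "dist x y < d" for y
    using d(2)[of y] that by (simp add: dist_real_def abs_if dist_commute split: if_splits)
  obtain r where r: "r > 0" "cball x r \<subseteq> U" using U x open_contains_cball by blast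
  define s where "s = min (d/2) r"
  have s: "s > 0" "cball x s \<subseteq> U" "\<And>y. y \<in> cball x s \<Longrightarrow> g y > 0"
    using d r gpos by (auto simp: s_def subset_iff)
  obtain f :: "real ^ 'n \<Rightarrow> real" where f: "smooth_on f UNIV" "\<And>y. 0 \<le> f y"
    "\<And>y. y \<in> ball x (s/2) \<Longrightarrow> f y = 1" "\<And>y. y \<notin> ball x s \<Longrightarrow> f y = 0"
    using plateau_exists[OF s(1)] by metis
  have f0: "f y = 0" if "y \<notin> cball x s" for y using f(4)[of y] that by auto
  have "integral U (\<lambda>y. f y * h y) = 0"
    using f s f0 by (intro int[of f "cball x s"]) auto
  then have i0: "integral U (\<lambda>y. f y * g y) = 0"
    using integral_mult_left[of U "\<lambda>y. f y * h y" "sgn (h x)"] by (simp add: g_def mult.assoc)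
  have "continuous_on U (\<lambda>y. f y * g y)"
    using \<open>continuous_on U g\<close> continuous_on_subset[OF smooth_on_continuous[OF f(1)]]
    by (intro continuous_intros) auto
  then have ab: "(\<lambda>y. f y * g y) absolutely_integrable_on U"
    by (rule absolutely_integrable_compact_support[OF compact_cball s(2)]) (use f0 in auto)
  have nn: "0 \<le> f y * g y" if "y \<in> U" for y
    using f(2)[of y] s(3)[of y] f0[of y] by (cases "y \<in> cball x s") (auto intro: mult_nonneg_nonneg)
  \<comment> \<open>Passing to a box gives access to the criterion that a nonnegative continuous
    function with integral 0 over a box vanishes there.\<close>
  obtain a b where ab': "x \<in> box a b" "cbox a b \<subseteq> ball x (s/2)"
    by (rule open_contains_cbox[of "ball x (s/2)" x]) (use s(1) in auto)
  have sub: "cbox a b \<subseteq> U" using ab'(2) s(1,2) by (auto simp: subset_iff)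
  have cbox_int: "(\<lambda>y. f y * g y) integrable_on cbox a b"
    using \<open>continuous_on U (\<lambda>y. f y * g y)\<close> sub by (intro integrable_continuous) (rule continuous_on_subset)
  have "(\<lambda>y. f y * g y) integrable_on U" using ab by (simp add: absolutely_integrable_on_def)
  then have "integral (cbox a b) (\<lambda>y. f y * g y) \<le> integral U (\<lambda>y. f y * g y)"
    by (intro integral_subset_le sub cbox_int) (use nn in auto)
  moreover have "0 \<le> integral (cbox a b) (\<lambda>y. f y * g y)"
    using nn sub by (intro integral_nonneg cbox_int) auto
  ultimately have "((\<lambda>y. f y * g y) has_integral 0) (cbox a b)"
    using i0 integrable_integral[OF cbox_int] by auto
  moreover have "x \<in> cbox a b" and "\<And>y. y \<in> box a b \<Longrightarrow> 0 \<le> f y * g y"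
    using ab'(1) nn sub box_subset_cbox[of a b] by blast+
  ultimately have "f x * g x = 0"
    using ab'(1) continuous_on_subset[OF \<open>continuous_on U (\<lambda>y. f y * g y)\<close> sub]
    by (intro has_integral_0_cbox_imp_0[of a b "\<lambda>y. f y * g y"]) auto
  moreover have "f x = 1" using f(3) s(1) by simp
  ultimately show False using gx by simp
qed

subsection \<open>Second order operators in coordinates\<close>

lemma smooth_on_tensor_divergence:
  assumes "open U" "smooth_on P U" shows "smooth_on (tensor_divergence P) U"
proof (rule smooth_on_vec[OF assms(1)])
  show "smooth_on (\<lambda>x. tensor_divergence P x $ i) U" for i
    unfolding tensor_divergence_def using assms
    by (auto intro!: smooth_on_sum smooth_on_pd smooth_on_nth)
qed

lemma smooth_on_divergence:
  assumes "open U" "smooth_on V U" shows "smooth_on (divergence V) U"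
  unfolding divergence_def[abs_def] using assms
  by (intro smooth_on_sum smooth_on_pd smooth_on_nth)

lemma smooth_on_op2:
  assumes "open U" "smooth_on P U" "smooth_on V U" "smooth_on W U" "smooth_on f U"
  shows "smooth_on (op2 P V W f) U"
  unfolding op2_def[abs_def] using assms
  by (intro smooth_on_add smooth_on_sum smooth_on_mult smooth_on_pd smooth_on_nth)

lemma pd_pd_cong:
  assumes "open U" "x \<in> U" "\<And>y. y \<in> U \<Longrightarrow> f y = g y"
  shows "pd a (pd b f) x = pd a (pd b g) x"
  by (rule pd_cong[OF assms(1,2)], rule pd_cong[OF assms(1)]) (use assms(3) in auto)

lemma op2_cong:
  assumes "open U" "x \<in> U" "\<And>y. y \<in> U \<Longrightarrow> f y = g y"
  shows "op2 P V W f x = op2 P V W g x"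
proof -
  have "pd a (pd b f) x = pd a (pd b g) x" "pd a f x = pd a g x" for a b
    by (rule pd_pd_cong[OF assms(1,2)], rule assms(3), assumption)
      (rule pd_cong[OF assms(1,2)], rule assms(3), assumption)
  then show ?thesis using assms(2,3) by (simp add: op2_def)
qed

text \<open>Lagrange's identity: the difference between an operator and its formal adjoint, tested
  on \<open>f\<close> and \<open>g\<close>, is a divergence. The products of first derivatives
  cancel by the symmetry of \<open>P\<close>, and \<open>W\<close> cancels outright.\<close>

lemma op2_lagrange_identity:
  fixes P :: "real ^ 'n \<Rightarrow> real ^ 'n ^ 'n"
  assumes U: "open U" and x: "x \<in> U" and s: "smooth_on P U" "smooth_on V U" "smooth_on f U" "smooth_on g U"
    and sym: "\<And>y a b. y \<in> U \<Longrightarrow> P y $ a $ b = P y $ b $ a"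
  shows "op2 P V W f x * g x - f x * op2 P (\<lambda>x. 2 *\<^sub>R tensor_divergence P x - V x)
      (\<lambda>x. divergence (tensor_divergence P) x - divergence V x + W x) g x
    = (\<Sum>a\<in>UNIV. pd a (\<lambda>y. (\<Sum>b\<in>UNIV. P y $ a $ b * (g y * pd b f y - f y * pd b g y))
        + (V y $ a - tensor_divergence P y $ a) * (f y * g y)) x)"
proof -
  define T where "T = tensor_divergence P"
  have sT: "smooth_on T U" unfolding T_def using U s by (intro smooth_on_tensor_divergence)
  have diff: "h differentiable (at x)" if "smooth_on h U" for h :: "real ^ 'n \<Rightarrow> real"
    using smooth_on_differentiable[OF that x] .
  have dP: "(\<lambda>y. P y $ a $ b) differentiable (at x)" for a b
    using U s by (intro diff smooth_on_nth)
  have dV: "(\<lambda>y. V y $ a) differentiable (at x)" "(\<lambda>y. T y $ a) differentiable (at x)" for a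
    using U s sT by (auto intro!: diff smooth_on_nth)
  have df: "f differentiable (at x)" "g differentiable (at x)" using s diff by auto
  have dpf: "pd b f differentiable (at x)" "pd b g differentiable (at x)" for b
    using s by (auto intro!: diff smooth_on_pd)
  have T: "T x $ b = (\<Sum>a\<in>UNIV. pd a (\<lambda>y. P y $ a $ b) x)" for b
    by (simp add: T_def tensor_divergence_def)
  have step: "pd a (\<lambda>y. (\<Sum>b\<in>UNIV. P y $ a $ b * (g y * pd b f y - f y * pd b g y))
        + (V y $ a - T y $ a) * (f y * g y)) x =
      (\<Sum>b\<in>UNIV. pd a (\<lambda>y. P y $ a $ b) x * (g x * pd b f x - f x * pd b g x)
        + P x $ a $ b * (g x * pd a (pd b f) x - f x * pd a (pd b g) x)
        + P x $ a $ b * (pd a g x * pd b f x - pd a f x * pd b g x))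
      + (pd a (\<lambda>y. V y $ a) x - pd a (\<lambda>y. T y $ a) x) * (f x * g x)
      + (V x $ a - T x $ a) * (pd a f x * g x + f x * pd a g x)" for a
  proof -
    have d1: "(\<lambda>y. P y $ a $ b * (g y * pd b f y - f y * pd b g y)) differentiable (at x)" for b
      by (intro differentiable_mult differentiable_diff dP df dpf)
    have "pd a (\<lambda>y. P y $ a $ b * (g y * pd b f y - f y * pd b g y)) x =
        pd a (\<lambda>y. P y $ a $ b) x * (g x * pd b f x - f x * pd b g x)
        + P x $ a $ b * (g x * pd a (pd b f) x - f x * pd a (pd b g) x)
        + P x $ a $ b * (pd a g x * pd b f x - pd a f x * pd b g x)" for b
      using df dpf dP
      by (simp add: pd_mult pd_diff differentiable_mult differentiable_diff algebra_simps)
    moreover have "pd a (\<lambda>y. (V y $ a - T y $ a) * (f y * g y)) x =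
        (pd a (\<lambda>y. V y $ a) x - pd a (\<lambda>y. T y $ a) x) * (f x * g x)
        + (V x $ a - T x $ a) * (pd a f x * g x + f x * pd a g x)"
      using df dV
      by (simp add: pd_mult pd_diff differentiable_mult differentiable_diff algebra_simps)
    ultimately show ?thesis
      using df dV d1
      by (subst pd_add) (auto simp: pd_sum intro!: differentiable_sum_fun differentiable_mult differentiable_diff)
  qed
  \<comment> \<open>A symmetric tensor contracted with an antisymmetric one.\<close>
  have anti: "(\<Sum>a\<in>UNIV. \<Sum>b\<in>UNIV. P x $ a $ b * (pd a g x * pd b f x - pd a f x * pd b g x)) = 0"
  proof -
    have "(\<Sum>a\<in>UNIV. \<Sum>b\<in>UNIV. P x $ a $ b * (pd a g x * pd b f x))
        = (\<Sum>a\<in>UNIV. \<Sum>b\<in>UNIV. P x $ a $ b * (pd a f x * pd b g x))"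
      by (subst sum.swap) (simp add: sym[OF x] mult_ac)
    then show ?thesis by (simp add: right_diff_distrib sum_subtractf)
  qed
  have div: "(\<Sum>a\<in>UNIV. \<Sum>b\<in>UNIV. pd a (\<lambda>y. P y $ a $ b) x * (g x * pd b f x - f x * pd b g x))
      = (\<Sum>b\<in>UNIV. T x $ b * (g x * pd b f x - f x * pd b g x))"
    unfolding T sum_distrib_right by (rule sum.swap)
  have "(\<Sum>a\<in>UNIV. pd a (\<lambda>y. (\<Sum>b\<in>UNIV. P y $ a $ b * (g y * pd b f y - f y * pd b g y))
        + (V y $ a - T y $ a) * (f y * g y)) x)
      = (\<Sum>b\<in>UNIV. T x $ b * (g x * pd b f x - f x * pd b g x))
        + (\<Sum>a\<in>UNIV. \<Sum>b\<in>UNIV. P x $ a $ b * (g x * pd a (pd b f) x - f x * pd a (pd b g) x))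
        + (\<Sum>a\<in>UNIV. (pd a (\<lambda>y. V y $ a) x - pd a (\<lambda>y. T y $ a) x) * (f x * g x))
        + (\<Sum>a\<in>UNIV. (V x $ a - T x $ a) * (pd a f x * g x + f x * pd a g x))"
    unfolding step sum.distrib anti div by simp
  also have "\<dots> = op2 P V W f x * g x - f x * op2 P (\<lambda>x. 2 *\<^sub>R T x - V x)
      (\<lambda>x. divergence T x - divergence V x + W x) g x"
    unfolding op2_def divergence_def
    by (simp add: algebra_simps sum.distrib sum_subtractf sum_distrib_left sum_distrib_right)
  finally show ?thesis by (simp add: T_def)
qed

text \<open>Every term of the vector field \<open>Z\<close> in the Lagrange identity contains
  \<open>f\<close> or a first derivative of \<open>f\<close>. Compact support of \<open>f\<close>
  alone therefore gives \<open>Z\<close> compact support, and the integral of its divergence is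
  0.\<close>

lemma op2_adjoint:
  fixes P :: "real ^ 'n \<Rightarrow> real ^ 'n ^ 'n"
  assumes U: "open U" and K: "compact K" "K \<subseteq> U"
    and s: "smooth_on P U" "smooth_on V U" "smooth_on W U" "smooth_on f U" "smooth_on g U"
    and sym: "\<And>y a b. y \<in> U \<Longrightarrow> P y $ a $ b = P y $ b $ a"
    and supp: "\<And>x. x \<in> U - K \<Longrightarrow> f x = 0"
  shows "integral U (\<lambda>x. op2 P V W f x * g x) =
    integral U (\<lambda>x. f x * op2 P (\<lambda>x. 2 *\<^sub>R tensor_divergence P x - V x)
      (\<lambda>x. divergence (tensor_divergence P) x - divergence V x + W x) g x)" (is "_ = integral U ?R")
proof -
  define Z where "Z a y = (\<Sum>b\<in>UNIV. P y $ a $ b * (g y * pd b f y - f y * pd b g y))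
        + (V y $ a - tensor_divergence P y $ a) * (f y * g y)" for a y
  have cK: "closed K" using K(1) by (rule compact_imp_closed)
  have sZ: "smooth_on (Z a) U" for a
    unfolding Z_def using U s
    by (intro smooth_on_add smooth_on_sum smooth_on_mult smooth_on_diff smooth_on_pd smooth_on_nth
      smooth_on_tensor_divergence)
  have Z0: "Z a x = 0" if "x \<in> U - K" for a x
    using pd_eq_zero_outside[OF U cK supp that] supp[OF that] by (simp add: Z_def)
  have sR: "smooth_on ?R U"
    using U s by (intro smooth_on_mult smooth_on_op2 smooth_on_add smooth_on_diff smooth_on_divergence
      smooth_on_tensor_divergence smooth_on_scaleR smooth_on_const)
  have iR: "?R absolutely_integrable_on U"
    by (rule absolutely_integrable_compact_support[OF K smooth_on_continuous[OF sR]]) (simp add: supp)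
  have iZ: "(\<lambda>x. pd a (Z a) x) absolutely_integrable_on U" for a
    by (rule absolutely_integrable_compact_support[OF K smooth_on_continuous[OF smooth_on_pd[OF sZ]]])
      (rule pd_eq_zero_outside[OF U cK Z0])
  have iR': "?R integrable_on U" and iZ': "\<And>a. pd a (Z a) integrable_on U"
    using iR iZ by (auto simp: absolutely_integrable_on_def)
  have "integral U (\<lambda>x. op2 P V W f x * g x) = integral U (\<lambda>x. ?R x + (\<Sum>a\<in>UNIV. pd a (Z a) x))"
  proof (rule integral_cong)
    fix x assume "x \<in> U"
    show "op2 P V W f x * g x = ?R x + (\<Sum>a\<in>UNIV. pd a (Z a) x)"
      using op2_lagrange_identity[OF U \<open>x \<in> U\<close> s(1,2,4,5) sym, of W] unfolding Z_def[abs_def] by linarith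
  qed
  also have "\<dots> = integral U ?R + (\<Sum>a\<in>UNIV. integral U (pd a (Z a)))"
    using iR' iZ' by (simp add: integral_add integrable_sum integral_sum)
  also have "(\<Sum>a\<in>UNIV. integral U (pd a (Z a))) = 0"
    using integral_pd_zero[OF U K sZ Z0] by simp
  finally show ?thesis by simp
qed

subsection \<open>Densities on a compact oriented manifold\<close>

locale compact_oriented =
  fixes X :: "'m topology" and A :: "('m, 'n::finite) chart set"
  assumes manifold: "compact_oriented_manifold X A"
begin

lemma
  assumes "c \<in> A"
  shows chart: "is_chart X c" and chart_inj: "inj_on (snd c) (fst c)"
    and chart_open: "openin X (fst c)" and coord_range_open: "open (coord_range c)"
    and chart_homeo: "homeomorphic_map (subtopology X (fst c)) (top_of_set (coord_range c)) (snd c)"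
proof -
  show "is_chart X c" using assms manifold by (auto simp: compact_oriented_manifold_def oriented_atlas_def)
  then show "openin X (fst c)" "open (coord_range c)"
    and h: "homeomorphic_map (subtopology X (fst c)) (top_of_set (coord_range c)) (snd c)"
    by (auto simp: is_chart_def)
  have "topspace (subtopology X (fst c)) = fst c"
    using openin_subset[OF \<open>openin X (fst c)\<close>] by auto
  then show "inj_on (snd c) (fst c)"
    using h by (metis homeomorphic_imp_injective_map)
qed

lemma atlas_covers: "(\<Union>c\<in>A. fst c) = topspace X"
  using manifold by (auto simp: compact_oriented_manifold_def oriented_atlas_def)

lemma chart_image_open:
  assumes "c \<in> A" "openin X N" shows "open (snd c ` (fst c \<inter> N))"
proof -
  have "openin (subtopology X (fst c)) (fst c \<inter> N)"
    using assms(2) by (metis Int_commute openin_subtopology_Int)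
  then have "openin (top_of_set (coord_range c)) (snd c ` (fst c \<inter> N))"
    using chart_homeo[OF assms(1)] homeomorphic_imp_open_map open_map_def by blast
  then show ?thesis
    using coord_range_open[OF assms(1)] openin_open_trans by blast
qed

lemma overlap_open: "c \<in> A \<Longrightarrow> c' \<in> A \<Longrightarrow> open (overlap c c')"
  unfolding overlap_def by (intro chart_image_open chart_open)

lemma overlap_subset: "overlap c c' \<subseteq> coord_range c"
  by (auto simp: overlap_def coord_range_def)

lemma overlap_self: "overlap c c = coord_range c"
  by (simp add: overlap_def coord_range_def)

lemma transition_snd:
  assumes "c \<in> A" "p \<in> fst c" shows "transition c c' (snd c p) = snd c' p"
  using assms chart_inj[OF assms(1)] by (simp add: transition_def)

lemma overlapI: "p \<in> fst c \<Longrightarrow> p \<in> fst c' \<Longrightarrow> snd c p \<in> overlap c c'"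
  by (auto simp: overlap_def)

lemma snd_in_overlap_iff:
  assumes "c \<in> A" "p \<in> fst c" shows "snd c p \<in> overlap c c' \<longleftrightarrow> p \<in> fst c'"
  using assms chart_inj[OF assms(1)] by (auto simp: overlap_def dest: inj_onD)

lemma transition_mem:
  assumes "c \<in> A" "x \<in> overlap c c'" shows "transition c c' x \<in> overlap c' c"
  using assms by (auto simp: overlap_def transition_snd)

lemma transition_inverse:
  assumes "c \<in> A" "c' \<in> A" "x \<in> overlap c c'" shows "transition c' c (transition c c' x) = x"
  using assms by (auto simp: overlap_def transition_snd)

lemma transition_self: "c \<in> A \<Longrightarrow> x \<in> coord_range c \<Longrightarrow> transition c c x = x"
  by (auto simp: coord_range_def transition_snd)

lemma transition_trans:
  assumes "c1 \<in> A" "c2 \<in> A" "x \<in> overlap c1 c2"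
  shows "transition c1 c2 x \<in> overlap c2 c3 \<longleftrightarrow> x \<in> overlap c1 c3"
    and "x \<in> overlap c1 c3 \<Longrightarrow> transition c2 c3 (transition c1 c2 x) = transition c1 c3 x"
  using assms by (auto simp: overlap_def[of _ c2] transition_snd snd_in_overlap_iff)

lemma transition_smooth: "c \<in> A \<Longrightarrow> c' \<in> A \<Longrightarrow> smooth_on (transition c c') (overlap c c')"
  and jac_pos: "c \<in> A \<Longrightarrow> c' \<in> A \<Longrightarrow> x \<in> overlap c c' \<Longrightarrow> 0 < det (jac c c' x)"
  using manifold by (auto simp: compact_oriented_manifold_def oriented_atlas_def)

lemma jac_smooth: "c \<in> A \<Longrightarrow> c' \<in> A \<Longrightarrow> smooth_on (jac c c') (overlap c c')"
  unfolding jac_def[abs_def] using overlap_open transition_smooth by (rule smooth_on_jacobian)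

lemma det_jac_smooth: "c \<in> A \<Longrightarrow> c' \<in> A \<Longrightarrow> smooth_on (\<lambda>x. det (jac c c' x)) (overlap c c')"
  using overlap_open jac_smooth by (rule smooth_on_det)

lemma det_jac_self: "c \<in> A \<Longrightarrow> x \<in> coord_range c \<Longrightarrow> det (jac c c x) = 1"
proof -
  assume c: "c \<in> A" "x \<in> coord_range c"
  have "frechet_derivative (transition c c) (at x) = frechet_derivative (\<lambda>y. y) (at x)"
    by (rule frechet_derivative_cong[OF coord_range_open[OF c(1)] c(2)]) (rule transition_self[OF c(1)])
  then have "jac c c x = mat 1"
    by (simp add: jac_def jacobian_def matrix_id_mat_1[unfolded id_def])
  then show ?thesis by simp
qed

text \<open>The chain rule makes the Jacobian determinants a multiplicative cocycle; this is what
  makes transformation by its powers consistent over three charts.\<close>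

lemma det_jac_trans:
  assumes c: "c1 \<in> A" "c2 \<in> A" "c3 \<in> A" and x: "x \<in> overlap c1 c2" "x \<in> overlap c1 c3"
  shows "det (jac c1 c3 x) = det (jac c2 c3 (transition c1 c2 x)) * det (jac c1 c2 x)"
proof -
  have y: "transition c1 c2 x \<in> overlap c2 c3" using c x by (simp add: transition_trans(1))
  have d12: "transition c1 c2 differentiable (at x)"
    using smooth_on_differentiable[OF transition_smooth] c x by blast
  have d23: "transition c2 c3 differentiable (at (transition c1 c2 x))"
    using smooth_on_differentiable[OF transition_smooth] c y by blast
  have "frechet_derivative (transition c1 c3) (at x) =
      frechet_derivative (transition c2 c3 \<circ> transition c1 c2) (at x)"
    by (rule frechet_derivative_cong[of "overlap c1 c2 \<inter> overlap c1 c3"])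
      (use c x in \<open>auto simp: overlap_open open_Int transition_trans(2)\<close>)
  also have "\<dots> = frechet_derivative (transition c2 c3) (at (transition c1 c2 x)) \<circ>
      frechet_derivative (transition c1 c2) (at x)"
    by (rule frechet_derivative_compose[OF d12 d23])
  finally have "jac c1 c3 x = jac c2 c3 (transition c1 c2 x) ** jac c1 c2 x"
    unfolding jac_def jacobian_def
    by (simp add: matrix_compose linear_frechet_derivative d12 d23)
  then show ?thesis by (simp add: det_mul)
qed

section \<open>Elementary algebra of densities\<close>

lemma densities_outside: "s \<in> densities A w \<Longrightarrow> c \<notin> A \<or> x \<notin> coord_range c \<Longrightarrow> s c x = 0"
  unfolding densities_def by blast

lemma densities_smooth: "s \<in> densities A w \<Longrightarrow> c \<in> A \<Longrightarrow> smooth_on (s c) (coord_range c)"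
  unfolding densities_def by blast

lemma densities_transform:
  assumes "s \<in> densities A w" "c \<in> A" "c' \<in> A" "x \<in> overlap c c'"
  shows "s c x = s c' (transition c c' x) * det (jac c c' x) powr w"
  using assms jac_pos[OF assms(2-4)] by (simp add: densities_def)

lemma densitiesI:
  assumes "\<And>c x. c \<notin> A \<or> x \<notin> coord_range c \<Longrightarrow> s c x = 0"
    and "\<And>c. c \<in> A \<Longrightarrow> smooth_on (s c) (coord_range c)"
    and "\<And>c c' x. c \<in> A \<Longrightarrow> c' \<in> A \<Longrightarrow> x \<in> overlap c c' \<Longrightarrow>
      s c x = s c' (transition c c' x) * det (jac c c' x) powr w"
  shows "s \<in> densities A w"
  unfolding densities_def
proof (intro CollectI conjI ballI allI impI)
  show "s c' x = s c (transition c' c x) * \<bar>det (jac c' c x)\<bar> powr w"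
    if "c \<in> A" "c' \<in> A" "x \<in> overlap c' c" for c c' x
    using assms(3)[OF that(2,1,3)] jac_pos[OF that(2,1,3)] by simp
qed (use assms in blast)+

lemma densities_eqI:
  assumes "s \<in> densities A w" "t \<in> densities A v"
    and "\<And>c x. c \<in> A \<Longrightarrow> x \<in> coord_range c \<Longrightarrow> s c x = t c x"
  shows "s = t"
  using assms densities_outside by (metis ext)

lemma densities_zero: "(\<lambda>c x. 0) \<in> densities A w"
  by (rule densitiesI) (auto intro: smooth_on_const)

lemma densities_add:
  assumes "s \<in> densities A w" "t \<in> densities A w" shows "(\<lambda>c x. s c x + t c x) \<in> densities A w"
proof (rule densitiesI)
  show "s c x + t c x = (s c' (transition c c' x) + t c' (transition c c' x)) * det (jac c c' x) powr w"
    if "c \<in> A" "c' \<in> A" "x \<in> overlap c c'" for c c' x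
    using densities_transform[OF assms(1) that] densities_transform[OF assms(2) that]
    by (simp add: distrib_right)
  show "s c x + t c x = 0" if "c \<notin> A \<or> x \<notin> coord_range c" for c x
    using densities_outside[OF assms(1) that] densities_outside[OF assms(2) that] by simp
  show "smooth_on (\<lambda>x. s c x + t c x) (coord_range c)" if "c \<in> A" for c
    using that by (intro smooth_on_add coord_range_open densities_smooth[OF assms(1)] densities_smooth[OF assms(2)])
qed

lemma densities_diff:
  assumes "s \<in> densities A w" "t \<in> densities A w" shows "(\<lambda>c x. s c x - t c x) \<in> densities A w"
proof (rule densitiesI)
  show "s c x - t c x = (s c' (transition c c' x) - t c' (transition c c' x)) * det (jac c c' x) powr w"
    if "c \<in> A" "c' \<in> A" "x \<in> overlap c c'" for c c' x
    using densities_transform[OF assms(1) that] densities_transform[OF assms(2) that]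
    by (simp add: left_diff_distrib)
  show "s c x - t c x = 0" if "c \<notin> A \<or> x \<notin> coord_range c" for c x
    using densities_outside[OF assms(1) that] densities_outside[OF assms(2) that] by simp
  show "smooth_on (\<lambda>x. s c x - t c x) (coord_range c)" if "c \<in> A" for c
    using that by (intro smooth_on_diff coord_range_open densities_smooth[OF assms(1)] densities_smooth[OF assms(2)])
qed

lemma densities_mult:
  assumes "s \<in> densities A w" "t \<in> densities A v" shows "(\<lambda>c x. s c x * t c x) \<in> densities A (w + v)"
proof (rule densitiesI)
  show "s c x * t c x = s c' (transition c c' x) * t c' (transition c c' x) * det (jac c c' x) powr (w + v)"
    if "c \<in> A" "c' \<in> A" "x \<in> overlap c c'" for c c' x
    using densities_transform[OF assms(1) that] densities_transform[OF assms(2) that]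
    by (simp add: powr_add)
  show "s c x * t c x = 0" if "c \<notin> A \<or> x \<notin> coord_range c" for c x
    using densities_outside[OF assms(1) that] densities_outside[OF assms(2) that] by simp
  show "smooth_on (\<lambda>x. s c x * t c x) (coord_range c)" if "c \<in> A" for c
    using that by (intro smooth_on_mult coord_range_open densities_smooth[OF assms(1)] densities_smooth[OF assms(2)])
qed

lemma unit_density: "unit_density A \<in> densities A 0"
proof (rule densitiesI)
  show "smooth_on (unit_density A c) (coord_range c)" if "c \<in> A" for c
    by (rule smooth_on_cong[OF coord_range_open[OF that], of "\<lambda>_. 1"])
      (auto simp: unit_density_def that intro: smooth_on_const)
  show "unit_density A c x = unit_density A c' (transition c c' x) * det (jac c c' x) powr 0"
    if "c \<in> A" "c' \<in> A" "x \<in> overlap c c'" for c c' x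
    using that jac_pos[OF that] transition_mem[OF that(1,3)] overlap_subset[of c c'] overlap_subset[of c' c]
    by (auto simp: unit_density_def)
qed (auto simp: unit_density_def)

text \<open>In a chart other than \<open>c\<close>, vanishing is demanded only off the overlap with
  \<open>c\<close>. On the overlap it follows, outside the image of \<open>K\<close>, from the
  transformation law.\<close>

definition supported_in :: "('m, 'n) chart \<Rightarrow> (real ^ 'n) set \<Rightarrow> ('m, 'n) density \<Rightarrow> bool" where
  "supported_in c K s \<longleftrightarrow> compact K \<and> K \<subseteq> coord_range c \<and> (\<forall>x\<in>coord_range c - K. s c x = 0) \<and>
     (\<forall>c'\<in>A. \<forall>x\<in>coord_range c' - overlap c' c. s c' x = 0)"

lemma supported_in_mult:
  "supported_in c K s \<Longrightarrow> supported_in c K (\<lambda>c x. s c x * t c x)"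
  "supported_in c K s \<Longrightarrow> supported_in c K (\<lambda>c x. t c x * s c x)"
  by (auto simp: supported_in_def)

text \<open>A function given in the chart \<open>c0\<close> is transported to all other charts by
  the transformation law of weight \<open>w\<close> and continued by 0.\<close>

definition extension :: "('m, 'n) chart \<Rightarrow> real \<Rightarrow> (real ^ 'n \<Rightarrow> real) \<Rightarrow> ('m, 'n) density" where
  "extension c0 w f = (\<lambda>c x. if c \<in> A \<and> x \<in> overlap c c0
     then f (transition c c0 x) * det (jac c c0 x) powr w else 0)"

text \<open>The set is the image of a compact set under the inverse chart, and compact sets are
  closed in a Hausdorff space. Its complement is thus a neighbourhood of the points outside the
  chart on which a density can be continued by 0.\<close>

lemma closedin_chart_preimage:
  assumes "c \<in> A" "compact K" "K \<subseteq> coord_range c"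
  shows "closedin X {p \<in> fst c. snd c p \<in> K}"
proof -
  obtain g where g: "homeomorphic_maps (subtopology X (fst c)) (top_of_set (coord_range c)) (snd c) g"
    using chart_homeo[OF assms(1)] homeomorphic_map_maps by blast
  have ts: "topspace (subtopology X (fst c)) = fst c"
    using openin_subset[OF chart_open[OF assms(1)]] by auto
  have cg: "continuous_map (top_of_set (coord_range c)) (subtopology X (fst c)) g"
    and gs: "\<And>p. p \<in> fst c \<Longrightarrow> g (snd c p) = p" "\<And>x. x \<in> coord_range c \<Longrightarrow> snd c (g x) = x"
    using g ts by (auto simp: homeomorphic_maps_def)
  have "compactin (top_of_set (coord_range c)) K"
    using assms(2,3) by (simp add: compactin_subtopology)
  then have "compactin (subtopology X (fst c)) (g ` K)"
    using cg by (rule image_compactin)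
  then have "compactin X (g ` K)" by (simp add: compactin_subtopology)
  moreover have "g ` K = {p \<in> fst c. snd c p \<in> K}"
  proof -
    have "g x \<in> fst c" if "x \<in> coord_range c" for x
      using cg that ts by (auto simp: continuous_map_def Pi_iff)
    then show ?thesis using assms(3) gs by (force simp: subset_iff)
  qed
  ultimately show ?thesis
    using manifold compactin_imp_closedin by (auto simp: compact_oriented_manifold_def)
qed

lemma extension:
  assumes c0: "c0 \<in> A" and f: "smooth_on f (coord_range c0)" and K: "compact K" "K \<subseteq> coord_range c0"
    and supp: "\<And>x. x \<in> coord_range c0 - K \<Longrightarrow> f x = 0"
  shows "extension c0 w f \<in> densities A w" and "supported_in c0 K (extension c0 w f)"
    and "\<And>x. x \<in> coord_range c0 \<Longrightarrow> extension c0 w f c0 x = f x"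
proof -
  show eq: "\<And>x. x \<in> coord_range c0 \<Longrightarrow> extension c0 w f c0 x = f x"
    using c0 by (simp add: extension_def overlap_self transition_self det_jac_self)
  then show "supported_in c0 K (extension c0 w f)"
    using K supp by (auto simp: supported_in_def extension_def)
  show "extension c0 w f \<in> densities A w"
  proof (rule densitiesI)
    show "extension c0 w f c x = 0" if "c \<notin> A \<or> x \<notin> coord_range c" for c x
      using that overlap_subset[of c c0] by (auto simp: extension_def)
  next
    fix c assume c: "c \<in> A"
    \<comment> \<open>The coordinate range of \<open>c\<close> is covered by the overlap with
      \<open>c0\<close>, where the transformation formula is smooth, and by the open image
      \<open>?V\<close> of the complement of \<open>?C\<close>, where the density is 0.\<close>
    let ?C = "{p \<in> fst c0. snd c0 p \<in> K}"
    let ?V = "snd c ` (fst c \<inter> (topspace X - ?C))"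
    have "open ?V"
      using closedin_chart_preimage[OF c0 K] c by (intro chart_image_open) auto
    have *: "smooth_on (extension c0 w f c) (overlap c c0)"
    proof (rule smooth_on_cong[OF overlap_open[OF c c0]])
      show "smooth_on (\<lambda>x. f (transition c c0 x) * det (jac c c0 x) powr w) (overlap c c0)"
        using c c0 transition_mem[OF c, of _ c0] overlap_subset[of c0 c]
        by (intro smooth_on_mult smooth_on_powr smooth_on_compose[OF _ f] overlap_open transition_smooth
          det_jac_smooth jac_pos) auto
    qed (simp add: extension_def c)
    have z: "extension c0 w f c x = 0" if x: "x \<in> ?V" for x
    proof (cases "x \<in> overlap c c0")
      case True
      obtain p where p: "p \<in> fst c" "p \<notin> ?C" "x = snd c p" using x by auto
      then have "p \<in> fst c0" using True snd_in_overlap_iff[OF c] by blast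
      then have "f (transition c c0 x) = 0"
        using p c supp by (auto simp: transition_snd coord_range_def)
      then show ?thesis by (simp add: extension_def)
    qed (simp add: extension_def)
    have "smooth_on (extension c0 w f c) ?V"
      by (rule smooth_on_cong[OF \<open>open ?V\<close>, of "\<lambda>_. 0"]) (auto simp: z intro: smooth_on_const)
    then have "smooth_on (extension c0 w f c) (overlap c c0 \<union> ?V)"
      using * \<open>open ?V\<close> overlap_open[OF c c0] by (intro smooth_on_Un)
    moreover have "overlap c c0 \<union> ?V = coord_range c"
      using openin_subset[OF chart_open[OF c]] by (auto simp: overlap_def coord_range_def)
    ultimately show "smooth_on (extension c0 w f c) (coord_range c)" by simp
  next
    fix c c' x assume c: "c \<in> A" "c' \<in> A" and x: "x \<in> overlap c c'"
    have iff: "transition c c' x \<in> overlap c' c0 \<longleftrightarrow> x \<in> overlap c c0"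
      using transition_trans(1)[OF c x] .
    show "extension c0 w f c x = extension c0 w f c' (transition c c' x) * det (jac c c' x) powr w"
    proof (cases "x \<in> overlap c c0")
      case True
      then have "0 < det (jac c' c0 (transition c c' x))" "0 < det (jac c c' x)"
        using jac_pos c c0 x iff by auto
      then show ?thesis
        using True iff c transition_trans(2)[OF c x] det_jac_trans[OF c c0 x]
        by (simp add: extension_def powr_mult)
    qed (simp add: extension_def iff)
  qed
qed

text \<open>A plateau function times \<open>f\<close>, extended by zero, keeps the germ of
  \<open>f\<close> at \<open>x\<close>. Identities between differential operators on densities can
  thus be tested on arbitrary smooth functions, at any weight.\<close>

lemma density_germ:
  assumes c: "c \<in> A" and x: "x \<in> coord_range c" and f: "smooth_on f UNIV"
  obtains s N where "s \<in> densities A w" "open N" "x \<in> N" "N \<subseteq> coord_range c" "\<And>y. y \<in> N \<Longrightarrow> s c y = f y"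
proof -
  obtain r where r: "r > 0" "cball x r \<subseteq> coord_range c"
    using coord_range_open[OF c] x open_contains_cball by blast
  obtain \<phi> :: "real ^ 'n \<Rightarrow> real" where \<phi>: "smooth_on \<phi> UNIV"
    "\<And>y. y \<in> ball x (r/2) \<Longrightarrow> \<phi> y = 1" "\<And>y. y \<notin> ball x r \<Longrightarrow> \<phi> y = 0"
    using plateau_exists[OF r(1)] by metis
  have "smooth_on (\<lambda>y. \<phi> y * f y) (coord_range c)"
    using \<phi>(1) f coord_range_open[OF c] by (intro smooth_on_mult) (auto intro: smooth_on_subset)
  note ext = extension[OF c this compact_cball r(2), where w = w]
  show thesis
  proof (rule that[of "extension c w (\<lambda>y. \<phi> y * f y)" "ball x (r/2)"])
    show "extension c w (\<lambda>y. \<phi> y * f y) \<in> densities A w" using ext(1) \<phi>(3) by auto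
    show sub: "ball x (r/2) \<subseteq> coord_range c" using r by (auto simp: subset_iff)
    show "extension c w (\<lambda>y. \<phi> y * f y) c y = f y" if "y \<in> ball x (r/2)" for y
      using ext(3)[of y] that sub \<phi>(2)[OF that] \<phi>(3) by auto
  qed (use r in auto)
qed

text \<open>Weight 0 matters: the coefficient does not change between charts, so the value 1 on
  \<open>N\<close> holds in every chart at once.\<close>

lemma bump_density:
  assumes "p \<in> topspace X"
  obtains \<phi> c K N where "\<phi> \<in> densities A 0" "c \<in> A" "supported_in c K \<phi>" "openin X N" "p \<in> N"
    "\<And>q c'. q \<in> N \<Longrightarrow> c' \<in> A \<Longrightarrow> q \<in> fst c' \<Longrightarrow> \<phi> c' (snd c' q) = 1"
proof -
  obtain c where c: "c \<in> A" "p \<in> fst c" using assms atlas_covers by blast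
  define x where "x = snd c p"
  have x: "x \<in> coord_range c" using c by (simp add: x_def coord_range_def)
  obtain r where r: "r > 0" "cball x r \<subseteq> coord_range c"
    using coord_range_open[OF c(1)] x open_contains_cball by blast
  obtain \<psi> :: "real ^ 'n \<Rightarrow> real" where \<psi>: "smooth_on \<psi> UNIV"
    "\<And>y. y \<in> ball x (r/2) \<Longrightarrow> \<psi> y = 1" "\<And>y. y \<notin> ball x r \<Longrightarrow> \<psi> y = 0"
    using plateau_exists[OF r(1)] by metis
  have ext: "extension c 0 \<psi> \<in> densities A 0" "supported_in c (cball x r) (extension c 0 \<psi>)"
    "\<And>y. y \<in> coord_range c \<Longrightarrow> extension c 0 \<psi> c y = \<psi> y"
    using extension[OF c(1) smooth_on_subset[OF \<psi>(1)] compact_cball r(2), where w = 0] \<psi>(3) by auto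
  define N where "N = {q \<in> topspace (subtopology X (fst c)). snd c q \<in> ball x (r/2)}"
  have "continuous_map (subtopology X (fst c)) (top_of_set (coord_range c)) (snd c)"
    using chart_homeo[OF c(1)] homeomorphic_imp_continuous_map by blast
  then have "continuous_map (subtopology X (fst c)) euclidean (snd c)"
    by (simp add: continuous_map_in_subtopology)
  then have "openin (subtopology X (fst c)) N"
    unfolding N_def by (rule openin_continuous_map_preimage) auto
  then have N: "openin X N"
    using chart_open[OF c(1)] openin_trans_full by blast
  show thesis
  proof (rule that[OF ext(1) c(1) ext(2) N])
    show "p \<in> N" using assms c r by (simp add: N_def x_def)
    fix q c' assume q: "q \<in> N" "c' \<in> A" "q \<in> fst c'"
    then have qc: "q \<in> fst c" by (simp add: N_def)
    have "extension c 0 \<psi> c' (snd c' q) = extension c 0 \<psi> c (snd c q) * det (jac c' c (snd c' q)) powr 0"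
      using densities_transform[OF ext(1) q(2) c(1) overlapI[OF q(3) qc]] transition_snd[OF q(2,3)] by simp
    also have "extension c 0 \<psi> c (snd c q) = 1"
      using q qc ext(3) \<psi>(2) by (auto simp: N_def coord_range_def)
    finally show "extension c 0 \<psi> c' (snd c' q) = 1"
      using jac_pos[OF q(2) c(1) overlapI[OF q(3) qc]] by simp
  qed
qed

text \<open>Each point has a neighbourhood on which some bump density is 1, and by compactness
  finitely many of these neighbourhoods suffice. The bumps need not add up to 1.\<close>

lemma bump_cover:
  obtains F where "finite F" "F \<subseteq> densities A 0" "\<And>\<phi>. \<phi> \<in> F \<Longrightarrow> \<exists>c\<in>A. \<exists>K. supported_in c K \<phi>"
    "\<And>c x. c \<in> A \<Longrightarrow> x \<in> coord_range c \<Longrightarrow> \<exists>\<phi>\<in>F. \<phi> c x = 1"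
proof -
  define bump where "bump N \<phi> \<longleftrightarrow> \<phi> \<in> densities A 0 \<and> (\<exists>c\<in>A. \<exists>K. supported_in c K \<phi>) \<and> openin X N \<and>
    (\<forall>q\<in>N. \<forall>c'\<in>A. q \<in> fst c' \<longrightarrow> \<phi> c' (snd c' q) = 1)" for N \<phi>
  define \<N> where "\<N> = {N. \<exists>\<phi>. bump N \<phi>}"
  have "topspace X \<subseteq> \<Union>\<N>"
  proof
    fix p assume "p \<in> topspace X"
    then obtain \<phi> c K N where "\<phi> \<in> densities A 0" "c \<in> A" "supported_in c K \<phi>" "openin X N" "p \<in> N"
      "\<And>q c'. q \<in> N \<Longrightarrow> c' \<in> A \<Longrightarrow> q \<in> fst c' \<Longrightarrow> \<phi> c' (snd c' q) = 1"
      using bump_density by metis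
    then show "p \<in> \<Union>\<N>" unfolding \<N>_def bump_def by blast
  qed
  moreover have "compactin X (topspace X)"
    using manifold by (simp add: compact_oriented_manifold_def compact_space_def)
  moreover have "\<And>N. N \<in> \<N> \<Longrightarrow> openin X N" by (auto simp: \<N>_def bump_def)
  ultimately obtain \<M> where M: "finite \<M>" "\<M> \<subseteq> \<N>" "topspace X \<subseteq> \<Union>\<M>"
    unfolding compactin_def by (metis)
  have "\<forall>N\<in>\<M>. \<exists>\<phi>. bump N \<phi>" using M(2) by (auto simp: \<N>_def)
  then obtain b where b: "\<And>N. N \<in> \<M> \<Longrightarrow> bump N (b N)" by metis
  show thesis
  proof (rule that[of "b ` \<M>"])
    fix c x assume c: "c \<in> A" "x \<in> coord_range c"
    then obtain q where q: "q \<in> fst c" "x = snd c q" by (auto simp: coord_range_def)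
    then have "q \<in> topspace X" using openin_subset[OF chart_open[OF c(1)]] by auto
    then obtain N where "N \<in> \<M>" "q \<in> N" using M(3) by auto
    then show "\<exists>\<phi>\<in>b ` \<M>. \<phi> c x = 1" using b[of N] c(1) q by (auto simp: bump_def)
  qed (use M(1) b in \<open>auto simp: bump_def\<close>)
qed

text \<open>Starting from \<open>u = 0\<close>, replacing \<open>u\<close> by \<open>u + \<phi> (s - u)\<close> for each bump \<open>\<phi>\<close> of a finite cover
  multiplies the error \<open>s - u\<close> by \<open>1 - \<phi>\<close> and so reaches \<open>s\<close>; this replaces a partition of unity.\<close>

lemma density_induct [consumes 1, case_names zero add supported]:
  assumes s: "s \<in> densities A w"
    and zero: "P (\<lambda>c x. 0)"
    and add: "\<And>s t. s \<in> densities A w \<Longrightarrow> t \<in> densities A w \<Longrightarrow> P s \<Longrightarrow> P t \<Longrightarrow> P (\<lambda>c x. s c x + t c x)"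
    and supp: "\<And>s c K. s \<in> densities A w \<Longrightarrow> c \<in> A \<Longrightarrow> supported_in c K s \<Longrightarrow> P s"
  shows "P s"
proof -
  obtain F where F: "finite F" "F \<subseteq> densities A 0" "\<And>\<phi>. \<phi> \<in> F \<Longrightarrow> \<exists>c\<in>A. \<exists>K. supported_in c K \<phi>"
    "\<And>c x. c \<in> A \<Longrightarrow> x \<in> coord_range c \<Longrightarrow> \<exists>\<phi>\<in>F. \<phi> c x = 1"
    by (rule bump_cover) (rule that; assumption)
  have "\<exists>u\<in>densities A w. P u \<and> (\<forall>c x. s c x - u c x = s c x * (\<Prod>\<phi>\<in>G. 1 - \<phi> c x))"
    if "finite G" "G \<subseteq> F" for G
    using that
  proof (induction G rule: finite_induct)
    case empty
    show ?case by (rule bexI[of _ "\<lambda>c x. 0"]) (auto simp: zero densities_zero)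
  next
    case (insert \<phi> G)
    then obtain u where u: "u \<in> densities A w" "P u"
      "\<And>c x. s c x - u c x = s c x * (\<Prod>\<phi>\<in>G. 1 - \<phi> c x)" by auto
    obtain c K where c: "c \<in> A" "supported_in c K \<phi>" using F(3) insert.prems by blast
    \<comment> \<open>The error may be spread over the whole manifold; the factor
      \<open>\<phi>\<close> confines the correction to one chart, so \<open>supp\<close> applies to
      it.\<close>
    define v where "v = (\<lambda>c x. \<phi> c x * (s c x - u c x))"
    have v: "v \<in> densities A w"
      using densities_mult[of \<phi> 0, OF _ densities_diff[OF s u(1)]] F(2) insert.prems
      by (auto simp: v_def)
    have "supported_in c K v" unfolding v_def by (rule supported_in_mult(1)[OF c(2)])
    then have "P v" by (rule supp[OF v c(1)])
    show ?case
    proof (intro bexI[of _ "\<lambda>c x. u c x + v c x"] conjI allI)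
      show "P (\<lambda>c x. u c x + v c x)" using add[OF u(1) v u(2) \<open>P v\<close>] .
      show "(\<lambda>c x. u c x + v c x) \<in> densities A w" using densities_add[OF u(1) v] .
      fix c x
      have "s c x - (u c x + v c x) = (1 - \<phi> c x) * (s c x - u c x)"
        by (simp add: v_def algebra_simps)
      then show "s c x - (u c x + v c x) = s c x * (\<Prod>\<phi>\<in>insert \<phi> G. 1 - \<phi> c x)"
        using insert.hyps by (simp add: u(3))
    qed
  qed
  then obtain u where u: "u \<in> densities A w" "P u" "\<And>c x. s c x - u c x = s c x * (\<Prod>\<phi>\<in>F. 1 - \<phi> c x)"
    using F(1) by (metis order_refl)
  have "s = u"
  proof (rule densities_eqI[OF s u(1)])
    fix c x assume "c \<in> A" "x \<in> coord_range c"
    then have "(\<Prod>\<phi>\<in>F. 1 - \<phi> c x) = 0" using F(1,4) by (simp add: prod_zero_iff)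
    then show "s c x = u c x" using u(3)[of c x] by simp
  qed
  then show ?thesis using u(2) by simp
qed

end

subsection \<open>The integral of a density\<close>

context compact_oriented
begin

abbreviation cover_list :: "('m, 'n) chart list" where
  "cover_list \<equiv> finite_cover A"

definition piece :: "nat \<Rightarrow> (real ^ 'n) set" where
  "piece i = snd (cover_list ! i) ` (fst (cover_list ! i) - (\<Union>j<i. fst (cover_list ! j)))"

text \<open>Compactness makes the choice in \<open>finite_cover\<close> meaningful; these are the
  only properties of the chosen list that are used.\<close>

lemma finite_cover: "set cover_list \<subseteq> A" "(\<Union>c\<in>set cover_list. fst c) = topspace X"
proof -
  have "compactin X (topspace X)"
    using manifold by (simp add: compact_oriented_manifold_def compact_space_def)
  moreover have "\<And>N. N \<in> fst ` A \<Longrightarrow> openin X N" using chart_open by blast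
  moreover have "topspace X \<subseteq> \<Union>(fst ` A)" using atlas_covers by simp
  ultimately obtain \<M> where M: "finite \<M>" "\<M> \<subseteq> fst ` A" "topspace X \<subseteq> \<Union>\<M>"
    unfolding compactin_def by metis
  then obtain B where B: "finite B" "B \<subseteq> A" "\<M> = fst ` B"
    by (metis finite_subset_image)
  obtain cs where cs: "set cs = B" using finite_list[OF B(1)] by blast
  have "set cs \<subseteq> A \<and> (\<Union>c\<in>set cs. fst c) = (\<Union>c\<in>A. fst c)"
    using B M(3) atlas_covers by (simp add: cs) blast
  then have "set cover_list \<subseteq> A \<and> (\<Union>c\<in>set cover_list. fst c) = (\<Union>c\<in>A. fst c)"
    unfolding finite_cover_def by (rule someI)
  then show "set cover_list \<subseteq> A" "(\<Union>c\<in>set cover_list. fst c) = topspace X"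
    using atlas_covers by simp_all
qed

lemma cover_list_nth: "i < length cover_list \<Longrightarrow> cover_list ! i \<in> A"
  using finite_cover(1) nth_mem by blast

lemma density_integral_pieces:
  "density_integral A s = (\<Sum>i<length cover_list. integral (piece i) (s (cover_list ! i)))"
  by (simp add: density_integral_def Let_def piece_def)

lemma piece_subset: "piece i \<subseteq> coord_range (cover_list ! i)"
  by (auto simp: piece_def coord_range_def)

text \<open>In coordinates, removing the earlier charts means removing open overlaps from an open
  coordinate range.\<close>

lemma piece_borel:
  assumes "i < length cover_list" shows "piece i \<in> sets borel"
proof -
  let ?c = "cover_list ! i"
  have c: "?c \<in> A" using cover_list_nth[OF assms] .
  have "piece i = coord_range ?c - (\<Union>j<i. overlap ?c (cover_list ! j))"
  proof (intro equalityI subsetI)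
    fix x assume "x \<in> piece i"
    then obtain p where p: "p \<in> fst ?c" "x = snd ?c p" "\<And>j. j < i \<Longrightarrow> p \<notin> fst (cover_list ! j)"
      unfolding piece_def by blast
    then show "x \<in> coord_range ?c - (\<Union>j<i. overlap ?c (cover_list ! j))"
      using snd_in_overlap_iff[OF c p(1)] by (auto simp: coord_range_def)
  next
    fix x assume x: "x \<in> coord_range ?c - (\<Union>j<i. overlap ?c (cover_list ! j))"
    then obtain p where p: "p \<in> fst ?c" "x = snd ?c p" unfolding coord_range_def by blast
    then have "\<And>j. j < i \<Longrightarrow> p \<notin> fst (cover_list ! j)"
      using x snd_in_overlap_iff[OF c p(1)] by blast
    then show "x \<in> piece i" using p unfolding piece_def by blast
  qed
  moreover have "open (overlap ?c (cover_list ! j))" if "j < i" for j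
    using c cover_list_nth[of j] that assms by (intro overlap_open) auto
  ultimately show ?thesis
    using coord_range_open[OF c] by auto
qed

lemma transition_inj: "c \<in> A \<Longrightarrow> c' \<in> A \<Longrightarrow> inj_on (transition c c') (overlap c c')"
  by (rule inj_on_inverseI[where g = "transition c' c"]) (rule transition_inverse)

text \<open>Carried into the chart \<open>c\<close>, the pieces become disjoint Borel sets that fill
  its coordinate range. On each of them the change of variables formula matches the transformation
  law of weight 1, so the sum is the integral in the chart \<open>c\<close>, whatever cover was
  chosen.\<close>

lemma supported_integral:
  assumes s: "s \<in> densities A 1" and c: "c \<in> A" and K: "supported_in c K s"
  shows "i < length cover_list \<Longrightarrow> s (cover_list ! i) absolutely_integrable_on piece i"
    and "density_integral A s = integral (coord_range c) (s c)"
proof -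
  have sc: "s c absolutely_integrable_on coord_range c"
    using K smooth_on_continuous[OF densities_smooth[OF s c]]
    by (intro absolutely_integrable_compact_support[of K]) (auto simp: supported_in_def)
  \<comment> \<open>The part of the \<open>i\<close>-th piece that lies in the domain of
    \<open>c\<close>, seen in the coordinates of \<open>c\<close>.\<close>
  define Q where "Q i = snd c ` (fst c \<inter> (fst (cover_list ! i) - (\<Union>j<i. fst (cover_list ! j))))" for i
  have pieces: "s (cover_list ! i) absolutely_integrable_on piece i \<and> s c absolutely_integrable_on Q i \<and>
      integral (piece i) (s (cover_list ! i)) = integral (Q i) (s c)"
    if i: "i < length cover_list" for i
  proof -
    define d where "d = cover_list ! i"
    have d: "d \<in> A" using cover_list_nth[OF i] by (simp add: d_def)
    define S where "S = piece i \<inter> overlap d c"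
    have S: "S \<in> sets borel" using piece_borel[OF i] overlap_open[OF d c] by (auto simp: S_def)
    have img: "transition d c ` S = Q i"
    proof (intro equalityI subsetI)
      fix y assume "y \<in> transition d c ` S"
      then obtain x where x: "x \<in> piece i" "x \<in> overlap d c" "y = transition d c x" by (auto simp: S_def)
      then obtain p where p: "p \<in> fst d" "x = snd d p" "\<And>j. j < i \<Longrightarrow> p \<notin> fst (cover_list ! j)"
        unfolding piece_def d_def by blast
      then have "p \<in> fst c" using x(2) snd_in_overlap_iff[OF d] by blast
      moreover have "y = snd c p" using x(3) p transition_snd[OF d] by simp
      ultimately show "y \<in> Q i" using p unfolding Q_def d_def by blast
    next
      fix y assume "y \<in> Q i"
      then obtain p where p: "p \<in> fst c" "p \<in> fst d" "\<And>j. j < i \<Longrightarrow> p \<notin> fst (cover_list ! j)" "y = snd c p"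
        unfolding Q_def d_def by blast
      then have "snd d p \<in> piece i" unfolding piece_def d_def by blast
      moreover have "snd d p \<in> overlap d c" using p by (intro overlapI)
      ultimately show "y \<in> transition d c ` S"
        using p transition_snd[OF d p(2)] unfolding S_def by (metis IntI image_eqI)
    qed
    have Qsub: "Q i \<subseteq> coord_range c" by (auto simp: Q_def coord_range_def)
    \<comment> \<open>Measurability is obtained by writing the set as a preimage under the opposite
      transition map.\<close>
    have Qb: "Q i \<in> sets borel"
    proof -
      have "Q i = (\<lambda>x. transition c d x) -` piece i \<inter> overlap c d"
      proof (intro equalityI subsetI)
        fix y assume y: "y \<in> Q i"
        then obtain x where x: "x \<in> S" "y = transition d c x" using img by blast
        then show "y \<in> (\<lambda>x. transition c d x) -` piece i \<inter> overlap c d"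
          using transition_mem[OF d] transition_inverse[OF d c] by (auto simp: S_def)
      next
        fix y assume y: "y \<in> (\<lambda>x. transition c d x) -` piece i \<inter> overlap c d"
        then have "transition c d y \<in> S" "y = transition d c (transition c d y)"
          using transition_mem[OF c] transition_inverse[OF c d] by (auto simp: S_def)
        then show "y \<in> Q i" using img by blast
      qed
      moreover have "(\<lambda>x. transition c d x) -` piece i \<inter> overlap c d \<in> sets borel"
      proof -
        \<comment> \<open>The transition map is controlled only on the overlap. Multiplying by the
          indicator gives a Borel map on the whole space with the same preimages inside the
          overlap.\<close>
        have "(\<lambda>x. indicator (overlap c d) x *\<^sub>R transition c d x) \<in> borel_measurable borel"
          using overlap_open[OF c d] smooth_on_continuous[OF transition_smooth[OF c d]]
          by (intro borel_measurable_continuous_on_indicator) auto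
        from measurable_sets[OF this piece_borel[OF i]]
        have "(\<lambda>x. indicator (overlap c d) x *\<^sub>R transition c d x) -` piece i \<inter> overlap c d \<in> sets borel"
          using overlap_open[OF c d] by auto
        moreover have "(\<lambda>x. indicator (overlap c d) x *\<^sub>R transition c d x) -` piece i \<inter> overlap c d
            = (\<lambda>x. transition c d x) -` piece i \<inter> overlap c d" by auto
        ultimately show ?thesis by simp
      qed
      ultimately show ?thesis by simp
    qed
    have scQ: "s c absolutely_integrable_on Q i"
      by (rule set_integrable_subset[OF sc _ Qsub]) (use Qb in auto)
    have der: "(transition d c has_derivative frechet_derivative (transition d c) (at x)) (at x within S)"
      if "x \<in> S" for x
    proof -
      have "transition d c differentiable (at x)"
        using smooth_on_differentiable[OF transition_smooth[OF d c]] that by (simp add: S_def)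
      then show ?thesis using frechet_derivative_works has_derivative_at_withinI by blast
    qed
    have inj: "inj_on (transition d c) S"
      by (rule inj_on_subset[OF transition_inj[OF d c]]) (simp add: S_def)
    have "s c absolutely_integrable_on transition d c ` S" using scQ by (simp only: img)
    note cov = change_of_variables[OF S der inj this, simplified, unfolded img]
    \<comment> \<open>The transformation law of weight 1 is exactly the factor in the change of
      variables formula; the absolute value disappears since the atlas is oriented.\<close>
    have tr: "\<bar>det (matrix (frechet_derivative (transition d c) (at x)))\<bar> * s c (transition d c x) = s d x"
      if "x \<in> S" for x
    proof -
      have x: "x \<in> overlap d c" using that by (simp add: S_def)
      have "matrix (frechet_derivative (transition d c) (at x)) = jac d c x"
        by (simp add: jac_def jacobian_def)
      then show ?thesis
        using densities_transform[OF s d c x] jac_pos[OF d c x] by simp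
    qed
    have a1: "s d absolutely_integrable_on S"
      using cov(1) set_integrable_cong[of lebesgue lebesgue S S, OF refl refl tr] by simp
    have a2: "integral S (s d) = integral (Q i) (s c)"
      using cov(2) integral_cong[of S _ "s d", OF tr] by simp
    \<comment> \<open>The piece exceeds \<open>S\<close> only by points outside the domain of
      \<open>c\<close>, where the density is 0.\<close>
    have eq: "(if x \<in> S then s d x else 0) = (if x \<in> piece i then s d x else 0)" for x
    proof (cases "x \<in> piece i \<and> x \<notin> overlap d c")
      case True
      then have "x \<in> coord_range d - overlap d c" using piece_subset[of i] by (auto simp: d_def)
      then have "s d x = 0" using K d unfolding supported_in_def by blast
      then show ?thesis by simp
    qed (auto simp: S_def)
    have "s d absolutely_integrable_on piece i"
      using a1 absolutely_integrable_restrict_UNIV[of S "s d"] absolutely_integrable_restrict_UNIV[of "piece i" "s d"]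
      by (simp add: eq)
    moreover have "integral (piece i) (s d) = integral S (s d)"
      using integral_restrict_UNIV[of S "s d"] integral_restrict_UNIV[of "piece i" "s d"]
      by (simp add: eq)
    ultimately show ?thesis using a2 scQ by (simp add: d_def)
  qed
  show "s (cover_list ! i) absolutely_integrable_on piece i" if "i < length cover_list"
    using pieces[OF that] by simp
  have disj: "disjoint_family_on Q {..<length cover_list}"
  proof -
    have "Q i \<inter> Q j = {}" if "i < j" for i j
    proof (rule ccontr)
      assume "Q i \<inter> Q j \<noteq> {}"
      then obtain p q where "p \<in> fst c" "q \<in> fst c" "snd c p = snd c q"
        "p \<in> fst (cover_list ! i)" "q \<notin> (\<Union>j<j. fst (cover_list ! j))" unfolding Q_def by blast
      moreover have "p = q" using calculation chart_inj[OF c] by (auto dest: inj_onD)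
      ultimately show False using that by blast
    qed
    then show ?thesis unfolding disjoint_family_on_def by (metis inf_commute linorder_neqE_nat)
  qed
  have un: "(\<Union>i<length cover_list. Q i) = coord_range c"
  proof (intro equalityI subsetI)
    fix y assume "y \<in> coord_range c"
    then obtain p where p: "p \<in> fst c" "y = snd c p" unfolding coord_range_def by blast
    then have "p \<in> topspace X" using openin_subset[OF chart_open[OF c]] by blast
    then have "\<exists>i. i < length cover_list \<and> p \<in> fst (cover_list ! i)"
      using finite_cover(2) by (metis UN_E in_set_conv_nth)
    \<comment> \<open>The least index is needed because each piece omits all earlier chart
      domains.\<close>
    then obtain i where i: "i < length cover_list" "p \<in> fst (cover_list ! i)"
      "\<And>j. j < i \<Longrightarrow> \<not> (j < length cover_list \<and> p \<in> fst (cover_list ! j))"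
      using exists_least_iff[of "\<lambda>i. i < length cover_list \<and> p \<in> fst (cover_list ! i)"] by blast
    then have "p \<notin> (\<Union>j<i. fst (cover_list ! j))" by auto
    then have "y \<in> Q i" using p i(2) unfolding Q_def by blast
    then show "y \<in> (\<Union>i<length cover_list. Q i)" using i(1) by blast
  qed (auto simp: Q_def coord_range_def)
  have "density_integral A s = (\<Sum>i<length cover_list. integral (Q i) (s c))"
    unfolding density_integral_pieces using pieces by simp
  also have "\<dots> = integral (\<Union>i<length cover_list. Q i) (s c)"
  proof -
    have "((s c) has_integral (\<Sum>i<length cover_list. integral (Q i) (s c))) (\<Union>i<length cover_list. Q i)"
    proof (rule has_integral_UN)
      show "(s c has_integral integral (Q i) (s c)) (Q i)" if "i \<in> {..<length cover_list}" for i
        using pieces[of i] that by (auto simp: absolutely_integrable_on_def)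
      show "pairwise (\<lambda>i i'. negligible (Q i \<inter> Q i')) {..<length cover_list}"
        using disj by (auto simp: pairwise_def disjoint_family_on_def)
    qed simp
    then show ?thesis by (simp add: integral_unique)
  qed
  finally show "density_integral A s = integral (coord_range c) (s c)" by (simp add: un)
qed

lemma density_integrable:
  assumes "s \<in> densities A 1"
  shows "\<forall>i<length cover_list. s (cover_list ! i) absolutely_integrable_on piece i"
  using assms
proof (induction rule: density_induct)
  case zero
  then show ?case by (simp add: set_integrable_def)
next
  case (add s t)
  then show ?case by (auto intro: set_integral_add(1))
next
  case (supported s c K)
  then show ?case using supported_integral(1) by blast
qed

text \<open>\<open>integral\<close> has a default value on non-integrable functions and is additive
  only under integrability, which \<open>density_integrable\<close> supplies on every piece.\<close>

lemma density_integral_add: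
  assumes "s \<in> densities A 1" "t \<in> densities A 1"
  shows "density_integral A (\<lambda>c x. s c x + t c x) = density_integral A s + density_integral A t"
proof -
  have "integral (piece i) (\<lambda>x. s (cover_list ! i) x + t (cover_list ! i) x) =
      integral (piece i) (s (cover_list ! i)) + integral (piece i) (t (cover_list ! i))"
    if "i < length cover_list" for i
    using that density_integrable[OF assms(1)] density_integrable[OF assms(2)]
    by (intro integral_add) (auto simp: absolutely_integrable_on_def)
  then show ?thesis by (simp add: density_integral_pieces sum.distrib)
qed

end

subsection \<open>Change of coordinates for second order operators\<close>

lemma pd_nth [simp]: "pd a (\<lambda>y :: real ^ 'n. y $ p) x = (if a = p then 1 else 0)"
  using pd_eqI[OF bounded_linear_imp_has_derivative[OF bounded_linear_vec_nth[of p]], of a x]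
  by (simp add: axis_def)

lemma smooth_on_coordinate: "smooth_on (\<lambda>y :: real ^ 'n. y $ p - c) UNIV"
  by (intro smooth_on_diff smooth_on_nth smooth_on_ident smooth_on_const) auto

lemma pd_coordinate: "pd a (\<lambda>y :: real ^ 'n. y $ p - c) = (\<lambda>_. if a = p then 1 else 0)"
proof
  fix x :: "real ^ 'n"
  have "pd a (\<lambda>y. y $ p - c) x = pd a (\<lambda>y. y $ p) x - pd a (\<lambda>_. c) x"
    by (rule pd_diff) (auto intro: differentiable_vec_nth)
  then show "pd a (\<lambda>y. y $ p - c) x = (if a = p then 1 else 0)" by simp
qed

text \<open>The coefficients are read off with polynomials centred at \<open>x\<close>: the constant
  1 gives \<open>W\<close>, the centred coordinates give \<open>V\<close>, and their products give
  the symmetrized entries of \<open>P\<close>, hence \<open>P\<close> itself.\<close>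

lemma op2_unique:
  fixes P P' :: "real ^ 'n ^ 'n"
  assumes eq: "\<And>f. smooth_on f UNIV \<Longrightarrow>
      op2 (\<lambda>_. P) (\<lambda>_. V) (\<lambda>_. W) f x = op2 (\<lambda>_. P') (\<lambda>_. V') (\<lambda>_. W') f x"
    and sym: "\<And>a b. P $ a $ b = P $ b $ a" "\<And>a b. P' $ a $ b = P' $ b $ a"
  shows "P = P'" "V = V'" "W = W'"
proof -
  show W: "W = W'"
    using eq[OF smooth_on_const[of 1]] by (simp add: op2_def)
  have "V $ p = V' $ p" for p
    using eq[OF smooth_on_coordinate[of p "x $ p"]]
    by (simp add: op2_def pd_coordinate if_distrib cong: if_cong)
  then show "V = V'" by (simp add: vec_eq_iff)
  have "P $ p $ q = P' $ p $ q" for p q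
  proof -
    \<comment> \<open>Both factors vanish at \<open>x\<close>, so their product sees only the
      second-order part of the operators.\<close>
    define u where "u = (\<lambda>y :: real ^ 'n. y $ p - x $ p)"
    define v where "v = (\<lambda>y :: real ^ 'n. y $ q - x $ q)"
    have sm: "smooth_on u UNIV" "smooth_on v UNIV"
      by (auto simp: u_def v_def smooth_on_coordinate)
    have d: "u differentiable (at y)" "v differentiable (at y)" for y
      using sm smooth_on_differentiable by blast+
    have pu: "pd a u = (\<lambda>_. if a = p then 1 else 0)" and pv: "pd a v = (\<lambda>_. if a = q then 1 else 0)" for a
      by (auto simp: u_def v_def pd_coordinate)
    have 1: "pd b (\<lambda>y. u y * v y) = (\<lambda>y. u y * (if b = q then 1 else 0) + (if b = p then 1 else 0) * v y)" for b
      by (rule ext, subst pd_mult) (auto simp: d pu pv)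
    have 2: "pd a (pd b (\<lambda>y. u y * v y)) x =
        (if a = p then 1 else 0) * (if b = q then 1 else 0) + (if b = p then 1 else 0) * (if a = q then 1 else 0)" for a b
      unfolding 1 by (subst pd_add) (auto simp: d pu pv pd_mult intro!: differentiable_mult)
    have "smooth_on (\<lambda>y. u y * v y) UNIV" using sm by (intro smooth_on_mult) auto
    from eq[OF this]
    have "(\<Sum>a\<in>UNIV. \<Sum>b\<in>UNIV. P $ a $ b * ((if a = p then 1 else 0) * (if b = q then 1 else 0) + (if b = p then 1 else 0) * (if a = q then 1 else 0)))
      = (\<Sum>a\<in>UNIV. \<Sum>b\<in>UNIV. P' $ a $ b * ((if a = p then 1 else 0) * (if b = q then 1 else 0) + (if b = p then 1 else 0) * (if a = q then 1 else 0)))"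
      unfolding op2_def 2 unfolding 1 by (simp add: u_def v_def)
    moreover have "(\<Sum>a\<in>UNIV. \<Sum>b\<in>UNIV. M $ a $ b * ((if a = p then 1 else 0) * (if b = q then 1 else 0) + (if b = p then 1 else 0) * (if a = q then 1 else 0)))
      = M $ p $ q + M $ q $ p" for M :: "real ^ 'n ^ 'n"
    proof -
      have "(\<Sum>a\<in>UNIV. \<Sum>b\<in>UNIV. M $ a $ b * ((if a = p' then 1 else 0) * (if b = q' then 1 else 0))) = M $ p' $ q'" for p' q'
      proof -
        have "(\<Sum>b\<in>UNIV. M $ a $ b * ((if a = p' then 1 else 0) * (if b = q' then 1 else 0))) = (if a = p' then M $ a $ q' else 0)" for a
          by (simp add: if_distrib cong: if_cong)
        then show ?thesis by simp
      qed
      from this[of p q] this[of q p] show ?thesis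
        by (simp add: distrib_left sum.distrib mult.commute[of "if _ = p then 1 else 0"])
    qed
    ultimately show ?thesis using sym(1)[of q p] sym(2)[of q p] by simp
  qed
  then show "P = P'" by (simp add: vec_eq_iff)
qed

section \<open>A single change of coordinates, detached from the atlas\<close>

locale transition_map =
  fixes \<phi> :: "real ^ 'n::finite \<Rightarrow> real ^ 'n" and U :: "(real ^ 'n) set"
  assumes open_U: "open U" and smooth_phi: "smooth_on \<phi> U"
    and det_pos: "\<And>x. x \<in> U \<Longrightarrow> det (jacobian \<phi> (at x)) > 0"
begin

definition j :: "'n \<Rightarrow> 'n \<Rightarrow> real ^ 'n \<Rightarrow> real" where
  "j p a = pd a (\<lambda>y. \<phi> y $ p)"

definition J :: "real ^ 'n \<Rightarrow> real" where
  "J x = det (jacobian \<phi> (at x))"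

definition l :: "real ^ 'n \<Rightarrow> real" where
  "l x = ln (det (jacobian \<phi> (at x)))"

lemma jacobian_j: "x \<in> U \<Longrightarrow> jacobian \<phi> (at x) $ p $ a = j p a x"
  unfolding j_def by (rule jacobian_nth) (rule smooth_on_differentiable[OF smooth_phi])

lemma smooth_j: "smooth_on (j p a) U"
  unfolding j_def using open_U smooth_phi by (intro smooth_on_pd smooth_on_nth)

lemma smooth_J: "smooth_on J U"
  unfolding J_def[abs_def] using open_U smooth_phi by (intro smooth_on_det smooth_on_jacobian)

lemma J_pos: "x \<in> U \<Longrightarrow> J x > 0"
  by (simp add: J_def det_pos)

lemma smooth_l: "smooth_on l U"
  using smooth_on_ln[OF open_U smooth_J J_pos] by (simp add: J_def l_def[abs_def])

lemma smooth_J_powr: "smooth_on (\<lambda>x. J x powr w) U"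
  by (rule smooth_on_powr[OF open_U smooth_J J_pos])

lemma diff_at: "smooth_on f U \<Longrightarrow> x \<in> U \<Longrightarrow> f differentiable (at x)"
  by (rule smooth_on_differentiable)

lemma pd_l: assumes "x \<in> U" shows "pd a J x = J x * pd a l x"
proof -
  have "pd a (\<lambda>x. ln (J x)) x = inverse (J x) * pd a J x"
    using J_pos[OF assms] by (intro pd_real_compose DERIV_ln diff_at[OF smooth_J assms]) auto
  then show ?thesis using J_pos[OF assms] by (simp add: l_def[abs_def] J_def[abs_def])
qed

lemma pd_J_powr:
  assumes "x \<in> U" shows "pd a (\<lambda>x. J x powr w) x = w * J x powr w * pd a l x"
proof -
  have "pd a (\<lambda>x. J x powr w) x = (w * J x powr (w - 1)) * pd a J x"
    using J_pos[OF assms]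
    by (intro pd_real_compose has_real_derivative_powr diff_at[OF smooth_J assms]) auto
  also have "J x powr (w - 1) = J x powr w / J x"
    using J_pos[OF assms] by (simp add: powr_diff)
  finally show ?thesis using J_pos[OF assms] by (simp add: pd_l[OF assms])
qed

lemma pd_pd_J_powr:
  assumes x: "x \<in> U"
  shows "pd a (pd b (\<lambda>x. J x powr w)) x = J x powr w * (w * pd a (pd b l) x + w\<^sup>2 * (pd a l x * pd b l x))"
proof -
  have "pd a (pd b (\<lambda>x. J x powr w)) x = pd a (\<lambda>x. w * (J x powr w * pd b l x)) x"
    by (rule pd_cong[OF open_U x]) (simp add: pd_J_powr)
  also have "\<dots> = w * (J x powr w * pd a (pd b l) x + w * J x powr w * pd a l x * pd b l x)"
    using diff_at[OF smooth_J_powr x, of w] diff_at[OF smooth_on_pd[OF smooth_l] x, of b]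
    by (simp add: pd_cmult pd_mult differentiable_mult pd_J_powr[OF x])
  finally show ?thesis by (simp add: algebra_simps power2_eq_square)
qed

text \<open>The operator applied to \<open>f\<close> composed with \<open>\<phi>\<close> and
  multiplied by a factor \<open>k\<close> is, as an operator on \<open>f\<close> at the image point,
  again of second order. \<open>pull2\<close> and \<open>pull1\<close> are its second-order and
  first-order coefficients, and its zeroth-order coefficient is the original operator applied to
  \<open>k\<close>. For densities of weight \<open>w\<close> the factor is the \<open>w\<close>-th
  power of the Jacobian.\<close>

definition pull2 :: "(real ^ 'n \<Rightarrow> real) \<Rightarrow> (real ^ 'n \<Rightarrow> real ^ 'n ^ 'n) \<Rightarrow> real ^ 'n \<Rightarrow> real ^ 'n ^ 'n" where
  "pull2 k P x = (\<chi> p q. (\<Sum>a\<in>UNIV. \<Sum>b\<in>UNIV. P x $ a $ b * (j p a x * j q b x)) * k x)"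

definition pull1 :: "(real ^ 'n \<Rightarrow> real) \<Rightarrow> (real ^ 'n \<Rightarrow> real ^ 'n ^ 'n) \<Rightarrow> (real ^ 'n \<Rightarrow> real ^ 'n) \<Rightarrow>
    real ^ 'n \<Rightarrow> real ^ 'n" where
  "pull1 k P V x = (\<chi> p. (\<Sum>a\<in>UNIV. \<Sum>b\<in>UNIV. P x $ a $ b *
      (pd a (j p b) x * k x + j p b x * pd a k x + j p a x * pd b k x)) + (\<Sum>a\<in>UNIV. V x $ a * j p a x) * k x)"

lemma op2_pullback:
  assumes x: "x \<in> U" and V': "open V'" "\<phi> ` U \<subseteq> V'" and f: "smooth_on f V'" and k: "smooth_on k U"
  shows "op2 P V W (\<lambda>y. f (\<phi> y) * k y) x =
    op2 (\<lambda>_. pull2 k P x) (\<lambda>_. pull1 k P V x) (\<lambda>_. op2 P V W k x) f (\<phi> x)"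
proof -
  have df: "(\<lambda>y. g (\<phi> y)) differentiable (at y)" and cf: "pd a (\<lambda>y. g (\<phi> y)) y = (\<Sum>p\<in>UNIV. pd p g (\<phi> y) * j p a y)"
    if "y \<in> U" "smooth_on g V'" for g y a
  proof -
    have "g differentiable (at (\<phi> y))" "\<phi> differentiable (at y)"
      using that V' smooth_on_differentiable smooth_phi by blast+
    then show "(\<lambda>y. g (\<phi> y)) differentiable (at y)" "pd a (\<lambda>y. g (\<phi> y)) y = (\<Sum>p\<in>UNIV. pd p g (\<phi> y) * j p a y)"
      by (auto simp: differentiable_compose_at pd_compose j_def)
  qed
  have dk: "k differentiable (at y)" "pd b k differentiable (at y)" if "y \<in> U" for y b
    using that k smooth_on_pd diff_at by blast+
  have first: "pd b (\<lambda>y. f (\<phi> y) * k y) y = (\<Sum>p\<in>UNIV. pd p f (\<phi> y) * (j p b y * k y)) + f (\<phi> y) * pd b k y"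
    if "y \<in> U" for y b
    using that by (simp add: pd_mult df[OF that f] dk cf[OF that f] sum_distrib_right mult.assoc)
  have second: "pd a (pd b (\<lambda>y. f (\<phi> y) * k y)) x =
      (\<Sum>p\<in>UNIV. \<Sum>q\<in>UNIV. pd q (pd p f) (\<phi> x) * (j q a x * j p b x * k x))
      + (\<Sum>p\<in>UNIV. pd p f (\<phi> x) * (pd a (j p b) x * k x + j p b x * pd a k x + j p a x * pd b k x))
      + f (\<phi> x) * pd a (pd b k) x" for a b
  proof -
    have dj: "j p b differentiable (at x)" for p using diff_at[OF smooth_j x] .
    have dp: "(\<lambda>y. pd p f (\<phi> y)) differentiable (at x)" for p
      by (rule df[OF x smooth_on_pd[OF f]])
    have dterm: "(\<lambda>y. pd p f (\<phi> y) * (j p b y * k y)) differentiable (at x)" for p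
      by (intro differentiable_mult dp dj dk x)
    have "pd a (pd b (\<lambda>y. f (\<phi> y) * k y)) x =
        pd a (\<lambda>y. (\<Sum>p\<in>UNIV. pd p f (\<phi> y) * (j p b y * k y)) + f (\<phi> y) * pd b k y) x"
      by (rule pd_cong[OF open_U x]) (rule first)
    also have "\<dots> = (\<Sum>p\<in>UNIV. pd a (\<lambda>y. pd p f (\<phi> y) * (j p b y * k y)) x) + pd a (\<lambda>y. f (\<phi> y) * pd b k y) x"
      by (subst pd_add)
        (auto simp: pd_sum[OF dterm] intro!: differentiable_sum_fun differentiable_mult dterm dk df f x)
    finally have 1: "pd a (pd b (\<lambda>y. f (\<phi> y) * k y)) x =
        (\<Sum>p\<in>UNIV. pd a (\<lambda>y. pd p f (\<phi> y) * (j p b y * k y)) x) + pd a (\<lambda>y. f (\<phi> y) * pd b k y) x" .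
    have 2: "pd a (\<lambda>y. f (\<phi> y) * pd b k y) x =
        f (\<phi> x) * pd a (pd b k) x + (\<Sum>p\<in>UNIV. pd p f (\<phi> x) * (j p a x * pd b k x))"
      by (simp add: pd_mult df[OF x f] dk[OF x] cf[OF x f] sum_distrib_right mult.assoc)
    have 3: "pd a (\<lambda>y. pd p f (\<phi> y) * (j p b y * k y)) x =
        (\<Sum>q\<in>UNIV. pd q (pd p f) (\<phi> x) * (j q a x * j p b x * k x))
        + pd p f (\<phi> x) * (pd a (j p b) x * k x + j p b x * pd a k x)" for p
      using dk[OF x]
      by (simp add: pd_mult dp dj differentiable_mult cf[OF x smooth_on_pd[OF f]] sum_distrib_right mult.assoc distrib_left)
    show ?thesis unfolding 1 2 3 by (simp only: sum.distrib distrib_left add_ac)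
  qed
  let ?T = "\<lambda>a b p q. P x $ a $ b * (pd q (pd p f) (\<phi> x) * (j q a x * j p b x * k x))"
  let ?L = "\<lambda>a b. P x $ a $ b * (\<Sum>p\<in>UNIV. \<Sum>q\<in>UNIV. pd q (pd p f) (\<phi> x) * (j q a x * j p b x * k x))"
  have s1: "(\<Sum>a\<in>UNIV. \<Sum>b\<in>UNIV. ?L a b)
      = (\<Sum>q\<in>UNIV. \<Sum>p\<in>UNIV. pull2 k P x $ q $ p * pd q (pd p f) (\<phi> x))"
  proof -
    have "(\<Sum>a\<in>UNIV. \<Sum>b\<in>UNIV. ?L a b)
      = (\<Sum>a\<in>UNIV. \<Sum>q\<in>UNIV. \<Sum>p\<in>UNIV. \<Sum>b\<in>UNIV. ?T a b p q)"
    proof (rule sum.cong[OF refl])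
      fix a
      have "(\<Sum>b\<in>UNIV. ?L a b)
          = (\<Sum>b\<in>UNIV. \<Sum>q\<in>UNIV. \<Sum>p\<in>UNIV. ?T a b p q)"
        unfolding sum_distrib_left by (rule sum.cong[OF refl], rule sum.swap)
      also have "\<dots> = (\<Sum>q\<in>UNIV. \<Sum>b\<in>UNIV. \<Sum>p\<in>UNIV. ?T a b p q)"
        by (rule sum.swap)
      also have "\<dots> = (\<Sum>q\<in>UNIV. \<Sum>p\<in>UNIV. \<Sum>b\<in>UNIV. ?T a b p q)"
        by (rule sum.cong[OF refl], rule sum.swap)
      finally show "(\<Sum>b\<in>UNIV. ?L a b)
          = (\<Sum>q\<in>UNIV. \<Sum>p\<in>UNIV. \<Sum>b\<in>UNIV. ?T a b p q)" .
    qed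
    also have "\<dots> = (\<Sum>q\<in>UNIV. \<Sum>a\<in>UNIV. \<Sum>p\<in>UNIV. \<Sum>b\<in>UNIV. ?T a b p q)"
      by (rule sum.swap)
    also have "\<dots> = (\<Sum>q\<in>UNIV. \<Sum>p\<in>UNIV. \<Sum>a\<in>UNIV. \<Sum>b\<in>UNIV. ?T a b p q)"
      by (rule sum.cong[OF refl], rule sum.swap)
    finally show ?thesis
      unfolding pull2_def by (rule trans) (simp add: sum_distrib_left sum_distrib_right mult_ac)
  qed
  have s2: "(\<Sum>a\<in>UNIV. \<Sum>b\<in>UNIV. P x $ a $ b * (\<Sum>p\<in>UNIV. pd p f (\<phi> x) * K p a b))
      = (\<Sum>p\<in>UNIV. (\<Sum>a\<in>UNIV. \<Sum>b\<in>UNIV. P x $ a $ b * K p a b) * pd p f (\<phi> x))" for K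
  proof -
    have "(\<Sum>a\<in>UNIV. \<Sum>b\<in>UNIV. P x $ a $ b * (\<Sum>p\<in>UNIV. pd p f (\<phi> x) * K p a b))
      = (\<Sum>a\<in>UNIV. \<Sum>p\<in>UNIV. \<Sum>b\<in>UNIV. P x $ a $ b * (pd p f (\<phi> x) * K p a b))"
      unfolding sum_distrib_left by (rule sum.cong[OF refl], rule sum.swap)
    also have "\<dots> = (\<Sum>p\<in>UNIV. \<Sum>a\<in>UNIV. \<Sum>b\<in>UNIV. P x $ a $ b * (pd p f (\<phi> x) * K p a b))"
      by (rule sum.swap)
    finally show ?thesis by (rule trans) (simp add: sum_distrib_left sum_distrib_right mult_ac)
  qed
  have s3: "(\<Sum>a\<in>UNIV. V x $ a * pd a (\<lambda>y. f (\<phi> y) * k y) x) =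
      (\<Sum>p\<in>UNIV. ((\<Sum>a\<in>UNIV. V x $ a * j p a x) * k x) * pd p f (\<phi> x)) + (\<Sum>a\<in>UNIV. V x $ a * pd a k x) * f (\<phi> x)"
  proof -
    have "(\<Sum>a\<in>UNIV. \<Sum>p\<in>UNIV. V x $ a * (pd p f (\<phi> x) * (j p a x * k x)))
      = (\<Sum>p\<in>UNIV. \<Sum>a\<in>UNIV. V x $ a * (pd p f (\<phi> x) * (j p a x * k x)))" by (rule sum.swap)
    moreover have "(\<Sum>a\<in>UNIV. V x $ a * pd a (\<lambda>y. f (\<phi> y) * k y) x) =
        (\<Sum>a\<in>UNIV. \<Sum>p\<in>UNIV. V x $ a * (pd p f (\<phi> x) * (j p a x * k x)))
        + (\<Sum>a\<in>UNIV. V x $ a * (f (\<phi> x) * pd a k x))"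
      by (simp add: first[OF x] distrib_left sum.distrib sum_distrib_left)
    ultimately show ?thesis
      by (simp only: sum_distrib_left sum_distrib_right mult_ac)
  qed
  have s4: "(\<Sum>a\<in>UNIV. \<Sum>b\<in>UNIV. P x $ a $ b * (f (\<phi> x) * pd a (pd b k) x))
      = (\<Sum>a\<in>UNIV. \<Sum>b\<in>UNIV. P x $ a $ b * pd a (pd b k) x) * f (\<phi> x)"
    by (simp add: sum_distrib_left sum_distrib_right mult_ac)
  \<comment> \<open>\<open>X\<close>, \<open>Y\<close> and \<open>Z\<close> collect the terms with
    second derivatives, with first derivatives and with the value of \<open>f\<close>. Opaque names
    let the sum be split without rewriting inside them.\<close>
  define X where "X a b = (\<Sum>p\<in>UNIV. \<Sum>q\<in>UNIV. pd q (pd p f) (\<phi> x) * (j q a x * j p b x * k x))" for a b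
  define Y where "Y a b = (\<Sum>p\<in>UNIV. pd p f (\<phi> x) *
      (pd a (j p b) x * k x + j p b x * pd a k x + j p a x * pd b k x))" for a b
  define Z where "Z a b = f (\<phi> x) * pd a (pd b k) x" for a b
  have "(\<Sum>a\<in>UNIV. \<Sum>b\<in>UNIV. P x $ a $ b * pd a (pd b (\<lambda>y. f (\<phi> y) * k y)) x) =
      (\<Sum>a\<in>UNIV. \<Sum>b\<in>UNIV. P x $ a $ b * (X a b + Y a b + Z a b))"
    by (simp only: second X_def Y_def Z_def)
  also have "\<dots> = (\<Sum>a\<in>UNIV. \<Sum>b\<in>UNIV. P x $ a $ b * X a b) + (\<Sum>a\<in>UNIV. \<Sum>b\<in>UNIV. P x $ a $ b * Y a b)
      + (\<Sum>a\<in>UNIV. \<Sum>b\<in>UNIV. P x $ a $ b * Z a b)"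
    by (simp add: distrib_left sum.distrib)
  also have "\<dots> = (\<Sum>q\<in>UNIV. \<Sum>p\<in>UNIV. pull2 k P x $ q $ p * pd q (pd p f) (\<phi> x))
     + (\<Sum>p\<in>UNIV. (\<Sum>a\<in>UNIV. \<Sum>b\<in>UNIV. P x $ a $ b *
        (pd a (j p b) x * k x + j p b x * pd a k x + j p a x * pd b k x)) * pd p f (\<phi> x))
     + (\<Sum>a\<in>UNIV. \<Sum>b\<in>UNIV. P x $ a $ b * pd a (pd b k) x) * f (\<phi> x)"
    unfolding X_def Y_def Z_def s1 s2 s4 ..
  finally have "op2 P V W (\<lambda>y. f (\<phi> y) * k y) x =
     (\<Sum>q\<in>UNIV. \<Sum>p\<in>UNIV. pull2 k P x $ q $ p * pd q (pd p f) (\<phi> x))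
     + (\<Sum>p\<in>UNIV. (\<Sum>a\<in>UNIV. \<Sum>b\<in>UNIV. P x $ a $ b *
        (pd a (j p b) x * k x + j p b x * pd a k x + j p a x * pd b k x)) * pd p f (\<phi> x))
     + (\<Sum>a\<in>UNIV. \<Sum>b\<in>UNIV. P x $ a $ b * pd a (pd b k) x) * f (\<phi> x)
     + ((\<Sum>p\<in>UNIV. ((\<Sum>a\<in>UNIV. V x $ a * j p a x) * k x) * pd p f (\<phi> x)) + (\<Sum>a\<in>UNIV. V x $ a * pd a k x) * f (\<phi> x))
     + W x * k x * f (\<phi> x)"
    unfolding op2_def s3 by simp
  also have "\<dots> = op2 (\<lambda>_. pull2 k P x) (\<lambda>_. pull1 k P V x) (\<lambda>_. op2 P V W k x) f (\<phi> x)"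
    by (simp only: op2_def pull1_def vec_lambda_beta distrib_right sum.distrib add_ac)
  finally show ?thesis .
qed

lemma pull2_sym:
  assumes "\<And>a b. P x $ a $ b = P x $ b $ a" shows "pull2 k P x $ p $ q = pull2 k P x $ q $ p"
proof -
  have "(\<Sum>a\<in>UNIV. \<Sum>b\<in>UNIV. P x $ a $ b * (j p a x * j q b x)) = (\<Sum>a\<in>UNIV. \<Sum>b\<in>UNIV. P x $ a $ b * (j q a x * j p b x))"
    by (subst sum.swap) (simp add: assms mult.commute)
  then show ?thesis by (simp add: pull2_def)
qed

end

subsection \<open>Transformation of the coefficients of a pencil\<close>

text \<open>Together with half of \<open>S\<close>, \<open>coef1\<close> and \<open>coef0\<close>
  are the coefficients of the canonical pencil at weight \<open>w\<close>.\<close>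

definition coef1 :: "real \<Rightarrow> real \<Rightarrow> (real ^ 'n::finite \<Rightarrow> real ^ 'n ^ 'n) \<Rightarrow> (real ^ 'n \<Rightarrow> real ^ 'n) \<Rightarrow>
    real ^ 'n \<Rightarrow> real ^ 'n" where
  "coef1 w \<delta> S \<gamma> x = (1 / 2) *\<^sub>R (tensor_divergence S x + (2 * w + \<delta> - 1) *\<^sub>R \<gamma> x)"

definition coef0 :: "real \<Rightarrow> real \<Rightarrow> (real ^ 'n::finite \<Rightarrow> real ^ 'n) \<Rightarrow> (real ^ 'n \<Rightarrow> real) \<Rightarrow>
    real ^ 'n \<Rightarrow> real" where
  "coef0 w \<delta> \<gamma> \<theta> x = 1 / 2 * (w * divergence \<gamma> x + w * (w + \<delta> - 1) * \<theta> x)"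

context transition_map
begin

lemma powr_inverse: "x \<in> U \<Longrightarrow> J x powr \<delta> * J x powr (- \<delta>) = 1"
  using J_pos[of x] by (simp add: powr_minus)

text \<open>Defects arise in the form on the left, while the transformation laws carry the factor
  \<open>J x powr (- \<delta>)\<close>; this converts one form into the other.\<close>

lemma powr_shift: "x \<in> U \<Longrightarrow> J x powr \<delta> * g - e = J x powr \<delta> * (g - J x powr (- \<delta>) * e)"
  using powr_inverse[of x \<delta>] by (simp add: right_diff_distrib mult.assoc[symmetric])

lemma smooth_coordinates: "smooth_on V U \<Longrightarrow> x \<in> U \<Longrightarrow> (\<lambda>y. V y $ b) differentiable (at x)"
  for V :: "real ^ 'n \<Rightarrow> real ^ 'n"
  by (rule differentiable_vec_nth) (rule diff_at)

text \<open>The factor \<open>1 - \<delta>\<close> has two sources: the pushforward contributes one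
  logarithmic derivative of the Jacobian, and differentiating the prefactor
  \<open>J powr (- \<delta>)\<close> contributes \<open>- \<delta>\<close> of them.\<close>

lemma divergence_pushforward_powr:
  assumes x: "x \<in> U" and V: "\<And>b. smooth_on (V b) U" and V': "\<And>p. (\<lambda>z. V' z $ p) differentiable (at (\<phi> x))"
    and eq: "\<And>y p. y \<in> U \<Longrightarrow> V' (\<phi> y) $ p = J y powr (- \<delta>) * (\<Sum>b\<in>UNIV. j p b y * V b y)"
  shows "J x powr \<delta> * divergence V' (\<phi> x) =
    (\<Sum>b\<in>UNIV. pd b (V b) x) + (1 - \<delta>) * (\<Sum>b\<in>UNIV. V b x * pd b l x)"
proof -
  define Y where "Y y = (\<chi> b. J y powr (- \<delta>) * V b y)" for y
  have dY: "(\<lambda>y. Y y $ b) differentiable (at x)" for b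
    unfolding Y_def using diff_at[OF smooth_on_mult[OF open_U smooth_J_powr V] x] by simp
  have "divergence V' (\<phi> x) = divergence Y x + (\<Sum>b\<in>UNIV. Y x $ b * pd b l x)"
    unfolding l_def[abs_def]
    by (rule divergence_pushforward[OF open_U x smooth_phi det_pos dY V'])
      (auto simp: eq jacobian_j Y_def sum_distrib_left mult_ac)
  also have "divergence Y x = (\<Sum>b\<in>UNIV. J x powr (- \<delta>) * pd b (V b) x + (- \<delta> * J x powr (- \<delta>) * pd b l x) * V b x)"
    unfolding divergence_def Y_def using diff_at[OF V x] diff_at[OF smooth_J_powr x]
    by (simp add: pd_mult pd_J_powr[OF x])
  finally have "divergence V' (\<phi> x) = J x powr (- \<delta>) *
      ((\<Sum>b\<in>UNIV. pd b (V b) x) + (1 - \<delta>) * (\<Sum>b\<in>UNIV. V b x * pd b l x))"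
    by (simp add: Y_def sum.distrib sum_distrib_left algebra_simps sum_subtractf)
  then show ?thesis using powr_inverse[OF x, of \<delta>] by (simp add: mult.assoc[symmetric])
qed

context
  fixes S S' :: "real ^ 'n \<Rightarrow> real ^ 'n ^ 'n" and \<gamma> \<gamma>' :: "real ^ 'n \<Rightarrow> real ^ 'n"
    and \<theta> \<theta>' :: "real ^ 'n \<Rightarrow> real" and V' :: "(real ^ 'n) set" and \<delta> :: real
  assumes V': "open V'" "\<phi> ` U \<subseteq> V'"
    and smooth: "smooth_on S U" "smooth_on \<gamma> U" "smooth_on S' V'" "smooth_on \<gamma>' V'"
    and sym: "\<And>x a b. x \<in> U \<Longrightarrow> S x $ a $ b = S x $ b $ a"
    and S_law: "\<And>x p q. x \<in> U \<Longrightarrow> S' (\<phi> x) $ p $ q = J x powr (- \<delta>) *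
      (\<Sum>a\<in>UNIV. \<Sum>b\<in>UNIV. j p a x * j q b x * S x $ a $ b)"
begin

lemma target_diff: "smooth_on f V' \<Longrightarrow> x \<in> U \<Longrightarrow> f differentiable (at (\<phi> x))"
  using V'(2) smooth_on_differentiable by blast

lemma smooth_S_nth: "smooth_on (\<lambda>y. S y $ a $ b) U"
  using open_U smooth by (intro smooth_on_nth)

text \<open>For fixed \<open>p\<close> the entries \<open>S' z $ q $ p\<close> form a vector field,
  namely the pushforward of \<open>S\<close> contracted with row \<open>p\<close> of the Jacobian
  matrix. Differentiating that row produces the non-tensorial term with second derivatives of
  \<open>\<phi>\<close>.\<close>

lemma tensor_divergence_transform:
  assumes x: "x \<in> U"
  shows "J x powr \<delta> * tensor_divergence S' (\<phi> x) $ p =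
    (\<Sum>a\<in>UNIV. \<Sum>b\<in>UNIV. S x $ a $ b * pd a (j p b) x) + (\<Sum>a\<in>UNIV. tensor_divergence S x $ a * j p a x)
    + (1 - \<delta>) * (\<Sum>a\<in>UNIV. \<Sum>b\<in>UNIV. S x $ a $ b * (j p a x * pd b l x))"
proof -
  define V where "V b y = (\<Sum>a\<in>UNIV. j p a y * S y $ b $ a)" for b y
  have sV: "smooth_on (V b) U" for b
    unfolding V_def using open_U by (intro smooth_on_sum smooth_on_mult smooth_j smooth_S_nth)
  have "tensor_divergence S' (\<phi> x) $ p = divergence (\<lambda>z. \<chi> q. S' z $ q $ p) (\<phi> x)"
    by (simp add: tensor_divergence_def divergence_def)
  then have "J x powr \<delta> * tensor_divergence S' (\<phi> x) $ p =
      (\<Sum>b\<in>UNIV. pd b (V b) x) + (1 - \<delta>) * (\<Sum>b\<in>UNIV. V b x * pd b l x)"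
    using divergence_pushforward_powr[OF x sV, of "\<lambda>z. \<chi> q. S' z $ q $ p" \<delta>]
      differentiable_vec_nth[OF differentiable_vec_nth[OF target_diff[OF smooth(3) x]]]
    by (simp add: S_law V_def sum_distrib_left mult_ac)
  also have "(\<Sum>b\<in>UNIV. pd b (V b) x) = (\<Sum>b\<in>UNIV. \<Sum>a\<in>UNIV. j p a x * pd b (\<lambda>y. S y $ b $ a) x + pd b (j p a) x * S x $ b $ a)"
    unfolding V_def using diff_at[OF smooth_j x] diff_at[OF smooth_S_nth x]
    by (simp add: pd_sum differentiable_mult pd_mult)
  also have "\<dots> = (\<Sum>b\<in>UNIV. \<Sum>a\<in>UNIV. j p a x * pd b (\<lambda>y. S y $ b $ a) x) + (\<Sum>a\<in>UNIV. \<Sum>b\<in>UNIV. S x $ a $ b * pd a (j p b) x)"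
    by (simp add: sum.distrib mult.commute)
  also have "(\<Sum>b\<in>UNIV. \<Sum>a\<in>UNIV. j p a x * pd b (\<lambda>y. S y $ b $ a) x) = (\<Sum>a\<in>UNIV. tensor_divergence S x $ a * j p a x)"
    by (subst sum.swap) (simp add: tensor_divergence_def sum_distrib_right sum_distrib_left mult.commute)
  also have "(\<Sum>b\<in>UNIV. V b x * pd b l x) = (\<Sum>a\<in>UNIV. \<Sum>b\<in>UNIV. S x $ a $ b * (j p a x * pd b l x))"
    unfolding V_def sum_distrib_right by (subst sum.swap) (simp add: sym[OF x] mult_ac)
  finally show ?thesis by simp
qed

text \<open>The second derivatives of \<open>\<phi>\<close> cancel. The contraction of
  \<open>S\<close> with the derivative of \<open>log J\<close> enters with coefficient
  \<open>(1 - \<delta>) / 2\<close> from the divergence of \<open>S'\<close> and with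
  \<open>- w\<close> from differentiating the Jacobian power; the sum
  \<open>- (2 * w + \<delta> - 1) / 2\<close> is exactly what the inhomogeneous term in the law of
  \<open>\<gamma>\<close> requires.\<close>

lemma coef1_transform:
  assumes x: "x \<in> U"
  shows "J x powr (w + \<delta>) * coef1 w \<delta> S' \<gamma>' (\<phi> x) $ p
      - pull1 (\<lambda>x. J x powr w) (\<lambda>x. (1 / 2) *\<^sub>R S x) (coef1 w \<delta> S \<gamma>) x $ p =
    1 / 2 * (2 * w + \<delta> - 1) * J x powr (w + \<delta>) * (\<gamma>' (\<phi> x) $ p - J x powr (- \<delta>) *
      (\<Sum>a\<in>UNIV. j p a x * (\<gamma> x $ a + (\<Sum>b\<in>UNIV. S x $ a $ b * pd b l x))))"
proof -
  define A1 where "A1 = (\<Sum>a\<in>UNIV. \<Sum>b\<in>UNIV. S x $ a $ b * pd a (j p b) x)"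
  define B where "B = (\<Sum>a\<in>UNIV. \<Sum>b\<in>UNIV. S x $ a $ b * (j p a x * pd b l x))"
  define C where "C = (\<Sum>a\<in>UNIV. tensor_divergence S x $ a * j p a x)"
  define D where "D = (\<Sum>a\<in>UNIV. \<gamma> x $ a * j p a x)"
  have B': "(\<Sum>a\<in>UNIV. \<Sum>b\<in>UNIV. S x $ a $ b * (j p b x * pd a l x)) = B"
    unfolding B_def by (subst sum.swap) (simp add: sym[OF x])
  have law: "(\<Sum>a\<in>UNIV. j p a x * (\<gamma> x $ a + (\<Sum>b\<in>UNIV. S x $ a $ b * pd b l x))) = D + B"
    by (simp add: D_def B_def distrib_left sum.distrib sum_distrib_left mult_ac)
  have "(\<Sum>a\<in>UNIV. \<Sum>b\<in>UNIV. (1 / 2) *\<^sub>R S x $ a $ b * (pd a (j p b) x * J x powr w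
      + j p b x * (w * J x powr w * pd a l x) + j p a x * (w * J x powr w * pd b l x)))
    = (\<Sum>a\<in>UNIV. \<Sum>b\<in>UNIV. J x powr w * (1 / 2 * (S x $ a $ b * pd a (j p b) x)
      + w / 2 * (S x $ a $ b * (j p b x * pd a l x)) + w / 2 * (S x $ a $ b * (j p a x * pd b l x))))"
    by (intro sum.cong refl) (simp add: algebra_simps)
  also have "\<dots> = J x powr w * (1 / 2 * A1 + w / 2 * B + w / 2 * B)"
    by (simp only: sum_distrib_left[symmetric] sum.distrib B' B_def[symmetric] A1_def[symmetric])
  finally have s: "(\<Sum>a\<in>UNIV. \<Sum>b\<in>UNIV. (1 / 2) *\<^sub>R S x $ a $ b * (pd a (j p b) x * J x powr w
      + j p b x * (w * J x powr w * pd a l x) + j p a x * (w * J x powr w * pd b l x)))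
    = J x powr w * (1 / 2 * A1 + w / 2 * B + w / 2 * B)" .
  have c1: "(\<Sum>a\<in>UNIV. coef1 w \<delta> S \<gamma> x $ a * j p a x) = 1 / 2 * (C + (2 * w + \<delta> - 1) * D)"
  proof -
    have "(\<Sum>a\<in>UNIV. coef1 w \<delta> S \<gamma> x $ a * j p a x) = (\<Sum>a\<in>UNIV. 1 / 2 * (tensor_divergence S x $ a * j p a x
        + (2 * w + \<delta> - 1) * (\<gamma> x $ a * j p a x)))"
      by (intro sum.cong refl) (simp add: coef1_def algebra_simps)
    then show ?thesis by (simp only: sum_distrib_left[symmetric] sum.distrib C_def D_def)
  qed
  have "pull1 (\<lambda>x. J x powr w) (\<lambda>x. (1 / 2) *\<^sub>R S x) (coef1 w \<delta> S \<gamma>) x $ p =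
      (\<Sum>a\<in>UNIV. \<Sum>b\<in>UNIV. (1 / 2) *\<^sub>R S x $ a $ b * (pd a (j p b) x * J x powr w
      + j p b x * (w * J x powr w * pd a l x) + j p a x * (w * J x powr w * pd b l x)))
      + (\<Sum>a\<in>UNIV. coef1 w \<delta> S \<gamma> x $ a * j p a x) * J x powr w"
    by (simp add: pull1_def pd_J_powr[OF x])
  then have pull: "pull1 (\<lambda>x. J x powr w) (\<lambda>x. (1 / 2) *\<^sub>R S x) (coef1 w \<delta> S \<gamma>) x $ p =
      J x powr w * (1 / 2 * A1 + w * B + 1 / 2 * C + 1 / 2 * (2 * w + \<delta> - 1) * D)"
    unfolding s c1 by (simp add: algebra_simps)
  have c1': "coef1 w \<delta> S' \<gamma>' (\<phi> x) $ p = 1 / 2 * (tensor_divergence S' (\<phi> x) $ p + (2 * w + \<delta> - 1) * \<gamma>' (\<phi> x) $ p)"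
    by (simp add: coef1_def)
  have "J x powr (w + \<delta>) * coef1 w \<delta> S' \<gamma>' (\<phi> x) $ p = J x powr w * (1 / 2 *
      (J x powr \<delta> * tensor_divergence S' (\<phi> x) $ p + (2 * w + \<delta> - 1) * (J x powr \<delta> * \<gamma>' (\<phi> x) $ p)))"
    unfolding c1' by (simp add: powr_add algebra_simps)
  also have "\<dots> = J x powr w * (1 / 2 *
      (A1 + C + (1 - \<delta>) * B + (2 * w + \<delta> - 1) * (J x powr \<delta> * \<gamma>' (\<phi> x) $ p)))"
    unfolding tensor_divergence_transform[OF x] A1_def B_def C_def ..
  finally have "J x powr (w + \<delta>) * coef1 w \<delta> S' \<gamma>' (\<phi> x) $ p
      - pull1 (\<lambda>x. J x powr w) (\<lambda>x. (1 / 2) *\<^sub>R S x) (coef1 w \<delta> S \<gamma>) x $ p =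
    1 / 2 * (2 * w + \<delta> - 1) * J x powr w * (J x powr \<delta> * \<gamma>' (\<phi> x) $ p - (D + B))"
    unfolding pull by (simp add: field_simps)
  also have "\<dots> = 1 / 2 * (2 * w + \<delta> - 1) * J x powr (w + \<delta>) * (\<gamma>' (\<phi> x) $ p - J x powr (- \<delta>) * (D + B))"
    unfolding powr_shift[OF x] by (simp add: powr_add mult.assoc)
  finally show ?thesis unfolding law .
qed

context
  assumes \<gamma>_law: "\<And>x p. x \<in> U \<Longrightarrow> \<gamma>' (\<phi> x) $ p = J x powr (- \<delta>) *
      (\<Sum>a\<in>UNIV. j p a x * (\<gamma> x $ a + (\<Sum>b\<in>UNIV. S x $ a $ b * pd b l x)))"
begin

text \<open>The vector field pushed forward is \<open>\<gamma>\<close> corrected by \<open>S\<close>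
  applied to the differential of \<open>log J\<close>; the product rule on this correction yields
  the second derivatives of \<open>log J\<close>.\<close>

lemma divergence_transform:
  assumes x: "x \<in> U"
  shows "J x powr \<delta> * divergence \<gamma>' (\<phi> x) = divergence \<gamma> x
    + (\<Sum>a\<in>UNIV. tensor_divergence S x $ a * pd a l x) + (\<Sum>a\<in>UNIV. \<Sum>b\<in>UNIV. S x $ a $ b * pd a (pd b l) x)
    + (1 - \<delta>) * ((\<Sum>a\<in>UNIV. \<gamma> x $ a * pd a l x) + (\<Sum>a\<in>UNIV. \<Sum>b\<in>UNIV. S x $ a $ b * (pd a l x * pd b l x)))"
proof -
  define V where "V a y = \<gamma> y $ a + (\<Sum>b\<in>UNIV. S y $ a $ b * pd b l y)" for a y
  have sV: "smooth_on (V b) U" for b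
    unfolding V_def using open_U smooth
    by (intro smooth_on_add smooth_on_sum smooth_on_mult smooth_on_nth smooth_on_pd smooth_l)
  have "J x powr \<delta> * divergence \<gamma>' (\<phi> x) =
      (\<Sum>b\<in>UNIV. pd b (V b) x) + (1 - \<delta>) * (\<Sum>b\<in>UNIV. V b x * pd b l x)"
    using differentiable_vec_nth[OF target_diff[OF smooth(4) x]]
    by (intro divergence_pushforward_powr[OF x sV]) (auto simp: \<gamma>_law V_def)
  moreover have "pd a (V a) x = pd a (\<lambda>y. \<gamma> y $ a) x + (\<Sum>b\<in>UNIV. pd a (\<lambda>y. S y $ a $ b) x * pd b l x)
      + (\<Sum>b\<in>UNIV. S x $ a $ b * pd a (pd b l) x)" for a
  proof -
    have d: "(\<lambda>y. S y $ a $ b) differentiable (at x)" "pd b l differentiable (at x)" "(\<lambda>y. \<gamma> y $ a) differentiable (at x)" for b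
      using diff_at[OF smooth_S_nth x] diff_at[OF smooth_on_pd[OF smooth_l] x] smooth_coordinates[OF smooth(2) x] by auto
    have "pd a (V a) x = pd a (\<lambda>y. \<gamma> y $ a) x + (\<Sum>b\<in>UNIV. pd a (\<lambda>y. S y $ a $ b * pd b l y) x)"
      unfolding V_def
      by (subst pd_add) (auto simp: d pd_sum differentiable_mult intro!: differentiable_sum_fun)
    then show ?thesis by (simp add: pd_mult d sum.distrib add.commute)
  qed
  moreover have "(\<Sum>a\<in>UNIV. \<Sum>b\<in>UNIV. pd a (\<lambda>y. S y $ a $ b) x * pd b l x) = (\<Sum>a\<in>UNIV. tensor_divergence S x $ a * pd a l x)"
    by (subst sum.swap) (simp add: tensor_divergence_def sum_distrib_right)
  moreover have "(\<Sum>b\<in>UNIV. V b x * pd b l x) = (\<Sum>a\<in>UNIV. \<gamma> x $ a * pd a l x) + (\<Sum>a\<in>UNIV. \<Sum>b\<in>UNIV. S x $ a $ b * (pd a l x * pd b l x))"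
  proof -
    have "(\<Sum>b\<in>UNIV. V b x * pd b l x) =
        (\<Sum>a\<in>UNIV. \<gamma> x $ a * pd a l x + (\<Sum>b\<in>UNIV. S x $ a $ b * (pd a l x * pd b l x)))"
      by (intro sum.cong refl) (simp add: V_def algebra_simps sum_distrib_left)
    then show ?thesis by (simp add: sum.distrib)
  qed
  ultimately show ?thesis by (simp add: sum.distrib divergence_def)
qed

text \<open>The terms with second derivatives of \<open>log J\<close> and with the divergence of
  \<open>S\<close> cancel. What remains of \<open>A4\<close> has coefficient
  \<open>w * (1 - \<delta>) / 2 - w * (2 * w + \<delta> - 1) / 2\<close>, which is
  \<open>- w * (w + \<delta> - 1)\<close>, and \<open>A2\<close> has half of that: this is the
  origin of the factor 2 in the law of \<open>\<theta>\<close>. The law of \<open>\<gamma>\<close>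
  is needed because \<open>coef0\<close> contains its divergence.\<close>

lemma coef0_transform:
  assumes x: "x \<in> U"
  shows "J x powr (w + \<delta>) * coef0 w \<delta> \<gamma>' \<theta>' (\<phi> x)
      - op2 (\<lambda>x. (1 / 2) *\<^sub>R S x) (coef1 w \<delta> S \<gamma>) (coef0 w \<delta> \<gamma> \<theta>) (\<lambda>x. J x powr w) x =
    1 / 2 * (w * (w + \<delta> - 1)) * J x powr (w + \<delta>) * (\<theta>' (\<phi> x) - J x powr (- \<delta>) *
      (\<theta> x + 2 * (\<Sum>a\<in>UNIV. \<gamma> x $ a * pd a l x) + (\<Sum>a\<in>UNIV. \<Sum>b\<in>UNIV. pd a l x * S x $ a $ b * pd b l x)))"
proof -
  define A1 where "A1 = (\<Sum>a\<in>UNIV. \<Sum>b\<in>UNIV. S x $ a $ b * pd a (pd b l) x)"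
  define A2 where "A2 = (\<Sum>a\<in>UNIV. \<Sum>b\<in>UNIV. S x $ a $ b * (pd a l x * pd b l x))"
  define A3 where "A3 = (\<Sum>a\<in>UNIV. tensor_divergence S x $ a * pd a l x)"
  define A4 where "A4 = (\<Sum>a\<in>UNIV. \<gamma> x $ a * pd a l x)"
  have A2': "(\<Sum>a\<in>UNIV. \<Sum>b\<in>UNIV. pd a l x * S x $ a $ b * pd b l x) = A2"
    by (simp add: A2_def mult_ac)
  have "(\<Sum>a\<in>UNIV. \<Sum>b\<in>UNIV. ((1 / 2) *\<^sub>R S x) $ a $ b * pd a (pd b (\<lambda>x. J x powr w)) x) =
      (\<Sum>a\<in>UNIV. \<Sum>b\<in>UNIV. J x powr w * (w / 2 * (S x $ a $ b * pd a (pd b l) x) + w\<^sup>2 / 2 * (S x $ a $ b * (pd a l x * pd b l x))))"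
    by (intro sum.cong refl) (simp add: pd_pd_J_powr[OF x] algebra_simps)
  also have "\<dots> = J x powr w * (w / 2 * A1 + w\<^sup>2 / 2 * A2)"
    by (simp only: sum_distrib_left[symmetric] sum.distrib A1_def A2_def)
  finally have s2: "(\<Sum>a\<in>UNIV. \<Sum>b\<in>UNIV. ((1 / 2) *\<^sub>R S x) $ a $ b * pd a (pd b (\<lambda>x. J x powr w)) x) =
      J x powr w * (w / 2 * A1 + w\<^sup>2 / 2 * A2)" .
  have "(\<Sum>a\<in>UNIV. coef1 w \<delta> S \<gamma> x $ a * pd a (\<lambda>x. J x powr w) x) =
      (\<Sum>a\<in>UNIV. J x powr w * (w / 2 * (tensor_divergence S x $ a * pd a l x
        + (2 * w + \<delta> - 1) * (\<gamma> x $ a * pd a l x))))"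
    by (intro sum.cong refl) (simp add: coef1_def pd_J_powr[OF x] algebra_simps)
  also have "\<dots> = J x powr w * (w / 2 * (A3 + (2 * w + \<delta> - 1) * A4))"
    by (simp only: sum_distrib_left[symmetric] sum.distrib A3_def A4_def)
  finally have s1: "(\<Sum>a\<in>UNIV. coef1 w \<delta> S \<gamma> x $ a * pd a (\<lambda>x. J x powr w) x) =
      J x powr w * (w / 2 * (A3 + (2 * w + \<delta> - 1) * A4))" .
  have op: "op2 (\<lambda>x. (1 / 2) *\<^sub>R S x) (coef1 w \<delta> S \<gamma>) (coef0 w \<delta> \<gamma> \<theta>) (\<lambda>x. J x powr w) x =
      J x powr w * (w / 2 * A1 + w\<^sup>2 / 2 * A2 + w / 2 * (A3 + (2 * w + \<delta> - 1) * A4) + coef0 w \<delta> \<gamma> \<theta> x)"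
    unfolding op2_def s2 s1 by (simp add: algebra_simps)
  have "J x powr (w + \<delta>) * coef0 w \<delta> \<gamma>' \<theta>' (\<phi> x) = J x powr w * (1 / 2 *
      (w * (J x powr \<delta> * divergence \<gamma>' (\<phi> x)) + w * (w + \<delta> - 1) * (J x powr \<delta> * \<theta>' (\<phi> x))))"
    by (simp add: coef0_def powr_add algebra_simps)
  also have "J x powr \<delta> * divergence \<gamma>' (\<phi> x) = divergence \<gamma> x + A3 + A1 + (1 - \<delta>) * (A4 + A2)"
    unfolding divergence_transform[OF x] A1_def A2_def A3_def A4_def ..
  finally have "J x powr (w + \<delta>) * coef0 w \<delta> \<gamma>' \<theta>' (\<phi> x)
      - op2 (\<lambda>x. (1 / 2) *\<^sub>R S x) (coef1 w \<delta> S \<gamma>) (coef0 w \<delta> \<gamma> \<theta>) (\<lambda>x. J x powr w) x =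
    1 / 2 * (w * (w + \<delta> - 1)) * J x powr w * (J x powr \<delta> * \<theta>' (\<phi> x) - (\<theta> x + 2 * A4 + A2))"
    unfolding op coef0_def by (simp add: field_simps power2_eq_square)
  also have "\<dots> = 1 / 2 * (w * (w + \<delta> - 1)) * J x powr (w + \<delta>) *
      (\<theta>' (\<phi> x) - J x powr (- \<delta>) * (\<theta> x + 2 * A4 + A2))"
    unfolding powr_shift[OF x] by (simp add: powr_add mult.assoc)
  finally show ?thesis unfolding A2' A4_def .
qed

end

end

end

subsection \<open>Local operators on densities\<close>

text \<open>Partial derivatives commute, so an operator determines only the symmetric part of its
  second-order coefficients. Every comparison of coefficients is made after passing to it.\<close>

definition symmetrization :: "(real ^ 'n::finite \<Rightarrow> real ^ 'n ^ 'n) \<Rightarrow> real ^ 'n \<Rightarrow> real ^ 'n ^ 'n" where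
  "symmetrization P x = (1 / 2) *\<^sub>R (\<chi> a b. P x $ a $ b + P x $ b $ a)"

lemma symmetrization_sym: "symmetrization P x $ a $ b = symmetrization P x $ b $ a"
  by (simp add: symmetrization_def add.commute)

lemma smooth_on_symmetrization:
  assumes "open U" "smooth_on P U" shows "smooth_on (symmetrization P) U"
proof (intro smooth_on_vec assms(1))
  fix a b
  have "smooth_on (\<lambda>x. 1 / 2 * (P x $ a $ b + P x $ b $ a)) U"
    using assms by (intro smooth_on_mult smooth_on_add smooth_on_nth smooth_on_const)
  then show "smooth_on (\<lambda>x. symmetrization P x $ a $ b) U"
    by (simp add: symmetrization_def)
qed

lemma op2_symmetrization:
  assumes "open U" "smooth_on f U" "x \<in> U"
  shows "op2 (symmetrization P) V W f x = op2 P V W f x"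
proof -
  have "(\<Sum>a\<in>UNIV. \<Sum>b\<in>UNIV. P x $ b $ a * pd a (pd b f) x) = (\<Sum>a\<in>UNIV. \<Sum>b\<in>UNIV. P x $ a $ b * pd a (pd b f) x)"
    by (subst sum.swap) (simp add: pd_commute[OF assms])
  then have "(\<Sum>a\<in>UNIV. \<Sum>b\<in>UNIV. symmetrization P x $ a $ b * pd a (pd b f) x)
      = (\<Sum>a\<in>UNIV. \<Sum>b\<in>UNIV. P x $ a $ b * pd a (pd b f) x)"
    by (simp add: symmetrization_def distrib_right sum.distrib add_divide_distrib sum_divide_distrib[symmetric])
  then show ?thesis by (simp add: op2_def)
qed

lemma op2_add:
  assumes "open U" "smooth_on f U" "smooth_on g U" "x \<in> U"
  shows "op2 P V W (\<lambda>y. f y + g y) x = op2 P V W f x + op2 P V W g x"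
proof -
  have d: "f differentiable (at y)" "g differentiable (at y)" "pd b f differentiable (at y)" "pd b g differentiable (at y)"
    if "y \<in> U" for y b
    using that assms smooth_on_differentiable smooth_on_pd by blast+
  have "pd a (pd b (\<lambda>y. f y + g y)) x = pd a (\<lambda>y. pd b f y + pd b g y) x" for a b
    by (rule pd_cong[OF assms(1,4)]) (simp add: pd_add d)
  then show ?thesis
    using assms(4) by (simp add: op2_def pd_add d distrib_left sum.distrib)
qed

lemma op2_const_one: "op2 P V W (\<lambda>_. 1) x = W x"
  by (simp add: op2_def)

lemma op2_scale: "c * op2 P V W f x = op2 (\<lambda>_. c *\<^sub>R P x) (\<lambda>_. c *\<^sub>R V x) (\<lambda>_. c * W x) f x"
  by (simp add: op2_def distrib_left sum_distrib_left mult.assoc)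

abbreviation adjoint1 :: "(real ^ 'n::finite \<Rightarrow> real ^ 'n ^ 'n) \<Rightarrow> (real ^ 'n \<Rightarrow> real ^ 'n) \<Rightarrow> real ^ 'n \<Rightarrow> real ^ 'n" where
  "adjoint1 P V \<equiv> (\<lambda>x. 2 *\<^sub>R tensor_divergence P x - V x)"

abbreviation adjoint0 :: "(real ^ 'n::finite \<Rightarrow> real ^ 'n ^ 'n) \<Rightarrow> (real ^ 'n \<Rightarrow> real ^ 'n) \<Rightarrow> (real ^ 'n \<Rightarrow> real) \<Rightarrow> real ^ 'n \<Rightarrow> real" where
  "adjoint0 P V W \<equiv> (\<lambda>x. divergence (tensor_divergence P) x - divergence V x + W x)"

context compact_oriented
begin

lemma transition_map_overlap:
  assumes "c \<in> A" "c' \<in> A" shows "transition_map (transition c c') (overlap c c')"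
proof
  show "det (jacobian (transition c c') (at x)) > 0" if "x \<in> overlap c c'" for x
    using jac_pos[OF assms that] by (simp add: jac_def)
qed (use assms overlap_open transition_smooth in blast)+

lemma transition_image: "c \<in> A \<Longrightarrow> transition c c' ` overlap c c' \<subseteq> coord_range c'"
  using transition_mem overlap_subset by blast

lemma densities_chart_transform:
  assumes "s \<in> densities A w" "c \<in> A" "c' \<in> A" "x \<in> overlap c c'"
  shows "op2 P V W (s c) x = op2 P V W (\<lambda>y. s c' (transition c c' y) * det (jac c c' y) powr w) x"
  using assms by (intro op2_cong[of "overlap c c'"] overlap_open densities_transform)

lemma local_form_sym:
  assumes c: "c \<in> A" and "local_form A w T c P V W"
  shows "local_form A w T c (symmetrization P) V W"
  using assms coord_range_open[OF c] densities_smooth[OF _ c]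
  by (simp add: local_form_def smooth_on_symmetrization op2_symmetrization)

lemma local_form_unique:
  assumes c: "c \<in> A" and l: "local_form A w T c P V W" "local_form A w T c P' V' W'"
    and sym: "\<And>a b. P x $ a $ b = P x $ b $ a" "\<And>a b. P' x $ a $ b = P' x $ b $ a"
    and x: "x \<in> coord_range c"
  shows "P x = P' x" "V x = V' x" "W x = W' x"
proof -
  have "op2 (\<lambda>_. P x) (\<lambda>_. V x) (\<lambda>_. W x) f x = op2 (\<lambda>_. P' x) (\<lambda>_. V' x) (\<lambda>_. W' x) f x"
    if f: "smooth_on f UNIV" for f
  proof -
    obtain s N where s: "s \<in> densities A w" "open N" "x \<in> N" "N \<subseteq> coord_range c" "\<And>y. y \<in> N \<Longrightarrow> s c y = f y"
      using density_germ[OF c x f] by metis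
    have "op2 P V W f x = op2 P V W (s c) x" "op2 P' V' W' f x = op2 P' V' W' (s c) x"
      using s by (auto intro!: op2_cong[OF s(2,3)])
    moreover have "T s c x = op2 P V W (s c) x" "T s c x = op2 P' V' W' (s c) x"
      using l s(1) x unfolding local_form_def by blast+
    ultimately have "op2 P V W f x = op2 P' V' W' f x" by simp
    then show ?thesis by (simp add: op2_def)
  qed
  from op2_unique[OF this sym] show "P x = P' x" "V x = V' x" "W x = W' x" by auto
qed

text \<open>A density with a prescribed germ in the chart \<open>c'\<close> is inserted into
  \<open>T\<close>. The result is computed in both charts and compared by the law of weight
  \<open>w + \<delta>\<close>, which gives two operators on the same arbitrary germ;
  \<open>op2_unique\<close> then equates their coefficients.\<close>

lemma local_form_transform:
  assumes T: "T \<in> operators A \<delta> w" and c: "c \<in> A" "c' \<in> A" and x: "x \<in> overlap c c'"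
    and l: "local_form A w T c P V W" "local_form A w T c' P' V' W'"
    and sym: "\<And>a b. P x $ a $ b = P x $ b $ a"
      "\<And>a b. P' (transition c c' x) $ a $ b = P' (transition c c' x) $ b $ a"
  defines "k \<equiv> \<lambda>y. det (jac c c' y) powr w"
  shows "det (jac c c' x) powr (w + \<delta>) *\<^sub>R P' (transition c c' x) = transition_map.pull2 (transition c c') k P x"
    and "det (jac c c' x) powr (w + \<delta>) *\<^sub>R V' (transition c c' x) = transition_map.pull1 (transition c c') k P V x"
    and "det (jac c c' x) powr (w + \<delta>) * W' (transition c c' x) = op2 P V W k x"
proof -
  define \<phi> where "\<phi> = transition c c'"
  interpret t: transition_map \<phi> "overlap c c'"
    unfolding \<phi>_def using c by (rule transition_map_overlap)
  have Jk: "t.J y = det (jac c c' y)" for y by (simp add: t.J_def jac_def \<phi>_def[symmetric])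
  have k: "smooth_on k (overlap c c')" using t.smooth_J_powr[of w] by (simp add: k_def Jk)
  define m where "m = det (jac c c' x) powr (w + \<delta>)"
  have z: "\<phi> x \<in> coord_range c'" using transition_image[OF c(1), of c'] x by (auto simp: \<phi>_def)
  have "op2 (\<lambda>_. m *\<^sub>R P' (\<phi> x)) (\<lambda>_. m *\<^sub>R V' (\<phi> x)) (\<lambda>_. m * W' (\<phi> x)) f (\<phi> x) =
      op2 (\<lambda>_. t.pull2 k P x) (\<lambda>_. t.pull1 k P V x) (\<lambda>_. op2 P V W k x) f (\<phi> x)"
    if f: "smooth_on f UNIV" for f
  proof -
    obtain s N where s: "s \<in> densities A w" "open N" "\<phi> x \<in> N" "N \<subseteq> coord_range c'" "\<And>y. y \<in> N \<Longrightarrow> s c' y = f y"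
      using density_germ[OF c(2) z f] by metis
    have Ts: "T s \<in> densities A (w + \<delta>)" using T s(1) by (auto simp: operators_def)
    have "open (overlap c c' \<inter> \<phi> -` N)"
      using smooth_on_continuous[OF t.smooth_phi] t.open_U s(2) by (rule continuous_open_preimage)
    then have e: "op2 P V W (\<lambda>y. s c' (\<phi> y) * k y) x = op2 P V W (\<lambda>y. f (\<phi> y) * k y) x"
      by (rule op2_cong) (use x s in auto)
    have "op2 (\<lambda>_. t.pull2 k P x) (\<lambda>_. t.pull1 k P V x) (\<lambda>_. op2 P V W k x) f (\<phi> x) = op2 P V W (\<lambda>y. f (\<phi> y) * k y) x"
      using t.op2_pullback[OF x open_UNIV subset_UNIV f k] by simp
    also have "\<dots> = op2 P V W (s c) x"
      using densities_chart_transform[OF s(1) c x, of P V W] e by (simp add: \<phi>_def k_def)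
    also have "\<dots> = T s c x"
      using l(1) s(1) x overlap_subset[of c c'] unfolding local_form_def by auto
    also have "\<dots> = m * T s c' (\<phi> x)"
      using densities_transform[OF Ts c x] by (simp add: m_def \<phi>_def)
    also have "T s c' (\<phi> x) = op2 P' V' W' (s c') (\<phi> x)"
      using l(2) s(1) z unfolding local_form_def by auto
    also have "\<dots> = op2 P' V' W' f (\<phi> x)"
      by (rule op2_cong[OF s(2,3,5)])
    finally show ?thesis by (simp add: op2_scale)
  qed
  note op2_unique[OF this]
  moreover have "(m *\<^sub>R P' (\<phi> x)) $ a $ b = (m *\<^sub>R P' (\<phi> x)) $ b $ a" for a b
    using sym(2)[of a b] by (simp add: \<phi>_def)
  moreover have "t.pull2 k P x $ a $ b = t.pull2 k P x $ b $ a" for a b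
    by (rule t.pull2_sym) (rule sym(1))
  ultimately show "det (jac c c' x) powr (w + \<delta>) *\<^sub>R P' (transition c c' x) = transition_map.pull2 (transition c c') k P x"
    "det (jac c c' x) powr (w + \<delta>) *\<^sub>R V' (transition c c' x) = transition_map.pull1 (transition c c') k P V x"
    "det (jac c c' x) powr (w + \<delta>) * W' (transition c c' x) = op2 P V W k x"
    unfolding m_def \<phi>_def by blast+
qed

definition local_operator ::
  "real \<Rightarrow> ('m, 'n) tensor_field \<Rightarrow> ('m, 'n) vector_field \<Rightarrow> ('m, 'n) scalar_field \<Rightarrow> ('m, 'n) operator" where
  "local_operator w P V W = (\<lambda>s\<in>densities A w. \<lambda>c x. if c \<in> A \<and> x \<in> coord_range c
     then op2 (P c) (V c) (W c) (s c) x else 0)"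

text \<open>Converse to \<open>local_form_transform\<close>: coefficients obeying these three laws
  give values that transform as a density of weight \<open>w + \<delta>\<close>.\<close>

lemma local_operator:
  assumes smooth: "\<And>c. c \<in> A \<Longrightarrow> smooth_on (P c) (coord_range c)" "\<And>c. c \<in> A \<Longrightarrow> smooth_on (V c) (coord_range c)"
      "\<And>c. c \<in> A \<Longrightarrow> smooth_on (W c) (coord_range c)"
    and law: "\<And>c c' x. c \<in> A \<Longrightarrow> c' \<in> A \<Longrightarrow> x \<in> overlap c c' \<Longrightarrow>
      det (jac c c' x) powr (w + \<delta>) *\<^sub>R P c' (transition c c' x)
        = transition_map.pull2 (transition c c') (\<lambda>y. det (jac c c' y) powr w) (P c) x \<and>
      det (jac c c' x) powr (w + \<delta>) *\<^sub>R V c' (transition c c' x)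
        = transition_map.pull1 (transition c c') (\<lambda>y. det (jac c c' y) powr w) (P c) (V c) x \<and>
      det (jac c c' x) powr (w + \<delta>) * W c' (transition c c' x)
        = op2 (P c) (V c) (W c) (\<lambda>y. det (jac c c' y) powr w) x"
  shows "local_operator w P V W \<in> operators A \<delta> w"
proof -
  have "(\<lambda>c x. if c \<in> A \<and> x \<in> coord_range c then op2 (P c) (V c) (W c) (s c) x else 0) \<in> densities A (w + \<delta>)"
    if s: "s \<in> densities A w" for s
  proof (rule densitiesI)
    fix c assume c: "c \<in> A"
    show "smooth_on (\<lambda>x. if c \<in> A \<and> x \<in> coord_range c then op2 (P c) (V c) (W c) (s c) x else 0) (coord_range c)"
      by (rule smooth_on_cong[OF coord_range_open[OF c] _
          smooth_on_op2[OF coord_range_open[OF c] smooth(1-3)[OF c] densities_smooth[OF s c]]]) (simp add: c)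
  next
    fix c c' x assume c: "c \<in> A" "c' \<in> A" and x: "x \<in> overlap c c'"
    interpret t: transition_map "transition c c'" "overlap c c'"
      using c by (rule transition_map_overlap)
    let ?z = "transition c c' x" and ?k = "\<lambda>y. det (jac c c' y) powr w"
    have k: "smooth_on ?k (overlap c c')"
      using t.smooth_J_powr[of w] by (simp add: t.J_def jac_def)
    have "op2 (P c) (V c) (W c) (s c) x = op2 (P c) (V c) (W c) (\<lambda>y. s c' (transition c c' y) * ?k y) x"
      by (rule densities_chart_transform[OF s c x])
    also have "\<dots> = op2 (\<lambda>_. t.pull2 ?k (P c) x) (\<lambda>_. t.pull1 ?k (P c) (V c) x)
        (\<lambda>_. op2 (P c) (V c) (W c) ?k x) (s c') ?z"
      by (rule t.op2_pullback[OF x coord_range_open[OF c(2)] transition_image[OF c(1)] densities_smooth[OF s c(2)] k])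
    also have "\<dots> = det (jac c c' x) powr (w + \<delta>) * op2 (P c') (V c') (W c') (s c') ?z"
      using law[OF c x] by (simp add: op2_scale)
    finally show "(if c \<in> A \<and> x \<in> coord_range c then op2 (P c) (V c) (W c) (s c) x else 0) =
        (if c' \<in> A \<and> ?z \<in> coord_range c' then op2 (P c') (V c') (W c') (s c') ?z else 0) *
        det (jac c c' x) powr (w + \<delta>)"
      using c x overlap_subset[of c c'] transition_image[OF c(1), of c'] by (auto simp: mult.commute)
  qed auto
  then show ?thesis by (simp add: local_operator_def operators_def)
qed

text \<open>Locality is separated from membership in \<open>operators\<close> because it is applied
  both to the given operator and to every member of a pencil.\<close>

definition is_local :: "real \<Rightarrow> ('m, 'n) operator \<Rightarrow> bool" where
  "is_local w T \<longleftrightarrow> (\<forall>c\<in>A. \<exists>P V W. local_form A w T c P V W)"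

lemma is_localD:
  assumes "is_local w T" "c \<in> A"
  obtains P V W where "local_form A w T c P V W" "\<And>x a b. P x $ a $ b = P x $ b $ a"
proof -
  obtain P V W where "local_form A w T c P V W" using assms unfolding is_local_def by blast
  then have "local_form A w T c (symmetrization P) V W" by (rule local_form_sym[OF assms(2)])
  then show thesis by (rule that) (rule symmetrization_sym)
qed

lemma operators_mem: "T \<in> operators A \<delta> w \<Longrightarrow> s \<in> densities A w \<Longrightarrow> T s \<in> densities A (w + \<delta>)"
  by (auto simp: operators_def)

lemma operators_eqI:
  assumes "T \<in> operators A \<delta> w" "T' \<in> operators A \<delta> w"
    and "\<And>s c x. s \<in> densities A w \<Longrightarrow> c \<in> A \<Longrightarrow> x \<in> coord_range c \<Longrightarrow> T s c x = T' s c x"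
  shows "T = T'"
proof (rule extensionalityI[of _ "densities A w"])
  show "T s = T' s" if "s \<in> densities A w" for s
    by (rule densities_eqI[OF operators_mem[OF assms(1) that] operators_mem[OF assms(2) that]])
      (rule assms(3)[OF that])
qed (use assms(1,2) in \<open>auto simp: operators_def PiE_def\<close>)

lemma operator_zero:
  assumes "T \<in> operators A \<delta> w" "is_local w T" shows "T (\<lambda>c x. 0) = (\<lambda>c x. 0)"
proof (rule densities_eqI[OF operators_mem[OF assms(1) densities_zero] densities_zero[of 0]])
  fix c x assume c: "c \<in> A" "x \<in> coord_range c"
  obtain P V W where "local_form A w T c P V W" using is_localD[OF assms(2) c(1)] by metis
  then have "T (\<lambda>c x. 0) c x = op2 P V W (\<lambda>x. 0) x"
    using c densities_zero[of w] unfolding local_form_def by blast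
  then show "T (\<lambda>c x. 0) c x = 0" by (simp add: op2_def)
qed

lemma operator_add:
  assumes "T \<in> operators A \<delta> w" "is_local w T" and s: "s \<in> densities A w" "t \<in> densities A w"
  shows "T (\<lambda>c x. s c x + t c x) = (\<lambda>c x. T s c x + T t c x)"
proof (rule densities_eqI[OF operators_mem[OF assms(1) densities_add[OF s]]
      densities_add[OF operators_mem[OF assms(1) s(1)] operators_mem[OF assms(1) s(2)]]])
  fix c x assume c: "c \<in> A" "x \<in> coord_range c"
  obtain P V W where l: "local_form A w T c P V W" using is_localD[OF assms(2) c(1)] by metis
  have "T (\<lambda>c x. s c x + t c x) c x = op2 P V W (\<lambda>x. s c x + t c x) x"
    "T s c x = op2 P V W (s c) x" "T t c x = op2 P V W (t c) x"
    using l c(2) s densities_add[OF s] unfolding local_form_def by blast+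
  then show "T (\<lambda>c x. s c x + t c x) c x = T s c x + T t c x"
    using op2_add[OF coord_range_open[OF c(1)] densities_smooth[OF s(1) c(1)] densities_smooth[OF s(2) c(1)] c(2)] by simp
qed

text \<open>Outside the closed set \<open>?C\<close> each point has a neighbourhood on which the
  density is 0 in the chart at hand, and a differential operator sees only the germ.\<close>

lemma operator_supported:
  assumes "is_local w T" and s: "s \<in> densities A w" and c: "c \<in> A" and K: "supported_in c K s"
  shows "supported_in c K (T s)"
proof -
  have cK: "compact K" "K \<subseteq> coord_range c" using K by (auto simp: supported_in_def)
  let ?C = "{p \<in> fst c. snd c p \<in> K}"
  have "T s d x = 0" if d: "d \<in> A" and p: "p \<in> fst d" "p \<notin> ?C" and xp: "x = snd d p" for d x p
  proof -
    define N where "N = snd d ` (fst d \<inter> (topspace X - ?C))"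
    have N: "open N"
      unfolding N_def using closedin_chart_preimage[OF c cK] d by (intro chart_image_open) auto
    have "p \<in> topspace X" using openin_subset[OF chart_open[OF d]] p(1) by blast
    then have xN: "x \<in> N" using p xp by (auto simp: N_def)
    have z: "s d y = 0" if y: "y \<in> N" for y
    proof (cases "y \<in> overlap d c")
      case True
      obtain q where q: "q \<in> fst d" "q \<notin> ?C" "y = snd d q" using y unfolding N_def by blast
      then have "q \<in> fst c" using True snd_in_overlap_iff[OF d] by blast
      then have "s c (snd c q) = 0" using q(2) K by (auto simp: supported_in_def coord_range_def)
      then show ?thesis
        using densities_transform[OF s d c True] transition_snd[OF d q(1)] q(3) by simp
    next
      case False
      then have "y \<in> coord_range d - overlap d c" using y by (auto simp: N_def coord_range_def)
      then show ?thesis using K d unfolding supported_in_def by blast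
    qed
    obtain P V W where l: "local_form A w T d P V W" using is_localD[OF assms(1) d] by metis
    have "x \<in> coord_range d" using p xp by (auto simp: coord_range_def)
    then have "T s d x = op2 P V W (s d) x" using l s unfolding local_form_def by blast
    also have "\<dots> = op2 P V W (\<lambda>_. 0) x" by (rule op2_cong[OF N xN z])
    finally show ?thesis by (simp add: op2_def)
  qed
  note zero = this
  show ?thesis unfolding supported_in_def
  proof (intro conjI ballI cK)
    fix x assume x: "x \<in> coord_range c - K"
    then obtain p where "p \<in> fst c" "x = snd c p" unfolding coord_range_def by blast
    then show "T s c x = 0" using x by (intro zero[OF c, of p]) auto
  next
    fix d x assume d: "d \<in> A" and x: "x \<in> coord_range d - overlap d c"
    then obtain p where p: "p \<in> fst d" "x = snd d p" unfolding coord_range_def by blast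
    then have "p \<notin> fst c" using x snd_in_overlap_iff[OF d] by blast
    then show "T s d x = 0" using p by (intro zero[OF d, of p]) auto
  qed
qed

section \<open>Adjoints\<close>

lemma weight_sum: "s \<in> densities A (w + \<delta>) \<Longrightarrow> t \<in> densities A (1 - w - \<delta>) \<Longrightarrow> (\<lambda>c x. s c x * t c x) \<in> densities A 1"
  using densities_mult[of s "w + \<delta>" t "1 - w - \<delta>"] by simp

lemma weight_sum': "s \<in> densities A w \<Longrightarrow> t \<in> densities A (1 - w) \<Longrightarrow> (\<lambda>c x. s c x * t c x) \<in> densities A 1"
  using densities_mult[of s w t "1 - w"] by simp

lemma is_adjoint_iff:
  "is_adjoint A \<delta> w T T' \<longleftrightarrow> T' \<in> operators A \<delta> (1 - w - \<delta>) \<and>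
    (\<forall>s\<in>densities A w. \<forall>t\<in>densities A (1 - w - \<delta>).
      density_integral A (\<lambda>c x. T s c x * t c x) = density_integral A (\<lambda>c x. s c x * T' t c x))"
  by (simp add: is_adjoint_def pairing_def)

text \<open>Both sides are additive in the first density, so it may be assumed to be supported in
  one chart while the second stays arbitrary. Locality of \<open>T\<close> keeps both integrands in
  that chart, where integration by parts applies.\<close>

lemma is_adjointI:
  assumes T: "T \<in> operators A \<delta> w" "is_local w T" and T': "T' \<in> operators A \<delta> (1 - w - \<delta>)"
    and adj: "\<And>c. c \<in> A \<Longrightarrow> \<exists>P V W. local_form A w T c P V W \<and>
      (\<forall>x\<in>coord_range c. \<forall>a b. P x $ a $ b = P x $ b $ a) \<and>
      (\<forall>t\<in>densities A (1 - w - \<delta>). \<forall>x\<in>coord_range c. T' t c x = op2 P (adjoint1 P V) (adjoint0 P V W) (t c) x)"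
  shows "is_adjoint A \<delta> w T T'"
proof -
  have T't: "T' t \<in> densities A (1 - w)" if "t \<in> densities A (1 - w - \<delta>)" for t
    using operators_mem[OF T' that] by simp
  have "density_integral A (\<lambda>c x. T s c x * t c x) = density_integral A (\<lambda>c x. s c x * T' t c x)"
    if s: "s \<in> densities A w" and t: "t \<in> densities A (1 - w - \<delta>)" for s t
    using s
  proof (induction rule: density_induct)
    case zero
    then show ?case by (simp add: operator_zero[OF T])
  next
    case (add s s')
    then show ?case
      using density_integral_add[OF weight_sum[OF operators_mem[OF T(1) add(1)] t] weight_sum[OF operators_mem[OF T(1) add(2)] t]]
        density_integral_add[OF weight_sum'[OF add(1) T't[OF t]] weight_sum'[OF add(2) T't[OF t]]]
      by (simp add: operator_add[OF T] distrib_right)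
  next
    case (supported s c K)
    obtain P V W where l: "local_form A w T c P V W" and sym: "\<forall>x\<in>coord_range c. \<forall>a b. P x $ a $ b = P x $ b $ a"
      and "\<forall>t\<in>densities A (1 - w - \<delta>). \<forall>x\<in>coord_range c. T' t c x = op2 P (adjoint1 P V) (adjoint0 P V W) (t c) x"
      using adj[OF supported(2)] by blast
    then have T'c: "T' t c x = op2 P (adjoint1 P V) (adjoint0 P V W) (t c) x" if "x \<in> coord_range c" for x
      using t that by blast
    have K: "compact K" "K \<subseteq> coord_range c" "\<And>x. x \<in> coord_range c - K \<Longrightarrow> s c x = 0"
      using supported(3) by (auto simp: supported_in_def)
    have "density_integral A (\<lambda>c x. T s c x * t c x) = integral (coord_range c) (\<lambda>x. T s c x * t c x)"
      by (rule supported_integral(2)[OF weight_sum[OF operators_mem[OF T(1) supported(1)] t] supported(2)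
        supported_in_mult(1)[OF operator_supported[OF T(2) supported]]])
    also have "\<dots> = integral (coord_range c) (\<lambda>x. op2 P V W (s c) x * t c x)"
      using l supported(1) by (intro integral_cong) (auto simp: local_form_def)
    also have "\<dots> = integral (coord_range c) (\<lambda>x. s c x * op2 P (adjoint1 P V) (adjoint0 P V W) (t c) x)"
      using l densities_smooth[OF supported(1,2)] densities_smooth[OF t supported(2)] K
      by (intro op2_adjoint[OF coord_range_open[OF supported(2)] K(1,2)]) (use sym in \<open>auto simp: local_form_def\<close>)
    also have "\<dots> = integral (coord_range c) (\<lambda>x. s c x * T' t c x)"
      by (intro integral_cong) (simp add: T'c)
    also have "\<dots> = density_integral A (\<lambda>c x. s c x * T' t c x)"
      by (rule supported_integral(2)[OF weight_sum'[OF supported(1) T't[OF t]] supported(2)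
        supported_in_mult(1)[OF supported(3)], symmetric])
    finally show ?case .
  qed
  then show ?thesis using T' by (simp add: is_adjoint_iff)
qed

text \<open>Testing with extensions of compactly supported functions localizes the global pairing to
  one chart. Integration by parts and the fundamental lemma then identify the adjoint with the
  formal adjoint, and uniqueness of symmetric coefficients finishes the comparison.\<close>

lemma adjoint_local_form:
  assumes T: "T \<in> operators A \<delta> w" "is_local w T" and adj: "is_adjoint A \<delta> w T T'" and c: "c \<in> A"
    and l: "local_form A w T c P V W" "local_form A (1 - w - \<delta>) T' c P' V' W'"
    and sym: "\<And>x a b. P x $ a $ b = P x $ b $ a" "\<And>x a b. P' x $ a $ b = P' x $ b $ a"
    and x: "x \<in> coord_range c"
  shows "P' x = P x" "V' x = adjoint1 P V x" "W' x = adjoint0 P V W x"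
proof -
  let ?U = "coord_range c"
  have U: "open ?U" using coord_range_open[OF c] .
  have sm: "smooth_on P ?U" "smooth_on V ?U" "smooth_on W ?U" "smooth_on P' ?U" "smooth_on V' ?U" "smooth_on W' ?U"
    using l by (auto simp: local_form_def)
  have sa: "smooth_on (adjoint1 P V) ?U" "smooth_on (adjoint0 P V W) ?U"
    using U sm by (auto intro!: smooth_on_add smooth_on_diff smooth_on_divergence
      smooth_on_tensor_divergence smooth_on_scaleR smooth_on_const)
  have T': "T' \<in> operators A \<delta> (1 - w - \<delta>)"
    and int: "\<And>s t. s \<in> densities A w \<Longrightarrow> t \<in> densities A (1 - w - \<delta>) \<Longrightarrow>
      density_integral A (\<lambda>c x. T s c x * t c x) = density_integral A (\<lambda>c x. s c x * T' t c x)"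
    using adj by (auto simp: is_adjoint_iff)
  have eq: "op2 P' V' W' (t c) y = op2 P (adjoint1 P V) (adjoint0 P V W) (t c) y"
    if t: "t \<in> densities A (1 - w - \<delta>)" and y: "y \<in> ?U" for t y
  proof -
    let ?h1 = "op2 P (adjoint1 P V) (adjoint0 P V W) (t c)" and ?h2 = "op2 P' V' W' (t c)"
    have st: "smooth_on (t c) ?U" using densities_smooth[OF t c] .
    have sh: "smooth_on ?h1 ?U" "smooth_on ?h2 ?U"
      by (intro smooth_on_op2 U sm sa st)+
    have "?h1 y - ?h2 y = 0"
    proof (rule fundamental_lemma[OF U _ _ y])
      show "continuous_on ?U (\<lambda>x. ?h1 x - ?h2 x)"
        using sh by (intro continuous_on_diff smooth_on_continuous)
      fix f :: "real ^ 'n \<Rightarrow> real" and K assume f: "smooth_on f UNIV" and K: "compact K" "K \<subseteq> ?U" and f0: "\<And>x. x \<notin> K \<Longrightarrow> f x = 0"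
      have fU: "smooth_on f ?U" using f by (rule smooth_on_subset) simp
      \<comment> \<open>The test function on the chart becomes a global density, so the adjointness
        relation can be used on it.\<close>
      define s where "s = extension c w f"
      have s: "s \<in> densities A w" "supported_in c K s" "\<And>x. x \<in> ?U \<Longrightarrow> s c x = f x"
        unfolding s_def using extension[OF c fU K] f0 by auto
      have T't: "T' t \<in> densities A (1 - w)" using operators_mem[OF T' t] by simp
      have "integral ?U (\<lambda>x. f x * ?h1 x) = integral ?U (\<lambda>x. op2 P V W f x * t c x)"
        by (rule op2_adjoint[symmetric, OF U K sm(1-3) fU st sym(1)]) (simp add: f0)
      also have "\<dots> = integral ?U (\<lambda>x. T s c x * t c x)"
      proof (rule integral_cong)
        fix x assume x: "x \<in> ?U"
        have "T s c x = op2 P V W (s c) x" using l(1) s(1) x unfolding local_form_def by blast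
        also have "\<dots> = op2 P V W f x" by (rule op2_cong[OF U x s(3)])
        finally show "op2 P V W f x * t c x = T s c x * t c x" by simp
      qed
      also have "\<dots> = density_integral A (\<lambda>c x. T s c x * t c x)"
        by (rule supported_integral(2)[OF weight_sum[OF operators_mem[OF T(1) s(1)] t] c
          supported_in_mult(1)[OF operator_supported[OF T(2) s(1) c s(2)]], symmetric])
      also have "\<dots> = density_integral A (\<lambda>c x. s c x * T' t c x)"
        by (rule int[OF s(1) t])
      also have "\<dots> = integral ?U (\<lambda>x. s c x * T' t c x)"
        by (rule supported_integral(2)[OF weight_sum'[OF s(1) T't] c supported_in_mult(1)[OF s(2)]])
      also have "\<dots> = integral ?U (\<lambda>x. f x * ?h2 x)"
        using l(2) t by (intro integral_cong) (simp add: s(3) local_form_def)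
      finally have eq: "integral ?U (\<lambda>x. f x * ?h1 x) = integral ?U (\<lambda>x. f x * ?h2 x)" .
      have int12: "(\<lambda>x. f x * ?h1 x) integrable_on ?U" "(\<lambda>x. f x * ?h2 x) integrable_on ?U"
        using absolutely_integrable_compact_support[OF K smooth_on_continuous[OF smooth_on_mult[OF U fU sh(1)]]]
          absolutely_integrable_compact_support[OF K smooth_on_continuous[OF smooth_on_mult[OF U fU sh(2)]]] f0
        by (auto simp: absolutely_integrable_on_def)
      show "integral ?U (\<lambda>x. f x * (?h1 x - ?h2 x)) = 0"
        using integral_diff[OF int12] eq by (simp add: right_diff_distrib)
    qed
    then show ?thesis by simp
  qed
  \<comment> \<open>\<open>T'\<close> now has two local forms with symmetric second-order part,
    which must coincide.\<close>
  have "local_form A (1 - w - \<delta>) T' c P (adjoint1 P V) (adjoint0 P V W)"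
    using l(2) sm sa eq unfolding local_form_def by auto
  from local_form_unique[OF c l(2) this sym(2) sym(1) x]
  show "P' x = P x" "V' x = adjoint1 P V x" "W' x = adjoint0 P V W x" .
qed

end

subsection \<open>The canonical pencil\<close>

lemma divergence_cong:
  "open U \<Longrightarrow> x \<in> U \<Longrightarrow> (\<And>y. y \<in> U \<Longrightarrow> V y = V' y) \<Longrightarrow> divergence V x = divergence V' x"
  unfolding divergence_def by (intro sum.cong refl pd_cong[of U]) auto

lemma tensor_divergence_cong:
  "open U \<Longrightarrow> x \<in> U \<Longrightarrow> (\<And>y. y \<in> U \<Longrightarrow> P y = P' y) \<Longrightarrow> tensor_divergence P x = tensor_divergence P' x"
  unfolding tensor_divergence_def vec_eq_iff vec_lambda_beta by (intro allI sum.cong refl pd_cong[of U]) auto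

lemma divergence_lincomb:
  assumes "V differentiable (at x)" "V' differentiable (at x)"
  shows "divergence (\<lambda>y. r *\<^sub>R V y + t *\<^sub>R V' y) x = r * divergence V x + t * divergence V' x"
proof -
  have "pd a (\<lambda>y. r * V y $ a + t * V' y $ a) x = r * pd a (\<lambda>y. V y $ a) x + t * pd a (\<lambda>y. V' y $ a) x" for a
    using assms[THEN differentiable_vec_nth] by (simp add: pd_add pd_cmult differentiable_mult)
  then show ?thesis by (simp add: divergence_def sum.distrib sum_distrib_left)
qed

lemma tensor_divergence_scale:
  assumes "P differentiable (at x)"
  shows "tensor_divergence (\<lambda>y. r *\<^sub>R P y) x = r *\<^sub>R tensor_divergence P x"
  using differentiable_vec_nth[OF differentiable_vec_nth[OF assms]]
  by (simp add: tensor_divergence_def vec_eq_iff pd_cmult sum_distrib_left)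

lemma smooth_on_coef1:
  assumes "open U" "smooth_on S U" "smooth_on \<gamma> U" shows "smooth_on (coef1 w \<delta> S \<gamma>) U"
  unfolding coef1_def[abs_def] using assms
  by (intro smooth_on_scaleR smooth_on_add smooth_on_tensor_divergence smooth_on_const)

lemma smooth_on_coef0:
  assumes "open U" "smooth_on \<gamma> U" "smooth_on \<theta> U" shows "smooth_on (coef0 w \<delta> \<gamma> \<theta>) U"
  unfolding coef0_def[abs_def] using assms
  by (intro smooth_on_mult smooth_on_add smooth_on_divergence smooth_on_const)

lemma smooth_on_scale:
  fixes S :: "'a::real_normed_vector \<Rightarrow> 'b::real_normed_vector"
  shows "open U \<Longrightarrow> smooth_on S U \<Longrightarrow> smooth_on (\<lambda>x. r *\<^sub>R S x) U"
  by (intro smooth_on_scaleR smooth_on_const)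

lemma canonical_form_op2:
  "1 / 2 * ((\<Sum>a\<in>UNIV. \<Sum>b\<in>UNIV. S x $ a $ b * pd a (pd b f) x)
     + (\<Sum>a\<in>UNIV. tensor_divergence S x $ a * pd a f x)
     + (2 * w + \<delta> - 1) * (\<Sum>a\<in>UNIV. \<gamma> x $ a * pd a f x)
     + w * divergence \<gamma> x * f x + w * (w + \<delta> - 1) * \<theta> x * f x)
   = op2 (\<lambda>x. (1 / 2) *\<^sub>R S x) (coef1 w \<delta> S \<gamma>) (coef0 w \<delta> \<gamma> \<theta>) f x"
proof -
  have "(\<Sum>a\<in>UNIV. coef1 w \<delta> S \<gamma> x $ a * pd a f x) = (\<Sum>a\<in>UNIV. 1 / 2 * (tensor_divergence S x $ a * pd a f x
      + (2 * w + \<delta> - 1) * (\<gamma> x $ a * pd a f x)))"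
    by (intro sum.cong refl) (simp add: coef1_def algebra_simps)
  then have 1: "(\<Sum>a\<in>UNIV. coef1 w \<delta> S \<gamma> x $ a * pd a f x) = 1 / 2 * ((\<Sum>a\<in>UNIV. tensor_divergence S x $ a * pd a f x)
      + (2 * w + \<delta> - 1) * (\<Sum>a\<in>UNIV. \<gamma> x $ a * pd a f x))"
    by (simp only: sum_distrib_left[symmetric] sum.distrib)
  have 2: "(\<Sum>a\<in>UNIV. \<Sum>b\<in>UNIV. ((1 / 2) *\<^sub>R S x) $ a $ b * pd a (pd b f) x)
      = 1 / 2 * (\<Sum>a\<in>UNIV. \<Sum>b\<in>UNIV. S x $ a $ b * pd a (pd b f) x)"
    by (simp add: sum_distrib_left)
  show ?thesis unfolding op2_def 1 2 coef0_def by (simp add: algebra_simps)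
qed

text \<open>Under \<open>w \<mapsto> 1 - w - \<delta>\<close> the factor
  \<open>2 * w + \<delta> - 1\<close> changes sign and \<open>w * (w + \<delta> - 1)\<close> is
  invariant, just as the formal adjoint requires.\<close>

lemma coef_adjoint:
  assumes U: "open U" "x \<in> U" and smooth: "smooth_on S U" "smooth_on \<gamma> U"
  shows "adjoint1 (\<lambda>x. (1 / 2) *\<^sub>R S x) (coef1 w \<delta> S \<gamma>) x = coef1 (1 - w - \<delta>) \<delta> S \<gamma> x"
    and "adjoint0 (\<lambda>x. (1 / 2) *\<^sub>R S x) (coef1 w \<delta> S \<gamma>) (coef0 w \<delta> \<gamma> \<theta>) x = coef0 (1 - w - \<delta>) \<delta> \<gamma> \<theta> x"
proof -
  have td: "tensor_divergence (\<lambda>x. (1 / 2) *\<^sub>R S x) y = (1 / 2) *\<^sub>R tensor_divergence S y" if "y \<in> U" for y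
    by (rule tensor_divergence_scale[OF smooth_on_differentiable[OF smooth(1) that]])
  show "adjoint1 (\<lambda>x. (1 / 2) *\<^sub>R S x) (coef1 w \<delta> S \<gamma>) x = coef1 (1 - w - \<delta>) \<delta> S \<gamma> x"
    by (simp add: td U(2) coef1_def vec_eq_iff field_simps)
  have dT: "tensor_divergence S differentiable (at x)"
    by (rule smooth_on_differentiable[OF smooth_on_tensor_divergence[OF U(1) smooth(1)] U(2)])
  have d\<gamma>: "\<gamma> differentiable (at x)"
    by (rule smooth_on_differentiable[OF smooth(2) U(2)])
  have "divergence (tensor_divergence (\<lambda>x. (1 / 2) *\<^sub>R S x)) x
      = divergence (\<lambda>y. (1 / 2) *\<^sub>R tensor_divergence S y + 0 *\<^sub>R \<gamma> y) x"
    by (rule divergence_cong[OF U]) (simp add: td)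
  also have "\<dots> = 1 / 2 * divergence (tensor_divergence S) x"
    by (subst divergence_lincomb[OF dT d\<gamma>]) simp
  finally have 1: "divergence (tensor_divergence (\<lambda>x. (1 / 2) *\<^sub>R S x)) x = 1 / 2 * divergence (tensor_divergence S) x" .
  have "coef1 w \<delta> S \<gamma> = (\<lambda>y. (1 / 2) *\<^sub>R tensor_divergence S y + ((2 * w + \<delta> - 1) / 2) *\<^sub>R \<gamma> y)"
    by (simp add: fun_eq_iff coef1_def scaleR_add_right)
  then have 2: "divergence (coef1 w \<delta> S \<gamma>) x = 1 / 2 * divergence (tensor_divergence S) x
      + (2 * w + \<delta> - 1) / 2 * divergence \<gamma> x"
    using divergence_lincomb[OF dT d\<gamma>] by simp
  show "adjoint0 (\<lambda>x. (1 / 2) *\<^sub>R S x) (coef1 w \<delta> S \<gamma>) (coef0 w \<delta> \<gamma> \<theta>) x = coef0 (1 - w - \<delta>) \<delta> \<gamma> \<theta> x"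
    unfolding 1 2 coef0_def by (simp add: field_simps)
qed

context compact_oriented
begin

lemma canonical_pencil_iff:
  "canonical_pencil A \<delta> S \<gamma> \<theta> D \<longleftrightarrow> (\<forall>w. D w \<in> operators A \<delta> w) \<and>
     (\<forall>c\<in>A. smooth_on (S c) (coord_range c) \<and> smooth_on (\<gamma> c) (coord_range c) \<and> smooth_on (\<theta> c) (coord_range c) \<and>
       (\<forall>x\<in>coord_range c. \<forall>a b. S c x $ a $ b = S c x $ b $ a) \<and>
       (\<forall>w. local_form A w (D w) c (\<lambda>x. (1 / 2) *\<^sub>R S c x) (coef1 w \<delta> (S c) (\<gamma> c)) (coef0 w \<delta> (\<gamma> c) (\<theta> c))))"
proof -
  have *: "(\<forall>w. \<forall>s\<in>densities A w. \<forall>x\<in>coord_range c. D w s c x =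
        op2 (\<lambda>x. (1 / 2) *\<^sub>R S c x) (coef1 w \<delta> (S c) (\<gamma> c)) (coef0 w \<delta> (\<gamma> c) (\<theta> c)) (s c) x) \<longleftrightarrow>
      (\<forall>w. local_form A w (D w) c (\<lambda>x. (1 / 2) *\<^sub>R S c x) (coef1 w \<delta> (S c) (\<gamma> c)) (coef0 w \<delta> (\<gamma> c) (\<theta> c)))"
    if "c \<in> A" "smooth_on (S c) (coord_range c)" "smooth_on (\<gamma> c) (coord_range c)" "smooth_on (\<theta> c) (coord_range c)" for c
    unfolding local_form_def
    using coord_range_open[OF that(1)] that(2-4) by (simp add: smooth_on_scale smooth_on_coef1 smooth_on_coef0)
  show ?thesis
    unfolding canonical_pencil_def canonical_form_op2
    by (intro conj_cong ball_cong refl) (rule *; assumption)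
qed

lemma canonical_pencilD:
  assumes "canonical_pencil A \<delta> S \<gamma> \<theta> D"
  shows "D w \<in> operators A \<delta> w"
    and "c \<in> A \<Longrightarrow> smooth_on (S c) (coord_range c)" "c \<in> A \<Longrightarrow> smooth_on (\<gamma> c) (coord_range c)"
      "c \<in> A \<Longrightarrow> smooth_on (\<theta> c) (coord_range c)"
    and "c \<in> A \<Longrightarrow> x \<in> coord_range c \<Longrightarrow> S c x $ a $ b = S c x $ b $ a"
    and "c \<in> A \<Longrightarrow> local_form A w (D w) c (\<lambda>x. (1 / 2) *\<^sub>R S c x) (coef1 w \<delta> (S c) (\<gamma> c)) (coef0 w \<delta> (\<gamma> c) (\<theta> c))"
  using assms unfolding canonical_pencil_iff by blast+

lemma canonical_imp_normalized_self_adjoint: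
  assumes D: "canonical_pencil A \<delta> S \<gamma> \<theta> D"
  shows "normalized_self_adjoint_pencil A \<delta> D"
  unfolding normalized_self_adjoint_pencil_def
proof (intro conjI)
  note D' = canonical_pencilD[OF D]
  have loc: "is_local w (D w)" for w
    unfolding is_local_def using D'(6) by blast
  show "self_adjoint_pencil A \<delta> D"
    unfolding self_adjoint_pencil_def
  proof (intro allI is_adjointI D'(1) loc)
    fix w c assume c: "c \<in> A"
    let ?P = "\<lambda>x. (1 / 2) *\<^sub>R S c x" and ?V = "coef1 w \<delta> (S c) (\<gamma> c)" and ?W = "coef0 w \<delta> (\<gamma> c) (\<theta> c)"
    have "D (1 - w - \<delta>) t c x = op2 ?P (adjoint1 ?P ?V) (adjoint0 ?P ?V ?W) (t c) x"
      if "t \<in> densities A (1 - w - \<delta>)" "x \<in> coord_range c" for t x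
    proof -
      have "D (1 - w - \<delta>) t c x = op2 ?P (coef1 (1 - w - \<delta>) \<delta> (S c) (\<gamma> c)) (coef0 (1 - w - \<delta>) \<delta> (\<gamma> c) (\<theta> c)) (t c) x"
        using D'(6)[OF c, of "1 - w - \<delta>"] that unfolding local_form_def by blast
      then show ?thesis
        using coef_adjoint[OF coord_range_open[OF c] that(2) D'(2,3)[OF c], of w \<delta>]
        unfolding op2_def by simp
    qed
    moreover have "?P x $ a $ b = ?P x $ b $ a" if "x \<in> coord_range c" for x a b
      using D'(5)[OF c that, of a b] by simp
    ultimately show "\<exists>P V W. local_form A w (D w) c P V W \<and>
        (\<forall>x\<in>coord_range c. \<forall>a b. P x $ a $ b = P x $ b $ a) \<and>
        (\<forall>t\<in>densities A (1 - w - \<delta>). \<forall>x\<in>coord_range c.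
          D (1 - w - \<delta>) t c x = op2 P (adjoint1 P V) (adjoint0 P V W) (t c) x)"
      using D'(6)[OF c, of w] by (intro exI[of _ ?P] exI[of _ ?V] exI[of _ ?W]) blast
  qed
  show "normalized_pencil A D"
    unfolding normalized_pencil_def
  proof (rule densities_eqI[OF operators_mem[OF D'(1) unit_density] densities_zero[of 0]])
    fix c x assume c: "c \<in> A" "x \<in> coord_range c"
    have "D 0 (unit_density A) c x = op2 (\<lambda>x. (1 / 2) *\<^sub>R S c x) (coef1 0 \<delta> (S c) (\<gamma> c)) (coef0 0 \<delta> (\<gamma> c) (\<theta> c)) (unit_density A c) x"
      using D'(6)[OF c(1), of 0] unit_density c(2) unfolding local_form_def by blast
    also have "\<dots> = op2 (\<lambda>x. (1 / 2) *\<^sub>R S c x) (coef1 0 \<delta> (S c) (\<gamma> c)) (coef0 0 \<delta> (\<gamma> c) (\<theta> c)) (\<lambda>_. 1) x"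
      by (rule op2_cong[OF coord_range_open[OF c(1)] c(2)]) (simp add: unit_density_def c(1))
    finally show "D 0 (unit_density A) c x = 0" by (simp add: op2_const_one coef0_def)
  qed
  show "second_order_pencil A \<delta> D"
    unfolding second_order_pencil_def
  proof (intro conjI allI ballI D'(1))
    fix c assume c: "c \<in> A"
    have U: "open (coord_range c)" by (rule coord_range_open[OF c])
    \<comment> \<open>The canonical coefficients sorted by powers of \<open>w\<close>:
      \<open>\<gamma>\<close> becomes \<open>Q\<close>, half of \<open>\<theta>\<close> becomes
      \<open>C\<close>, and \<open>G\<close> is 0.\<close>
    let ?V = "\<lambda>x. (1 / 2) *\<^sub>R (tensor_divergence (S c) x + (\<delta> - 1) *\<^sub>R \<gamma> c x)"
    let ?E = "\<lambda>x. 1 / 2 * (divergence (\<gamma> c) x + (\<delta> - 1) * \<theta> c x)"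
    have coef: "coef1 w \<delta> (S c) (\<gamma> c) = (\<lambda>y. w *\<^sub>R \<gamma> c y + ?V y)"
      "coef0 w \<delta> (\<gamma> c) (\<theta> c) = (\<lambda>y. w\<^sup>2 * (1 / 2 * \<theta> c y) + w * ?E y + 0)" for w
      by (simp_all add: fun_eq_iff coef1_def coef0_def vec_eq_iff field_simps power2_eq_square)
    show "\<exists>P Q C V E G. smooth_on P (coord_range c) \<and> smooth_on Q (coord_range c) \<and>
        smooth_on C (coord_range c) \<and> smooth_on V (coord_range c) \<and> smooth_on E (coord_range c) \<and>
        smooth_on G (coord_range c) \<and> (\<forall>w. \<forall>s\<in>densities A w. \<forall>x\<in>coord_range c.
          D w s c x = op2 P (\<lambda>y. w *\<^sub>R Q y + V y) (\<lambda>y. w\<^sup>2 * C y + w * E y + G y) (s c) x)"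
    proof (intro exI conjI)
      show "smooth_on (\<lambda>x. (1 / 2) *\<^sub>R S c x) (coord_range c)" "smooth_on (\<gamma> c) (coord_range c)"
        "smooth_on (\<lambda>x. 1 / 2 * \<theta> c x) (coord_range c)" "smooth_on ?V (coord_range c)"
        "smooth_on ?E (coord_range c)" "smooth_on (\<lambda>x. 0) (coord_range c)"
        by (intro smooth_on_scaleR smooth_on_mult smooth_on_add smooth_on_const
          smooth_on_tensor_divergence smooth_on_divergence U D'(2)[OF c] D'(3)[OF c] D'(4)[OF c])+
      show "\<forall>w. \<forall>s\<in>densities A w. \<forall>x\<in>coord_range c. D w s c x =
          op2 (\<lambda>x. (1 / 2) *\<^sub>R S c x) (\<lambda>y. w *\<^sub>R \<gamma> c y + ?V y) (\<lambda>y. w\<^sup>2 * (1 / 2 * \<theta> c y) + w * ?E y + 0) (s c) x"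
        using D'(6)[OF c] unfolding local_form_def coef by blast
    qed
  qed
qed

text \<open>It suffices to use self-adjointness at the weight \<open>w = - \<delta> / 2\<close>, whose dual weight is \<open>w + 1\<close>.\<close>

lemma normalized_self_adjoint_local:
  assumes D: "normalized_self_adjoint_pencil A \<delta> D" and c: "c \<in> A"
  obtains S \<gamma> \<theta> where "smooth_on S (coord_range c)" "smooth_on \<gamma> (coord_range c)" "smooth_on \<theta> (coord_range c)"
    "\<And>x a b. S x $ a $ b = S x $ b $ a"
    "\<And>w. local_form A w (D w) c (\<lambda>x. (1 / 2) *\<^sub>R S x) (coef1 w \<delta> S \<gamma>) (coef0 w \<delta> \<gamma> \<theta>)"
proof -
  let ?U = "coord_range c"
  have U: "open ?U" by (rule coord_range_open[OF c])
  have ops: "D w \<in> operators A \<delta> w" for w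
    using D unfolding normalized_self_adjoint_pencil_def second_order_pencil_def by blast
  have ex: "\<forall>c\<in>A. \<exists>P Q C V E G. smooth_on P (coord_range c) \<and> smooth_on Q (coord_range c) \<and>
        smooth_on C (coord_range c) \<and> smooth_on V (coord_range c) \<and> smooth_on E (coord_range c) \<and>
        smooth_on G (coord_range c) \<and> (\<forall>w. \<forall>s\<in>densities A w. \<forall>x\<in>coord_range c.
          D w s c x = op2 P (\<lambda>y. w *\<^sub>R Q y + V y) (\<lambda>y. w\<^sup>2 * C y + w * E y + G y) (s c) x)"
    using D unfolding normalized_self_adjoint_pencil_def second_order_pencil_def by blast
  have lf: "local_form A w (D w) d P (\<lambda>y. w *\<^sub>R Q y + V y) (\<lambda>y. w\<^sup>2 * C y + w * E y + G y)"
    if d: "d \<in> A" and sm: "smooth_on P (coord_range d)" "smooth_on Q (coord_range d)"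
        "smooth_on C (coord_range d)" "smooth_on V (coord_range d)" "smooth_on E (coord_range d)"
        "smooth_on G (coord_range d)" and eq: "\<forall>w. \<forall>s\<in>densities A w. \<forall>x\<in>coord_range d.
          D w s d x = op2 P (\<lambda>y. w *\<^sub>R Q y + V y) (\<lambda>y. w\<^sup>2 * C y + w * E y + G y) (s d) x"
    for w d P Q C V E G
    unfolding local_form_def
    using eq sm coord_range_open[OF d]
    by (intro conjI smooth_on_add smooth_on_scaleR smooth_on_mult smooth_on_const) auto
  have loc: "is_local w (D w)" for w
    unfolding is_local_def
  proof
    fix d assume d: "d \<in> A"
    obtain P Q C V E G where "smooth_on P (coord_range d)" "smooth_on Q (coord_range d)"
        "smooth_on C (coord_range d)" "smooth_on V (coord_range d)" "smooth_on E (coord_range d)"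
        "smooth_on G (coord_range d)" "\<forall>w. \<forall>s\<in>densities A w. \<forall>x\<in>coord_range d.
          D w s d x = op2 P (\<lambda>y. w *\<^sub>R Q y + V y) (\<lambda>y. w\<^sup>2 * C y + w * E y + G y) (s d) x"
      using bspec[OF ex d] by blast
    from lf[OF d this] show "\<exists>P V W. local_form A w (D w) d P V W" by blast
  qed
  obtain P0 Q C V E G where sm0: "smooth_on P0 ?U" and sm: "smooth_on Q ?U"
        "smooth_on C ?U" "smooth_on V ?U" "smooth_on E ?U" "smooth_on G ?U"
      and eq: "\<forall>w. \<forall>s\<in>densities A w. \<forall>x\<in>?U.
          D w s c x = op2 P0 (\<lambda>y. w *\<^sub>R Q y + V y) (\<lambda>y. w\<^sup>2 * C y + w * E y + G y) (s c) x"
    using bspec[OF ex c] by blast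
  define P where "P = symmetrization P0"
  have l: "local_form A w (D w) c P (\<lambda>y. w *\<^sub>R Q y + V y) (\<lambda>y. w\<^sup>2 * C y + w * E y + G y)" for w
    unfolding P_def by (rule local_form_sym[OF c lf[OF c sm0 sm eq]])
  have sP: "smooth_on P ?U" using l[of 0] by (simp add: local_form_def)
  have sym: "P x $ a $ b = P x $ b $ a" for x a b unfolding P_def by (rule symmetrization_sym)
  \<comment> \<open>At weight 0 the operator maps the constant 1 to \<open>G\<close>, so this is the
    normalization.\<close>
  have G: "G x = 0" if x: "x \<in> ?U" for x
  proof -
    have "D 0 (unit_density A) c x = op2 P (\<lambda>y. 0 *\<^sub>R Q y + V y) (\<lambda>y. 0\<^sup>2 * C y + 0 * E y + G y) (unit_density A c) x"
      using l[of 0] unit_density x unfolding local_form_def by blast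
    also have "\<dots> = op2 P (\<lambda>y. 0 *\<^sub>R Q y + V y) (\<lambda>y. 0\<^sup>2 * C y + 0 * E y + G y) (\<lambda>_. 1) x"
      by (rule op2_cong[OF U x]) (simp add: unit_density_def c)
    also have "\<dots> = G x" by (simp add: op2_const_one)
    finally show ?thesis
      using D by (simp add: normalized_self_adjoint_pencil_def normalized_pencil_def)
  qed
  \<comment> \<open>The self-dual weight \<open>(1 - \<delta>) / 2\<close> would determine
    \<open>V\<close> but not \<open>E\<close>: there the terms in \<open>E\<close> cancel from the
    zeroth-order equation. A weight at distance 1 from its dual leaves \<open>E\<close> with
    coefficient 1.\<close>
  define w where "w = - \<delta> / 2"
  have dual: "1 - w - \<delta> = w + 1" by (simp add: w_def)
  have adj: "is_adjoint A \<delta> w (D w) (D (w + 1))"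
    using D dual unfolding normalized_self_adjoint_pencil_def self_adjoint_pencil_def by metis
  have V: "V x = tensor_divergence P x - ((1 - \<delta>) / 2) *\<^sub>R Q x"
    and W: "(w + 1)\<^sup>2 * C x + (w + 1) * E x =
      divergence (tensor_divergence P) x - divergence (\<lambda>y. w *\<^sub>R Q y + V y) x + (w\<^sup>2 * C x + w * E x)"
    if x: "x \<in> ?U" for x
  proof -
    have l': "local_form A (1 - w - \<delta>) (D (w + 1)) c P (\<lambda>y. (w + 1) *\<^sub>R Q y + V y) (\<lambda>y. (w + 1)\<^sup>2 * C y + (w + 1) * E y + G y)"
      unfolding dual by (rule l)
    note a = adjoint_local_form[OF ops loc adj c l l' sym sym x]
    have "V x $ i = tensor_divergence P x $ i - ((1 - \<delta>) / 2) * Q x $ i" for i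
    proof -
      have "(w + 1) * Q x $ i + V x $ i = 2 * tensor_divergence P x $ i - (w * Q x $ i + V x $ i)"
        using arg_cong[OF a(2), of "\<lambda>v. v $ i"] by simp
      then have "2 * w * Q x $ i + Q x $ i + 2 * V x $ i = 2 * tensor_divergence P x $ i"
        by (simp add: algebra_simps)
      then have "(1 - \<delta>) * Q x $ i + 2 * V x $ i = 2 * tensor_divergence P x $ i"
        by (simp add: w_def algebra_simps)
      then show ?thesis by (simp add: field_simps)
    qed
    then show "V x = tensor_divergence P x - ((1 - \<delta>) / 2) *\<^sub>R Q x"
      by (simp add: vec_eq_iff)
    show "(w + 1)\<^sup>2 * C x + (w + 1) * E x =
      divergence (tensor_divergence P) x - divergence (\<lambda>y. w *\<^sub>R Q y + V y) x + (w\<^sup>2 * C x + w * E x)"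
      using a(3) G[OF x] by simp
  qed
  have E: "E x = 1 / 2 * divergence Q x - (1 - \<delta>) * C x" if x: "x \<in> ?U" for x
  proof -
    have dT: "tensor_divergence P differentiable (at x)"
      by (rule smooth_on_differentiable[OF smooth_on_tensor_divergence[OF U sP] x])
    have dQ: "Q differentiable (at x)" by (rule smooth_on_differentiable[OF sm(1) x])
    \<comment> \<open>With the formula for \<open>V\<close> and this choice of \<open>w\<close>, the
      first-order coefficient is the divergence of \<open>P\<close> minus half of
      \<open>Q\<close>.\<close>
    have "divergence (\<lambda>y. w *\<^sub>R Q y + V y) x = divergence (\<lambda>y. 1 *\<^sub>R tensor_divergence P y + (- 1 / 2) *\<^sub>R Q y) x"
      by (rule divergence_cong[OF U x]) (simp add: V vec_eq_iff w_def field_simps)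
    also have "\<dots> = divergence (tensor_divergence P) x - 1 / 2 * divergence Q x"
      by (subst divergence_lincomb[OF dT dQ]) simp
    finally have "(w + 1)\<^sup>2 * C x + (w + 1) * E x = 1 / 2 * divergence Q x + (w\<^sup>2 * C x + w * E x)"
      using W[OF x] by simp
    then show ?thesis by (simp add: w_def field_simps power2_eq_square)
  qed
  show thesis
  \<comment> \<open>The factors 2 compensate the overall 1/2 of the canonical form. In its
    first-order coefficient \<open>w\<close> multiplies \<open>\<gamma>\<close> itself, so
    \<open>\<gamma>\<close> is \<open>Q\<close> without a factor.\<close>
  proof (rule that[of "\<lambda>x. 2 *\<^sub>R P x" Q "\<lambda>x. 2 * C x"])
    show sS: "smooth_on (\<lambda>x. 2 *\<^sub>R P x) ?U" using U sP by (rule smooth_on_scale)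
    show "smooth_on Q ?U" by (rule sm(1))
    show s\<theta>: "smooth_on (\<lambda>x. 2 * C x) ?U" using U sm(2) by (intro smooth_on_mult smooth_on_const)
    show "(2 *\<^sub>R P x) $ a $ b = (2 *\<^sub>R P x) $ b $ a" for x a b using sym[of x a b] by simp
    show "local_form A v (D v) c (\<lambda>x. (1 / 2) *\<^sub>R 2 *\<^sub>R P x) (coef1 v \<delta> (\<lambda>x. 2 *\<^sub>R P x) Q) (coef0 v \<delta> Q (\<lambda>x. 2 * C x))" for v
      unfolding local_form_def
    proof (intro conjI ballI)
      show "smooth_on (\<lambda>x. (1 / 2) *\<^sub>R 2 *\<^sub>R P x) ?U" using U sS by (rule smooth_on_scale)
      show "smooth_on (coef1 v \<delta> (\<lambda>x. 2 *\<^sub>R P x) Q) ?U" using U sS sm(1) by (rule smooth_on_coef1)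
      show "smooth_on (coef0 v \<delta> Q (\<lambda>x. 2 * C x)) ?U" using U sm(1) s\<theta> by (rule smooth_on_coef0)
      fix s x assume s: "s \<in> densities A v" and x: "x \<in> ?U"
      have "tensor_divergence (\<lambda>x. 2 *\<^sub>R P x) x = 2 *\<^sub>R tensor_divergence P x"
        by (rule tensor_divergence_scale[OF smooth_on_differentiable[OF sP x]])
      then have 1: "coef1 v \<delta> (\<lambda>x. 2 *\<^sub>R P x) Q x = v *\<^sub>R Q x + V x"
        unfolding coef1_def V[OF x] by (simp add: vec_eq_iff field_simps)
      have 2: "coef0 v \<delta> Q (\<lambda>x. 2 * C x) x = v\<^sup>2 * C x + v * E x + G x"
        unfolding coef0_def E[OF x] G[OF x] by (simp add: field_simps power2_eq_square)
      have "D v s c x = op2 P (\<lambda>y. v *\<^sub>R Q y + V y) (\<lambda>y. v\<^sup>2 * C y + v * E y + G y) (s c) x"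
        using l[of v] s x unfolding local_form_def by blast
      then show "D v s c x = op2 (\<lambda>x. (1 / 2) *\<^sub>R 2 *\<^sub>R P x) (coef1 v \<delta> (\<lambda>x. 2 *\<^sub>R P x) Q) (coef0 v \<delta> Q (\<lambda>x. 2 * C x)) (s c) x"
        unfolding op2_def 1 2 by simp
    qed
  qed
qed

text \<open>The triples can be chosen chart by chart, since \<open>canonical_pencil\<close> ties
  them to the operators in each chart separately.\<close>

lemma normalized_self_adjoint_iff:
  "normalized_self_adjoint_pencil A \<delta> D \<longleftrightarrow> (\<exists>S \<gamma> \<theta>. canonical_pencil A \<delta> S \<gamma> \<theta> D)"
proof
  assume D: "normalized_self_adjoint_pencil A \<delta> D"
  define good where "good c S \<gamma> \<theta> \<longleftrightarrow> smooth_on S (coord_range c) \<and> smooth_on \<gamma> (coord_range c) \<and>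
      smooth_on \<theta> (coord_range c) \<and> (\<forall>x\<in>coord_range c. \<forall>a b. S x $ a $ b = S x $ b $ a) \<and>
      (\<forall>w. local_form A w (D w) c (\<lambda>x. (1 / 2) *\<^sub>R S x) (coef1 w \<delta> S \<gamma>) (coef0 w \<delta> \<gamma> \<theta>))" for c S \<gamma> \<theta>
  have "\<exists>S \<gamma> \<theta>. good c S \<gamma> \<theta>" if "c \<in> A" for c
    unfolding good_def by (rule normalized_self_adjoint_local[OF D that]) blast
  then obtain S where "\<And>c. c \<in> A \<Longrightarrow> \<exists>\<gamma> \<theta>. good c (S c) \<gamma> \<theta>" by metis
  then obtain \<gamma> where "\<And>c. c \<in> A \<Longrightarrow> \<exists>\<theta>. good c (S c) (\<gamma> c) \<theta>" by metis
  then obtain \<theta> where good: "\<And>c. c \<in> A \<Longrightarrow> good c (S c) (\<gamma> c) (\<theta> c)" by metis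
  have "D w \<in> operators A \<delta> w" for w
    using D unfolding normalized_self_adjoint_pencil_def second_order_pencil_def by blast
  then have "canonical_pencil A \<delta> S \<gamma> \<theta> D"
    using good unfolding canonical_pencil_iff good_def by blast
  then show "\<exists>S \<gamma> \<theta>. canonical_pencil A \<delta> S \<gamma> \<theta> D" by blast
qed (use canonical_imp_normalized_self_adjoint in blast)

text \<open>The three laws make the right-hand sides of \<open>coef1_transform\<close> and
  \<open>coef0_transform\<close> zero at every weight, so the local expressions patch together to
  operators on densities.\<close>

lemma canonical_pencil_exists:
  assumes S: "principal_symbol A \<delta> S" and \<gamma>: "upper_connection A \<delta> S \<gamma>" and \<theta>: "brans_dicke_function A \<delta> S \<gamma> \<theta>"
  obtains D where "canonical_pencil A \<delta> S \<gamma> \<theta> D"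
proof
  define D where "D w = local_operator w (\<lambda>c x. (1 / 2) *\<^sub>R S c x) (\<lambda>c. coef1 w \<delta> (S c) (\<gamma> c)) (\<lambda>c. coef0 w \<delta> (\<gamma> c) (\<theta> c))" for w
  have sm: "smooth_on (S c) (coord_range c)" "smooth_on (\<gamma> c) (coord_range c)" "smooth_on (\<theta> c) (coord_range c)" if "c \<in> A" for c
    using S \<gamma> \<theta> that unfolding principal_symbol_def upper_connection_def brans_dicke_function_def by blast+
  have sym: "S c x $ a $ b = S c x $ b $ a" if "c \<in> A" "x \<in> coord_range c" for c x a b
    using S that unfolding principal_symbol_def by blast
  have op: "D w \<in> operators A \<delta> w" for w
    unfolding D_def
  proof (rule local_operator)
    fix c c' x assume c: "c \<in> A" "c' \<in> A" and x: "x \<in> overlap c c'"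
    interpret t: transition_map "transition c c'" "overlap c c'"
      using c by (rule transition_map_overlap)
    have J: "det (jac c c' y) = t.J y" for y by (simp add: t.J_def jac_def)
    have l: "log_jac c c' = t.l" by (simp add: fun_eq_iff t.l_def log_jac_def jac_def)
    have j: "jac c c' y $ p $ a = t.j p a y" if "y \<in> overlap c c'" for y p a
      using t.jacobian_j[OF that] by (simp add: jac_def)
    have sub: "overlap c c' \<subseteq> coord_range c" by (rule overlap_subset)
    have S_law: "S c' (transition c c' y) $ p $ q = t.J y powr (- \<delta>) *
        (\<Sum>a\<in>UNIV. \<Sum>b\<in>UNIV. t.j p a y * t.j q b y * S c y $ a $ b)" if y: "y \<in> overlap c c'" for y p q
      using S c y unfolding principal_symbol_def j[OF y, symmetric] J[symmetric] by blast
    have \<gamma>_law: "\<gamma> c' (transition c c' y) $ p = t.J y powr (- \<delta>) *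
        (\<Sum>a\<in>UNIV. t.j p a y * (\<gamma> c y $ a + (\<Sum>b\<in>UNIV. S c y $ a $ b * pd b t.l y)))" if y: "y \<in> overlap c c'" for y p
      using \<gamma> c y unfolding upper_connection_def j[OF y, symmetric] J[symmetric] l[symmetric] by blast
    have \<theta>_law: "\<theta> c' (transition c c' x) = t.J x powr (- \<delta>) * (\<theta> c x + 2 * (\<Sum>a\<in>UNIV. \<gamma> c x $ a * pd a t.l x)
        + (\<Sum>a\<in>UNIV. \<Sum>b\<in>UNIV. pd a t.l x * S c x $ a $ b * pd b t.l x))"
      using \<theta> c x unfolding brans_dicke_function_def J[symmetric] l[symmetric] by blast
    have symU: "S c y $ a $ b = S c y $ b $ a" if "y \<in> overlap c c'" for y a b
      using sym[OF c(1)] sub that by blast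
    have 1: "t.J x powr (w + \<delta>) *\<^sub>R ((1 / 2) *\<^sub>R S c' (transition c c' x)) =
        t.pull2 (\<lambda>y. t.J y powr w) (\<lambda>x. (1 / 2) *\<^sub>R S c x) x"
    proof -
      have "t.J x powr (w + \<delta>) * (t.J x powr (- \<delta>) * e) = t.J x powr w * e" for e
        using t.powr_inverse[OF x, of \<delta>] by (simp add: powr_add)
      then show ?thesis
        by (simp add: vec_eq_iff t.pull2_def S_law[OF x] sum_divide_distrib[symmetric] mult_ac)
    qed
    have 2: "t.J x powr (w + \<delta>) *\<^sub>R coef1 w \<delta> (S c') (\<gamma> c') (transition c c' x) =
        t.pull1 (\<lambda>y. t.J y powr w) (\<lambda>x. (1 / 2) *\<^sub>R S c x) (coef1 w \<delta> (S c) (\<gamma> c)) x"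
      using t.coef1_transform[OF coord_range_open[OF c(2)] transition_image[OF c(1)]
          smooth_on_subset[OF sm(1)[OF c(1)] sub] smooth_on_subset[OF sm(2)[OF c(1)] sub]
          sm(1)[OF c(2)] sm(2)[OF c(2)] symU S_law x, of w] \<gamma>_law[OF x]
      by (simp add: vec_eq_iff)
    have 3: "t.J x powr (w + \<delta>) * coef0 w \<delta> (\<gamma> c') (\<theta> c') (transition c c' x) =
        op2 (\<lambda>x. (1 / 2) *\<^sub>R S c x) (coef1 w \<delta> (S c) (\<gamma> c)) (coef0 w \<delta> (\<gamma> c) (\<theta> c)) (\<lambda>y. t.J y powr w) x"
      using t.coef0_transform[OF coord_range_open[OF c(2)] transition_image[OF c(1)]
          smooth_on_subset[OF sm(1)[OF c(1)] sub] smooth_on_subset[OF sm(2)[OF c(1)] sub]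
          sm(1)[OF c(2)] sm(2)[OF c(2)] symU S_law \<gamma>_law x, of w "\<theta> c'" "\<theta> c"] \<theta>_law
      by simp
    show "det (jac c c' x) powr (w + \<delta>) *\<^sub>R (1 / 2) *\<^sub>R S c' (transition c c' x)
        = transition_map.pull2 (transition c c') (\<lambda>y. det (jac c c' y) powr w) (\<lambda>x. (1 / 2) *\<^sub>R S c x) x \<and>
      det (jac c c' x) powr (w + \<delta>) *\<^sub>R coef1 w \<delta> (S c') (\<gamma> c') (transition c c' x)
        = transition_map.pull1 (transition c c') (\<lambda>y. det (jac c c' y) powr w) (\<lambda>x. (1 / 2) *\<^sub>R S c x) (coef1 w \<delta> (S c) (\<gamma> c)) x \<and>
      det (jac c c' x) powr (w + \<delta>) * coef0 w \<delta> (\<gamma> c') (\<theta> c') (transition c c' x)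
        = op2 (\<lambda>x. (1 / 2) *\<^sub>R S c x) (coef1 w \<delta> (S c) (\<gamma> c)) (coef0 w \<delta> (\<gamma> c) (\<theta> c)) (\<lambda>y. det (jac c c' y) powr w) x"
      unfolding J using 1 2 3 by blast
  next
    fix c assume c: "c \<in> A"
    note U = coord_range_open[OF c]
    show "smooth_on (\<lambda>x. (1 / 2) *\<^sub>R S c x) (coord_range c)"
      by (rule smooth_on_scale[OF U sm(1)[OF c]])
    show "smooth_on (coef1 w \<delta> (S c) (\<gamma> c)) (coord_range c)"
      by (rule smooth_on_coef1[OF U sm(1,2)[OF c]])
    show "smooth_on (coef0 w \<delta> (\<gamma> c) (\<theta> c)) (coord_range c)"
      by (rule smooth_on_coef0[OF U sm(2,3)[OF c]])
  qed
  have lf: "local_form A w (D w) c (\<lambda>x. (1 / 2) *\<^sub>R S c x) (coef1 w \<delta> (S c) (\<gamma> c)) (coef0 w \<delta> (\<gamma> c) (\<theta> c))"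
    if c: "c \<in> A" for w c
    unfolding local_form_def using coord_range_open[OF c] sm[OF c]
    by (simp add: smooth_on_scale smooth_on_coef1 smooth_on_coef0 D_def local_operator_def c)
  show "canonical_pencil A \<delta> S \<gamma> \<theta> D"
    unfolding canonical_pencil_iff using op sm sym lf by blast
qed

end

subsection \<open>The pencil through a given operator\<close>

context compact_oriented
begin

text \<open>Since \<open>T\<close> is globally defined, the left-hand sides of
  \<open>coef1_transform\<close> and \<open>coef0_transform\<close> are zero at the weight
  \<open>w\<close>. The law of \<open>S\<close> is a premise of the first and the law of
  \<open>\<gamma>\<close> of the second, so the laws come in this order; the numerical factors are
  nonzero by the assumptions on \<open>w\<close>.\<close>

lemma transformation_laws:
  assumes T: "T \<in> operators A \<delta> w"
    and smooth: "\<And>c. c \<in> A \<Longrightarrow> smooth_on (S c) (coord_range c)" "\<And>c. c \<in> A \<Longrightarrow> smooth_on (\<gamma> c) (coord_range c)"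
      "\<And>c. c \<in> A \<Longrightarrow> smooth_on (\<theta> c) (coord_range c)"
    and sym: "\<And>c x a b. c \<in> A \<Longrightarrow> x \<in> coord_range c \<Longrightarrow> S c x $ a $ b = S c x $ b $ a"
    and lf: "\<And>c. c \<in> A \<Longrightarrow> local_form A w T c (\<lambda>x. (1 / 2) *\<^sub>R S c x) (coef1 w \<delta> (S c) (\<gamma> c)) (coef0 w \<delta> (\<gamma> c) (\<theta> c))"
    and w: "w \<noteq> 0" "w + \<delta> - 1 \<noteq> 0" "2 * w + \<delta> - 1 \<noteq> 0"
  shows "principal_symbol A \<delta> S" "upper_connection A \<delta> S \<gamma>" "brans_dicke_function A \<delta> S \<gamma> \<theta>"
proof -
  have laws: "(\<forall>x\<in>overlap c c'. \<forall>p q. S c' (transition c c' x) $ p $ q = det (jac c c' x) powr (- \<delta>) *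
          (\<Sum>a\<in>UNIV. \<Sum>b\<in>UNIV. jac c c' x $ p $ a * jac c c' x $ q $ b * S c x $ a $ b)) \<and>
      (\<forall>x\<in>overlap c c'. \<forall>p. \<gamma> c' (transition c c' x) $ p = det (jac c c' x) powr (- \<delta>) *
          (\<Sum>a\<in>UNIV. jac c c' x $ p $ a * (\<gamma> c x $ a + (\<Sum>b\<in>UNIV. S c x $ a $ b * pd b (log_jac c c') x)))) \<and>
      (\<forall>x\<in>overlap c c'. \<theta> c' (transition c c' x) = det (jac c c' x) powr (- \<delta>) *
          (\<theta> c x + 2 * (\<Sum>a\<in>UNIV. \<gamma> c x $ a * pd a (log_jac c c') x)
           + (\<Sum>a\<in>UNIV. \<Sum>b\<in>UNIV. pd a (log_jac c c') x * S c x $ a $ b * pd b (log_jac c c') x)))"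
    if c: "c \<in> A" "c' \<in> A" for c c'
  proof -
    interpret t: transition_map "transition c c'" "overlap c c'"
      using c by (rule transition_map_overlap)
    have J: "det (jac c c' y) = t.J y" for y by (simp add: t.J_def jac_def)
    have l: "log_jac c c' = t.l" by (simp add: fun_eq_iff t.l_def log_jac_def jac_def)
    have j: "jac c c' y $ p $ a = t.j p a y" if "y \<in> overlap c c'" for y p a
      using t.jacobian_j[OF that] by (simp add: jac_def)
    have sub: "overlap c c' \<subseteq> coord_range c" by (rule overlap_subset)
    have symU: "S c y $ a $ b = S c y $ b $ a" if "y \<in> overlap c c'" for y a b
      using sym[OF c(1)] sub that by blast
    have tr: "t.J x powr (w + \<delta>) *\<^sub>R ((1 / 2) *\<^sub>R S c' (transition c c' x)) =
          t.pull2 (\<lambda>y. t.J y powr w) (\<lambda>x. (1 / 2) *\<^sub>R S c x) x" (is ?S)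
        "t.J x powr (w + \<delta>) *\<^sub>R coef1 w \<delta> (S c') (\<gamma> c') (transition c c' x) =
          t.pull1 (\<lambda>y. t.J y powr w) (\<lambda>x. (1 / 2) *\<^sub>R S c x) (coef1 w \<delta> (S c) (\<gamma> c)) x" (is ?V)
        "t.J x powr (w + \<delta>) * coef0 w \<delta> (\<gamma> c') (\<theta> c') (transition c c' x) =
          op2 (\<lambda>x. (1 / 2) *\<^sub>R S c x) (coef1 w \<delta> (S c) (\<gamma> c)) (coef0 w \<delta> (\<gamma> c) (\<theta> c)) (\<lambda>y. t.J y powr w) x" (is ?W)
      if x: "x \<in> overlap c c'" for x
    proof -
      have z: "transition c c' x \<in> coord_range c'" using transition_image[OF c(1), of c'] x by blast
      have "((1 / 2) *\<^sub>R S c x) $ a $ b = ((1 / 2) *\<^sub>R S c x) $ b $ a" for a b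
        using symU[OF x, of a b] by simp
      moreover have "((1 / 2) *\<^sub>R S c' (transition c c' x)) $ a $ b = ((1 / 2) *\<^sub>R S c' (transition c c' x)) $ b $ a" for a b
        using sym[OF c(2) z, of a b] by simp
      ultimately show ?S ?V ?W
        using local_form_transform[OF T c x lf[OF c(1)] lf[OF c(2)]] unfolding J by blast+
    qed
    \<comment> \<open>Positivity of the Jacobian lets its powers be cancelled from all three
      comparisons.\<close>
    have J0: "t.J x powr v \<noteq> 0" if "x \<in> overlap c c'" for x v
      using t.J_pos[OF that] by simp
    have S_law: "S c' (transition c c' x) $ p $ q = t.J x powr (- \<delta>) *
        (\<Sum>a\<in>UNIV. \<Sum>b\<in>UNIV. t.j p a x * t.j q b x * S c x $ a $ b)" if x: "x \<in> overlap c c'" for x p q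
    proof -
      have "t.J x powr (w + \<delta>) * (1 / 2 * S c' (transition c c' x) $ p $ q) =
          (\<Sum>a\<in>UNIV. \<Sum>b\<in>UNIV. 1 / 2 * S c x $ a $ b * (t.j p a x * t.j q b x)) * t.J x powr w"
        using arg_cong[OF tr(1)[OF x], of "\<lambda>M. M $ p $ q"] by (simp add: t.pull2_def)
      also have "\<dots> = 1 / 2 * (t.J x powr w * (\<Sum>a\<in>UNIV. \<Sum>b\<in>UNIV. t.j p a x * t.j q b x * S c x $ a $ b))"
        by (simp add: sum_distrib_left sum_distrib_right mult_ac)
      finally have "t.J x powr w * (t.J x powr \<delta> * S c' (transition c c' x) $ p $ q) =
          t.J x powr w * (\<Sum>a\<in>UNIV. \<Sum>b\<in>UNIV. t.j p a x * t.j q b x * S c x $ a $ b)"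
        by (simp add: powr_add)
      then have e: "t.J x powr \<delta> * S c' (transition c c' x) $ p $ q =
          (\<Sum>a\<in>UNIV. \<Sum>b\<in>UNIV. t.j p a x * t.j q b x * S c x $ a $ b)"
        using J0[OF x, of w] by simp
      show ?thesis
        unfolding e[symmetric] using t.powr_inverse[OF x, of \<delta>] by (simp add: mult.assoc[symmetric] mult.commute)
    qed
    note smU = smooth_on_subset[OF smooth(1)[OF c(1)] sub] smooth_on_subset[OF smooth(2)[OF c(1)] sub]
      smooth(1)[OF c(2)] smooth(2)[OF c(2)]
    have \<gamma>_law: "\<gamma> c' (transition c c' x) $ p = t.J x powr (- \<delta>) *
        (\<Sum>a\<in>UNIV. t.j p a x * (\<gamma> c x $ a + (\<Sum>b\<in>UNIV. S c x $ a $ b * pd b t.l x)))" if x: "x \<in> overlap c c'" for x p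
    proof -
      have "1 / 2 * (2 * w + \<delta> - 1) * t.J x powr (w + \<delta>) * (\<gamma> c' (transition c c' x) $ p - t.J x powr (- \<delta>) *
        (\<Sum>a\<in>UNIV. t.j p a x * (\<gamma> c x $ a + (\<Sum>b\<in>UNIV. S c x $ a $ b * pd b t.l x)))) = 0"
        using t.coef1_transform[OF coord_range_open[OF c(2)] transition_image[OF c(1)] smU symU S_law x, of w p]
          arg_cong[OF tr(2)[OF x], of "\<lambda>v. v $ p"] by simp
      then show ?thesis using w(3) J0[OF x, of "w + \<delta>"] by simp
    qed
    have \<theta>_law: "\<theta> c' (transition c c' x) = t.J x powr (- \<delta>) * (\<theta> c x + 2 * (\<Sum>a\<in>UNIV. \<gamma> c x $ a * pd a t.l x)
        + (\<Sum>a\<in>UNIV. \<Sum>b\<in>UNIV. pd a t.l x * S c x $ a $ b * pd b t.l x))" if x: "x \<in> overlap c c'" for x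
    proof -
      have "1 / 2 * (w * (w + \<delta> - 1)) * t.J x powr (w + \<delta>) * (\<theta> c' (transition c c' x) - t.J x powr (- \<delta>) *
        (\<theta> c x + 2 * (\<Sum>a\<in>UNIV. \<gamma> c x $ a * pd a t.l x) + (\<Sum>a\<in>UNIV. \<Sum>b\<in>UNIV. pd a t.l x * S c x $ a $ b * pd b t.l x))) = 0"
        using t.coef0_transform[OF coord_range_open[OF c(2)] transition_image[OF c(1)] smU symU S_law \<gamma>_law x, of w "\<theta> c'" "\<theta> c"]
          tr(3)[OF x] by simp
      then show ?thesis using w(1,2) J0[OF x, of "w + \<delta>"] by simp
    qed
    show ?thesis
      unfolding J l using S_law \<gamma>_law \<theta>_law by (simp add: j)
  qed
  show "principal_symbol A \<delta> S"
    unfolding principal_symbol_def using smooth sym laws by blast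
  show "upper_connection A \<delta> S \<gamma>"
    unfolding upper_connection_def using smooth laws by blast
  show "brans_dicke_function A \<delta> S \<gamma> \<theta>"
    unfolding brans_dicke_function_def using smooth laws by blast
qed

text \<open>Fields are total functions whose values outside the atlas and the coordinate ranges are
  arbitrary, so uniqueness can only mean equality on coordinate ranges.\<close>

definition agree :: "('m, 'n) tensor_field \<Rightarrow> ('m, 'n) vector_field \<Rightarrow> ('m, 'n) scalar_field \<Rightarrow>
    ('m, 'n) tensor_field \<Rightarrow> ('m, 'n) vector_field \<Rightarrow> ('m, 'n) scalar_field \<Rightarrow> bool" where
  "agree S \<gamma> \<theta> S' \<gamma>' \<theta>' \<longleftrightarrow>
     (\<forall>c\<in>A. \<forall>x\<in>coord_range c. S' c x = S c x \<and> \<gamma>' c x = \<gamma> c x \<and> \<theta>' c x = \<theta> c x)"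

text \<open>Agreement on an open coordinate range includes agreement of the divergences, and
  operators are determined by their values there because they are extensional and densities vanish
  elsewhere.\<close>

lemma canonical_pencil_unique:
  assumes D: "canonical_pencil A \<delta> S \<gamma> \<theta> D" and D': "canonical_pencil A \<delta> S' \<gamma>' \<theta>' D'"
    and agree: "agree S \<gamma> \<theta> S' \<gamma>' \<theta>'"
  shows "D' = D"
proof
  fix w
  show "D' w = D w"
  proof (rule operators_eqI[OF canonical_pencilD(1)[OF D'] canonical_pencilD(1)[OF D]])
    fix s c x assume s: "s \<in> densities A w" and c: "c \<in> A" and x: "x \<in> coord_range c"
    have eq: "S' c y = S c y" "\<gamma>' c y = \<gamma> c y" "\<theta>' c y = \<theta> c y" if "y \<in> coord_range c" for y
      using agree c that unfolding agree_def by blast+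
    have "tensor_divergence (S' c) x = tensor_divergence (S c) x" "divergence (\<gamma>' c) x = divergence (\<gamma> c) x"
      using tensor_divergence_cong[OF coord_range_open[OF c] x eq(1)] divergence_cong[OF coord_range_open[OF c] x eq(2)] by auto
    then have "coef1 w \<delta> (S' c) (\<gamma>' c) x = coef1 w \<delta> (S c) (\<gamma> c) x" "coef0 w \<delta> (\<gamma>' c) (\<theta>' c) x = coef0 w \<delta> (\<gamma> c) (\<theta> c) x"
      by (simp_all add: coef1_def coef0_def eq[OF x])
    moreover have "D' w s c x = op2 (\<lambda>x. (1 / 2) *\<^sub>R S' c x) (coef1 w \<delta> (S' c) (\<gamma>' c)) (coef0 w \<delta> (\<gamma>' c) (\<theta>' c)) (s c) x"
      "D w s c x = op2 (\<lambda>x. (1 / 2) *\<^sub>R S c x) (coef1 w \<delta> (S c) (\<gamma> c)) (coef0 w \<delta> (\<gamma> c) (\<theta> c)) (s c) x"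
      using canonical_pencilD(6)[OF D c, of w] canonical_pencilD(6)[OF D' c, of w] s x unfolding local_form_def by blast+
    ultimately show "D' w s c x = D w s c x" by (simp add: op2_def eq[OF x])
  qed
qed

lemma coefficient_relations_iff:
  "coefficient_relations A \<delta> w A2 A1 A0 S \<gamma> \<theta> \<longleftrightarrow> (\<forall>c\<in>A. \<forall>x\<in>coord_range c.
     (1 / 2) *\<^sub>R S c x = A2 c x \<and> coef1 w \<delta> (S c) (\<gamma> c) x = A1 c x \<and> coef0 w \<delta> (\<gamma> c) (\<theta> c) x = A0 c x)"
proof -
  have "(\<forall>a. 1 / 2 * ((2 * w + \<delta> - 1) * \<gamma> c x $ a + tensor_divergence (S c) x $ a) = A1 c x $ a) \<longleftrightarrow>
      coef1 w \<delta> (S c) (\<gamma> c) x = A1 c x" for c x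
    by (simp add: coef1_def vec_eq_iff add.commute)
  moreover have "(\<forall>a b. 1 / 2 * S c x $ a $ b = A2 c x $ a $ b) \<longleftrightarrow> (1 / 2) *\<^sub>R S c x = A2 c x" for c x
    by (simp add: vec_eq_iff)
  ultimately show ?thesis by (simp add: coefficient_relations_def coef0_def)
qed

text \<open>The relations are solved from the top order down. \<open>S\<close> and then
  \<open>\<gamma>\<close> are compared on the entire coordinate range, because the next relation
  contains their derivatives.\<close>

lemma coefficient_relations_unique:
  assumes rel: "coefficient_relations A \<delta> w A2 A1 A0 S \<gamma> \<theta>" "coefficient_relations A \<delta> w A2 A1 A0 S' \<gamma>' \<theta>'"
    and w: "w \<noteq> 0" "w + \<delta> - 1 \<noteq> 0" "2 * w + \<delta> - 1 \<noteq> 0"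
  shows "agree S \<gamma> \<theta> S' \<gamma>' \<theta>'"
  unfolding agree_def
proof (intro ballI)
  fix c x assume c: "c \<in> A" and x: "x \<in> coord_range c"
  note U = coord_range_open[OF c]
  have r: "(1 / 2) *\<^sub>R S c y = A2 c y" "coef1 w \<delta> (S c) (\<gamma> c) y = A1 c y" "coef0 w \<delta> (\<gamma> c) (\<theta> c) y = A0 c y"
    "(1 / 2) *\<^sub>R S' c y = A2 c y" "coef1 w \<delta> (S' c) (\<gamma>' c) y = A1 c y" "coef0 w \<delta> (\<gamma>' c) (\<theta>' c) y = A0 c y"
    if "y \<in> coord_range c" for y
    using rel c that unfolding coefficient_relations_iff by blast+
  have S: "S' c y = S c y" if "y \<in> coord_range c" for y
  proof -
    have "(1 / 2) *\<^sub>R S' c y = (1 / 2) *\<^sub>R S c y" using r(1,4)[OF that] by simp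
    then show ?thesis by (subst (asm) scaleR_cancel_left) simp
  qed
  have \<gamma>: "\<gamma>' c y = \<gamma> c y" if y: "y \<in> coord_range c" for y
  proof -
    have "coef1 w \<delta> (S' c) (\<gamma>' c) y = coef1 w \<delta> (S c) (\<gamma> c) y" using r(2,5)[OF y] by simp
    moreover have "tensor_divergence (S' c) y = tensor_divergence (S c) y" by (rule tensor_divergence_cong[OF U y S])
    ultimately have "(2 * w + \<delta> - 1) *\<^sub>R \<gamma>' c y = (2 * w + \<delta> - 1) *\<^sub>R \<gamma> c y"
      by (simp add: coef1_def)
    then show ?thesis using w(3) by (simp only: scaleR_cancel_left) simp
  qed
  have "coef0 w \<delta> (\<gamma>' c) (\<theta>' c) x = coef0 w \<delta> (\<gamma> c) (\<theta> c) x" using r(3,6)[OF x] by simp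
  moreover have "divergence (\<gamma>' c) x = divergence (\<gamma> c) x" by (rule divergence_cong[OF U x \<gamma>])
  ultimately have "\<theta>' c x = \<theta> c x" using w(1,2) by (simp add: coef0_def)
  then show "S' c x = S c x \<and> \<gamma>' c x = \<gamma> c x \<and> \<theta>' c x = \<theta> c x" using S[OF x] \<gamma>[OF x] by simp
qed

lemma pencil_through_operator:
  assumes T: "T \<in> operators A \<delta> w"
    and forms: "\<And>c. c \<in> A \<Longrightarrow> local_form A w T c (A2 c) (A1 c) (A0 c)"
    and sym: "\<And>c x a b. c \<in> A \<Longrightarrow> x \<in> coord_range c \<Longrightarrow> A2 c x $ a $ b = A2 c x $ b $ a"
    and w: "w \<noteq> 0" "w + \<delta> - 1 \<noteq> 0" "2 * w + \<delta> - 1 \<noteq> 0"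
  obtains S \<gamma> \<theta> D where "coefficient_relations A \<delta> w A2 A1 A0 S \<gamma> \<theta>"
    "principal_symbol A \<delta> S" "upper_connection A \<delta> S \<gamma>" "brans_dicke_function A \<delta> S \<gamma> \<theta>"
    "canonical_pencil A \<delta> S \<gamma> \<theta> D"
    "\<And>D'. normalized_self_adjoint_pencil A \<delta> D' \<and> D' w = T \<longleftrightarrow> D' = D"
proof -
  define S where "S c x = 2 *\<^sub>R A2 c x" for c x
  \<comment> \<open>This and the next line solve the first-order and zeroth-order relations at the
    weight \<open>w\<close>; the divisors are nonzero by the assumptions on
    \<open>w\<close>.\<close>
  define \<gamma> where "\<gamma> c x = (1 / (2 * w + \<delta> - 1)) *\<^sub>R (2 *\<^sub>R A1 c x - tensor_divergence (S c) x)" for c x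
  define \<theta> where "\<theta> c x = (1 / (w * (w + \<delta> - 1))) * (2 * A0 c x - w * divergence (\<gamma> c) x)" for c x
  have smA: "smooth_on (A2 c) (coord_range c)" "smooth_on (A1 c) (coord_range c)" "smooth_on (A0 c) (coord_range c)" if "c \<in> A" for c
    using forms[OF that] by (simp_all add: local_form_def)
  have smS: "smooth_on (S c) (coord_range c)" if c: "c \<in> A" for c
    unfolding S_def[abs_def] by (rule smooth_on_scale[OF coord_range_open[OF c] smA(1)[OF c]])
  have sm\<gamma>: "smooth_on (\<gamma> c) (coord_range c)" if c: "c \<in> A" for c
    unfolding \<gamma>_def[abs_def]
    by (intro smooth_on_scale smooth_on_diff smooth_on_tensor_divergence coord_range_open[OF c] smA(2)[OF c] smS[OF c])
  have sm\<theta>: "smooth_on (\<theta> c) (coord_range c)" if c: "c \<in> A" for c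
    unfolding \<theta>_def[abs_def]
    by (intro smooth_on_mult smooth_on_const smooth_on_diff smooth_on_divergence coord_range_open[OF c] smA(3)[OF c] sm\<gamma>[OF c])
  have symS: "S c x $ a $ b = S c x $ b $ a" if "c \<in> A" "x \<in> coord_range c" for c x a b
    using sym[OF that, of a b] by (simp add: S_def)
  have c2: "(1 / 2) *\<^sub>R S c x = A2 c x" for c x by (simp add: S_def)
  have c1: "coef1 w \<delta> (S c) (\<gamma> c) x = A1 c x" for c x
    using w(3) by (simp add: coef1_def \<gamma>_def)
  have c0: "coef0 w \<delta> (\<gamma> c) (\<theta> c) x = A0 c x" for c x
    using w(1,2) by (simp add: coef0_def \<theta>_def)
  have eqs: "(\<lambda>x. (1 / 2) *\<^sub>R S c x) = A2 c" "coef1 w \<delta> (S c) (\<gamma> c) = A1 c" "coef0 w \<delta> (\<gamma> c) (\<theta> c) = A0 c" for c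
    by (rule ext, rule c2, rule ext, rule c1, rule ext, rule c0)
  have rel: "coefficient_relations A \<delta> w A2 A1 A0 S \<gamma> \<theta>"
    unfolding coefficient_relations_iff using c2 c1 c0 by blast
  have laws: "principal_symbol A \<delta> S" "upper_connection A \<delta> S \<gamma>" "brans_dicke_function A \<delta> S \<gamma> \<theta>"
    by (rule transformation_laws[OF T smS sm\<gamma> sm\<theta> symS _ w]; simp add: eqs forms)+
  obtain D where D: "canonical_pencil A \<delta> S \<gamma> \<theta> D"
    using canonical_pencil_exists[OF laws] by blast
  have "D w = T"
  proof (rule operators_eqI[OF canonical_pencilD(1)[OF D] T])
    fix s c x assume s: "s \<in> densities A w" and c: "c \<in> A" and x: "x \<in> coord_range c"
    show "D w s c x = T s c x"
      using canonical_pencilD(6)[OF D c, of w] forms[OF c] s x unfolding eqs local_form_def by simp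
  qed
  \<comment> \<open>A competing pencil is canonical for some triple. Its member at weight
    \<open>w\<close> is \<open>T\<close>, so uniqueness of local forms makes that triple satisfy the
    same coefficient relations.\<close>
  have "D' = D" if D': "normalized_self_adjoint_pencil A \<delta> D'" "D' w = T" for D'
  proof -
    obtain S' \<gamma>' \<theta>' where can: "canonical_pencil A \<delta> S' \<gamma>' \<theta>' D'"
      using D'(1) normalized_self_adjoint_iff by blast
    have "coefficient_relations A \<delta> w A2 A1 A0 S' \<gamma>' \<theta>'"
      unfolding coefficient_relations_iff
    proof (intro ballI)
      fix c x assume c: "c \<in> A" and x: "x \<in> coord_range c"
      have l: "local_form A w T c (\<lambda>x. (1 / 2) *\<^sub>R S' c x) (coef1 w \<delta> (S' c) (\<gamma>' c)) (coef0 w \<delta> (\<gamma>' c) (\<theta>' c))"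
        using canonical_pencilD(6)[OF can c, of w] D'(2) by simp
      have "((1 / 2) *\<^sub>R S' c x) $ a $ b = ((1 / 2) *\<^sub>R S' c x) $ b $ a" for a b
        using canonical_pencilD(5)[OF can c x, of a b] by simp
      from local_form_unique[OF c l forms[OF c] this sym[OF c x] x]
      show "(1 / 2) *\<^sub>R S' c x = A2 c x \<and> coef1 w \<delta> (S' c) (\<gamma>' c) x = A1 c x \<and> coef0 w \<delta> (\<gamma>' c) (\<theta>' c) x = A0 c x"
        by blast
    qed
    from canonical_pencil_unique[OF D can coefficient_relations_unique[OF rel this w]]
    show ?thesis .
  qed
  then have "normalized_self_adjoint_pencil A \<delta> D' \<and> D' w = T \<longleftrightarrow> D' = D" for D'
    using canonical_imp_normalized_self_adjoint[OF D] \<open>D w = T\<close> by blast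
  then show thesis using that[OF rel laws D] by blast
qed

end

theorem theorem1:
  fixes X :: "'m topology"
    and A :: "('m, 'n::finite) chart set"
    and w0 \<delta> \<mu>0 :: real
    and \<Delta> :: "('m, 'n) operator"
  assumes "compact_oriented_manifold X A"
    and "\<mu>0 = w0 + \<delta>"
    and "second_order_operator A \<delta> w0 \<Delta>"
    and "w0 \<noteq> 0" and "\<mu>0 \<noteq> 1" and "w0 + \<mu>0 \<noteq> 1"
  shows
    "(\<exists>!D. normalized_self_adjoint_pencil A \<delta> D \<and> D w0 = \<Delta>) \<and>
     (\<forall>D. normalized_self_adjoint_pencil A \<delta> D \<longleftrightarrow> (\<exists>S \<gamma> \<theta>. canonical_pencil A \<delta> S \<gamma> \<theta> D)) \<and>
     (\<forall>A2 A1 A0.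
        (\<forall>c\<in>A. local_form A w0 \<Delta> c (A2 c) (A1 c) (A0 c) \<and>
           (\<forall>x\<in>coord_range c. \<forall>a b. A2 c x $ a $ b = A2 c x $ b $ a)) \<longrightarrow>
        (\<exists>S \<gamma> \<theta>.
           coefficient_relations A \<delta> w0 A2 A1 A0 S \<gamma> \<theta> \<and>
           (\<forall>S' \<gamma>' \<theta>'. coefficient_relations A \<delta> w0 A2 A1 A0 S' \<gamma>' \<theta>' \<longrightarrow>
              (\<forall>c\<in>A. \<forall>x\<in>coord_range c. S' c x = S c x \<and> \<gamma>' c x = \<gamma> c x \<and> \<theta>' c x = \<theta> c x)) \<and>
           principal_symbol A \<delta> S \<and> upper_connection A \<delta> S \<gamma> \<and> brans_dicke_function A \<delta> S \<gamma> \<theta> \<and>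
           (\<forall>D. normalized_self_adjoint_pencil A \<delta> D \<and> D w0 = \<Delta> \<longleftrightarrow>
              canonical_pencil A \<delta> S \<gamma> \<theta> D)))"
proof -
  interpret compact_oriented X A
    using assms(1) by unfold_locales
  \<comment> \<open>In terms of \<open>w0\<close> and \<open>\<delta>\<close>, the conditions on
    \<open>\<mu>0\<close> say that the remaining divisors are nonzero.\<close>
  have w: "w0 \<noteq> 0" "w0 + \<delta> - 1 \<noteq> 0" "2 * w0 + \<delta> - 1 \<noteq> 0"
    using assms by auto
  have T: "\<Delta> \<in> operators A \<delta> w0" and loc: "is_local w0 \<Delta>"
    using assms(3) by (auto simp: second_order_operator_def is_local_def)
  have forms: "\<exists>A2 A1 A0. \<forall>c\<in>A. local_form A w0 \<Delta> c (A2 c) (A1 c) (A0 c) \<and>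
           (\<forall>x\<in>coord_range c. \<forall>a b. A2 c x $ a $ b = A2 c x $ b $ a)"
  proof -
    define good where "good c P V W \<longleftrightarrow> local_form A w0 \<Delta> c P V W \<and>
      (\<forall>x\<in>coord_range c. \<forall>a b. P x $ a $ b = P x $ b $ a)" for c P V W
    have "\<exists>P V W. good c P V W" if "c \<in> A" for c
      unfolding good_def by (rule is_localD[OF loc that]) blast
    then obtain P where "\<And>c. c \<in> A \<Longrightarrow> \<exists>V W. good c (P c) V W" by metis
    then obtain V where "\<And>c. c \<in> A \<Longrightarrow> \<exists>W. good c (P c) (V c) W" by metis
    then obtain W where "\<And>c. c \<in> A \<Longrightarrow> good c (P c) (V c) (W c)" by metis
    then show ?thesis unfolding good_def by blast
  qed
  show ?thesis
  \<comment> \<open>The characterization of normalized self-adjoint pencils is closed by the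
    introduction itself; unique existence and the claim about coefficients remain.\<close>
  proof (intro conjI allI impI normalized_self_adjoint_iff, goal_cases)
    case 1
    obtain A2 A1 A0 where l: "\<forall>c\<in>A. local_form A w0 \<Delta> c (A2 c) (A1 c) (A0 c) \<and>
        (\<forall>x\<in>coord_range c. \<forall>a b. A2 c x $ a $ b = A2 c x $ b $ a)"
      using forms by blast
    obtain S \<gamma> \<theta> D where "\<And>D'. normalized_self_adjoint_pencil A \<delta> D' \<and> D' w0 = \<Delta> \<longleftrightarrow> D' = D"
      by (rule pencil_through_operator[OF T _ _ w, of A2 A1 A0]) (use l in blast)+
    then show ?case by simp
  next
    case (2 A2 A1 A0)
    obtain S \<gamma> \<theta> D where rel: "coefficient_relations A \<delta> w0 A2 A1 A0 S \<gamma> \<theta>"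
      and laws: "principal_symbol A \<delta> S" "upper_connection A \<delta> S \<gamma>" "brans_dicke_function A \<delta> S \<gamma> \<theta>"
      and D: "canonical_pencil A \<delta> S \<gamma> \<theta> D"
      and iff: "\<And>D'. normalized_self_adjoint_pencil A \<delta> D' \<and> D' w0 = \<Delta> \<longleftrightarrow> D' = D"
      by (rule pencil_through_operator[OF T _ _ w, of A2 A1 A0]) (use 2 in blast)+
    \<comment> \<open>A triple determines its canonical pencil, so being equal to \<open>D\<close>
      and being canonical for this triple are the same condition.\<close>
    have "D' = D \<longleftrightarrow> canonical_pencil A \<delta> S \<gamma> \<theta> D'" for D'
      using D canonical_pencil_unique[OF D, of S \<gamma> \<theta> D'] by (auto simp: agree_def)
    then show ?case
      using rel laws iff coefficient_relations_unique[OF rel _ w] unfolding agree_def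
      by (intro exI[of _ S] exI[of _ \<gamma>] exI[of _ \<theta>]) blast
  qed
qed

end
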